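(* Let $N\ge1$, $0<\alpha<1$ and $\lambda\in\mathbb{C}\setminus\{0\}$. There exists an initial value $u_0\in C^\infty_c(\mathbb{R}^N)$ such that the corresponding maximal solution $u\in C([0,T_{\max}),C_0(\mathbb{R}^N))$ of $$u_t=\Delta u+\lambda|u|^\alpha u,\qquad u(0,\cdot)=u_0,$$ does not belong to $L^1((0,T),H^{s,p}(\mathbb{R}^N))$ whenever $1<p<\infty$, $s>3+\frac{N}{p}+\alpha$ and $0<T<T_{\max}$.
   Context: All functions are complex-valued. $C_0(\mathbb{R}^N)$ is the space of continuous functions on $\mathbb{R}^N$ vanishing at infinity, with the sup norm. $C^\infty_c(\mathbb{R}^N)$ is the space of smooth compactly supported functions. For $s\ge0$ and $1<p<\infty$, $H^{s,p}(\mathbb{R}^N)$ is the usual Sobolev (Bessel potential) space with norm $\|u\|_{H^{s,p}}=\|\mathcal{F}^{-1}[(1+|\xi|^2)^{s/2}\widehat{u}]\|_{L^p}$. The Cauchy problem is locally well posed in $C_0(\mathbb{R}^N)$: for every $u_0\in C_0(\mathbb{R}^N)$ there exist a maximal existence time $T_{\max}=T_{\max}(u_0)\in(0,\infty]$ and a unique maximal solution $u\in C([0,T_{\max}),C_0(\mathbb{R}^N))$, i.e. a solution of $u(t)=e^{t\Delta}u_0+\lambda\int_0^t e^{(t-\sigma)\Delta}(|u(\sigma)|^\alpha u(\sigma))\,d\sigma$, where $(e^{t\Delta})_{t\ge0}$ is the heat semigroup on $\mathbb{R}^N$. *)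

theory Defs
  imports "HOL-Analysis.Analysis" "HOL-Probability.Distributions"
begin

subsection \<open>Smooth functions, test functions, Schwartz functions\<close>

text \<open>A list of basis vectors plays the role of a multi-index: \<open>iter_deriv [e1, ..., ek] f\<close> is
  the iterated partial derivative of \<open>f\<close> in the directions \<open>ek, ..., e1\<close>.\<close>

primrec iter_deriv ::
  "'a list \<Rightarrow> ('a::euclidean_space \<Rightarrow> complex) \<Rightarrow> 'a \<Rightarrow> complex" where
  "iter_deriv [] f = f"
| "iter_deriv (e # es) f = (\<lambda>x. frechet_derivative (iter_deriv es f) (at x) e)"

definition smooth :: "('a::euclidean_space \<Rightarrow> complex) \<Rightarrow> bool" where
  "smooth f \<longleftrightarrow> (\<forall>es x. set es \<subseteq> Basis \<longrightarrow> iter_deriv es f differentiable (at x))"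

definition Cc_smooth :: "('a::euclidean_space \<Rightarrow> complex) set" where
  "Cc_smooth = {f. smooth f \<and> compact (closure {x. f x \<noteq> 0})}"

definition schwartz :: "('a::euclidean_space \<Rightarrow> complex) set" where
  "schwartz = {f. smooth f \<and>
     (\<forall>k es. set es \<subseteq> Basis \<longrightarrow> bounded (range (\<lambda>x. (1 + norm x) ^ k *\<^sub>R iter_deriv es f x)))}"

definition schwartz_seminorm ::
  "nat \<Rightarrow> 'a list \<Rightarrow> ('a::euclidean_space \<Rightarrow> complex) \<Rightarrow> real" where
  "schwartz_seminorm k es f = (SUP x. (1 + norm x) ^ k * norm (iter_deriv es f x))"


subsection \<open>Tempered distributions and the Fourier transform\<close>

text \<open>A tempered distribution is represented by a functional on all functions, of which only the
  values on Schwartz functions matter.\<close>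

type_synonym 'a functional = "('a \<Rightarrow> complex) \<Rightarrow> complex"

definition tempered_distribution :: "('a::euclidean_space) functional \<Rightarrow> bool" where
  "tempered_distribution L \<longleftrightarrow>
     (\<forall>f\<in>schwartz. \<forall>g\<in>schwartz. \<forall>a b.
        L (\<lambda>x. a * f x + b * g x) = a * L f + b * L g) \<and>
     (\<exists>C k. \<forall>f\<in>schwartz.
        norm (L f) \<le> C * (\<Sum>es | set es \<subseteq> Basis \<and> length es \<le> k. schwartz_seminorm k es f))"

definition regular_distribution ::
  "('a::euclidean_space \<Rightarrow> complex) \<Rightarrow> 'a functional" where
  "regular_distribution f = (\<lambda>\<psi>. LINT x|lborel. f x * \<psi> x)"

definition fourier :: "('a::euclidean_space \<Rightarrow> complex) \<Rightarrow> 'a \<Rightarrow> complex" where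
  "fourier f \<xi> = (LINT x|lborel. exp (- (\<i> * complex_of_real (x \<bullet> \<xi>))) * f x)"

definition inv_fourier :: "('a::euclidean_space \<Rightarrow> complex) \<Rightarrow> 'a \<Rightarrow> complex" where
  "inv_fourier f x =
     (LINT \<xi>|lborel. exp (\<i> * complex_of_real (x \<bullet> \<xi>)) * f \<xi>) / (2 * pi) ^ DIM('a)"

text \<open>Operations on tempered distributions, by duality.\<close>

definition fourier_dist :: "('a::euclidean_space) functional \<Rightarrow> 'a functional" where
  "fourier_dist L = (\<lambda>\<psi>. L (fourier \<psi>))"

definition inv_fourier_dist :: "('a::euclidean_space) functional \<Rightarrow> 'a functional" where
  "inv_fourier_dist L = (\<lambda>\<psi>. L (inv_fourier \<psi>))"

definition mult_dist ::
  "('a::euclidean_space \<Rightarrow> complex) \<Rightarrow> 'a functional \<Rightarrow> 'a functional" where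
  "mult_dist m L = (\<lambda>\<psi>. L (\<lambda>x. m x * \<psi> x))"


subsection \<open>Bessel potential spaces\<close>

definition Lp_space :: "real \<Rightarrow> ('a::euclidean_space \<Rightarrow> complex) set" where
  "Lp_space p = {g \<in> borel_measurable lborel. integrable lborel (\<lambda>x. norm (g x) powr p)}"

definition Lp_norm :: "real \<Rightarrow> ('a::euclidean_space \<Rightarrow> complex) \<Rightarrow> real" where
  "Lp_norm p g = (LINT x|lborel. norm (g x) powr p) powr (1 / p)"

definition bessel_potential :: "real \<Rightarrow> ('a::euclidean_space) functional \<Rightarrow> 'a functional" where
  "bessel_potential s L = inv_fourier_dist
     (mult_dist (\<lambda>\<xi>. complex_of_real ((1 + (norm \<xi>)\<^sup>2) powr (s / 2))) (fourier_dist L))"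

definition is_Lp_function ::
  "real \<Rightarrow> ('a::euclidean_space) functional \<Rightarrow> ('a \<Rightarrow> complex) \<Rightarrow> bool" where
  "is_Lp_function p L g \<longleftrightarrow>
     g \<in> Lp_space p \<and> (\<forall>\<psi>\<in>schwartz. L \<psi> = regular_distribution g \<psi>)"

definition Hsp :: "real \<Rightarrow> real \<Rightarrow> ('a::euclidean_space) functional set" where
  "Hsp s p = {L. tempered_distribution L \<and> (\<exists>g. is_Lp_function p (bessel_potential s L) g)}"

text \<open>The representing \<open>g\<close> is unique almost everywhere, so the number below is well defined on
  \<open>Hsp s p\<close>.\<close>

definition Hsp_norm :: "real \<Rightarrow> real \<Rightarrow> ('a::euclidean_space) functional \<Rightarrow> real" where
  "Hsp_norm s p L =
     (THE r. \<exists>g. is_Lp_function p (bessel_potential s L) g \<and> r = Lp_norm p g)"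

text \<open>Membership in the Bochner space \<open>L\<^sup>1((0,T), H\<^sup>s\<^sup>,\<^sup>p)\<close>: strong measurability (almost everywhere
  approximation by simple functions in the norm of \<open>H\<^sup>s\<^sup>,\<^sup>p\<close>) and integrability of the norm.\<close>

definition L1_Hsp ::
  "real \<Rightarrow> real \<Rightarrow> real \<Rightarrow> (real \<Rightarrow> ('a::euclidean_space) functional) \<Rightarrow> bool" where
  "L1_Hsp s p T U \<longleftrightarrow>
     (AE t in lebesgue_on {0<..<T}. U t \<in> Hsp s p) \<and>
     (\<exists>\<phi>. (\<forall>n. simple_function (lebesgue_on {0<..<T}) (\<phi> n) \<and>
                (\<forall>t\<in>{0<..<T}. \<phi> n t \<in> Hsp s p)) \<and>
          (AE t in lebesgue_on {0<..<T}.
             (\<lambda>n. Hsp_norm s p (\<lambda>\<psi>. U t \<psi> - \<phi> n t \<psi>)) \<longlonglongrightarrow> 0)) \<and>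
     (\<integral>\<^sup>+ t. ennreal (Hsp_norm s p (U t)) \<partial>lebesgue_on {0<..<T}) < \<infinity>"


subsection \<open>The nonlinear heat equation in \<open>C\<^sub>0\<close>\<close>

definition C0 :: "('a::euclidean_space \<Rightarrow>\<^sub>C complex) set" where
  "C0 = {f. (apply_bcontfun f \<longlongrightarrow> 0) at_infinity}"

definition heat_kernel :: "real \<Rightarrow> 'a::euclidean_space \<Rightarrow> real" where
  "heat_kernel t y = (4 * pi * t) powr (- real DIM('a) / 2) * exp (- (norm y)\<^sup>2 / (4 * t))"

definition heat_semigroup ::
  "real \<Rightarrow> ('a::euclidean_space \<Rightarrow>\<^sub>C complex) \<Rightarrow> ('a \<Rightarrow>\<^sub>C complex)" where
  "heat_semigroup t f =
     (if 0 < t then Bcontfun (\<lambda>x. LINT y|lborel. heat_kernel t y *\<^sub>R f (x - y)) else f)"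

definition power_nonlin ::
  "real \<Rightarrow> ('a::euclidean_space \<Rightarrow>\<^sub>C complex) \<Rightarrow> ('a \<Rightarrow>\<^sub>C complex)" where
  "power_nonlin \<alpha> f = Bcontfun (\<lambda>x. complex_of_real (norm (f x) powr \<alpha>) * f x)"

text \<open>Both uses of \<open>Bcontfun\<close> are legitimate.\<close>

lemma integrable_gauss_euclidean:
  assumes "0 < c"
  shows "integrable lborel (\<lambda>y::'a::euclidean_space. exp (- (norm y)\<^sup>2 / c))"
proof (rule integrableI_nonneg)
  have 1: "(\<integral>\<^sup>+ x. ennreal (exp (- x\<^sup>2 / c)) \<partial>lborel) < \<infinity>" for b :: 'a
  proof -
    have "integrable lborel (\<lambda>x. sqrt (2 * pi * (sqrt (c/2))\<^sup>2) * normal_density 0 (sqrt (c/2)) x)"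
      using assms by (intro integrable_mult_right integrable_normal_density) auto
    also have "(\<lambda>x. sqrt (2 * pi * (sqrt (c/2))\<^sup>2) * normal_density 0 (sqrt (c/2)) x)
        = (\<lambda>x. exp (- x\<^sup>2 / c))"
      using assms by (auto simp: normal_density_def fun_eq_iff)
    finally show ?thesis
      by (subst (asm) integrable_iff_bounded) auto
  qed
  have "(\<integral>\<^sup>+ (y::'a). ennreal (exp (- (norm y)\<^sup>2 / c)) \<partial>lborel)
      = (\<integral>\<^sup>+ (y::'a). (\<Prod>b\<in>Basis. ennreal (exp (- (y \<bullet> b)\<^sup>2 / c))) \<partial>lborel)"
  proof (rule nn_integral_cong)
    fix y :: 'a
    have "(norm y)\<^sup>2 = (\<Sum>b\<in>Basis. (y \<bullet> b)\<^sup>2)"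
      unfolding power2_norm_eq_inner by (subst euclidean_inner) (simp add: power2_eq_square)
    then have "exp (- (norm y)\<^sup>2 / c) = (\<Prod>b\<in>Basis. exp (- (y \<bullet> b)\<^sup>2 / c))"
      by (simp add: exp_sum[symmetric] sum_negf sum_divide_distrib)
    then show "ennreal (exp (- (norm y)\<^sup>2 / c)) = (\<Prod>b\<in>Basis. ennreal (exp (- (y \<bullet> b)\<^sup>2 / c)))"
      by (simp add: prod_ennreal)
  qed
  also have "\<dots> = (\<Prod>b\<in>(Basis::'a set). (\<integral>\<^sup>+ x. ennreal (exp (- x\<^sup>2 / c)) \<partial>lborel))"
    by (intro nn_integral_lborel_prod) auto
  also have "\<dots> < \<infinity>"
    using 1 by (simp add: power_less_top_ennreal)
  finally show "(\<integral>\<^sup>+ (y::'a). ennreal (exp (- (norm y)\<^sup>2 / c)) \<partial>lborel) < \<infinity>" .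
qed auto

lemma integrable_heat_kernel:
  "0 < t \<Longrightarrow> integrable lborel (heat_kernel t :: 'a::euclidean_space \<Rightarrow> real)"
  unfolding heat_kernel_def[abs_def]
  by (intro integrable_mult_right integrable_gauss_euclidean) auto

lemma apply_heat_semigroup:
  fixes f :: "'a::euclidean_space \<Rightarrow>\<^sub>C complex"
  assumes t: "0 < t"
  shows "heat_semigroup t f x = (LINT y|lborel. heat_kernel t y *\<^sub>R f (x - y))"
proof -
  obtain B where B: "\<And>x. norm (f x) \<le> B"
    using bounded_apply_bcontfun[of f] unfolding bounded_iff by auto
  have fm: "apply_bcontfun f \<in> borel_measurable borel"
    by (intro borel_measurable_continuous_onI) auto
  have [measurable]: "(heat_kernel t :: 'a \<Rightarrow> real) \<in> borel_measurable borel"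
    using borel_measurable_integrable[OF integrable_heat_kernel[OF t, where 'a='a]] by simp
  have [measurable]: "(\<lambda>y. f (x - y)) \<in> borel_measurable borel" for x
    using fm by measurable
  have int: "integrable lborel (\<lambda>y::'a. heat_kernel t y * B)"
    by (intro integrable_mult_left integrable_heat_kernel t)
  have K0: "0 \<le> heat_kernel t y" for y :: 'a
    by (simp add: heat_kernel_def)
  have bd: "norm (heat_kernel t y *\<^sub>R f (x - y)) \<le> heat_kernel t y * B" for x y
    using K0[of y] B[of "x - y"] by (simp add: mult_left_mono)
  let ?h = "\<lambda>x. LINT y|lborel. heat_kernel t y *\<^sub>R f (x - y)"
  have "isCont ?h x" for x
    unfolding continuous_at_sequentially comp_def
  proof (intro allI impI)
    fix X :: "nat \<Rightarrow> 'a" assume X: "X \<longlonglongrightarrow> x"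
    have "(\<lambda>n. f (X n - y)) \<longlonglongrightarrow> f (x - y)" for y
      using continuous_on_apply_bcontfun[of UNIV f] X
      by (intro continuous_on_tendsto_compose[of UNIV f] tendsto_intros) auto
    then show "(\<lambda>n. ?h (X n)) \<longlonglongrightarrow> ?h x"
      by (intro integral_dominated_convergence[OF _ _ int])
        (auto intro!: tendsto_intros simp del: norm_scaleR simp: bd)
  qed
  then have c: "continuous_on UNIV ?h"
    by (simp add: continuous_on_eq_continuous_at)
  have "norm (?h x) \<le> (LINT y|lborel. heat_kernel t (y::'a) * B)" for x
  proof -
    have "integrable lborel (\<lambda>y. heat_kernel t y *\<^sub>R f (x - y))"
      by (rule Bochner_Integration.integrable_bound[OF int])
        (auto simp del: norm_scaleR intro!: order_trans[OF bd])
    then have "(LINT y|lborel. norm (heat_kernel t y *\<^sub>R f (x - y)))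
        \<le> (LINT y|lborel. heat_kernel t (y::'a) * B)"
      by (intro Bochner_Integration.integral_mono integrable_norm int bd)
    then show ?thesis
      by (rule order_trans[OF integral_norm_bound])
  qed
  then have "bounded (range ?h)"
    unfolding bounded_iff by blast
  with c t show ?thesis
    by (simp add: heat_semigroup_def Bcontfun_inverse bcontfun_def)
qed

lemma apply_power_nonlin:
  fixes f :: "'a::euclidean_space \<Rightarrow>\<^sub>C complex"
  assumes "0 < \<alpha>"
  shows "power_nonlin \<alpha> f x = complex_of_real (norm (f x) powr \<alpha>) * f x"
proof -
  obtain B where B: "\<And>x. norm (f x) \<le> B"
    using bounded_apply_bcontfun[of f] unfolding bounded_iff by auto
  have "continuous_on UNIV (\<lambda>x. complex_of_real (norm (f x) powr \<alpha>) * f x)"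
    using assms by (intro continuous_intros continuous_on_powr') auto
  moreover have "norm (complex_of_real (norm (f x) powr \<alpha>) * f x) \<le> B powr \<alpha> * B" for x
    using B[of x] assms order_trans[OF norm_ge_zero B]
    by (simp add: norm_mult) (intro mult_mono powr_mono2; simp)
  then have "bounded (range (\<lambda>x. complex_of_real (norm (f x) powr \<alpha>) * f x))"
    unfolding bounded_iff by blast
  ultimately show ?thesis
    by (simp add: power_nonlin_def Bcontfun_inverse bcontfun_def)
qed

text \<open>The time integral is that of a function with values in the Banach space of bounded continuous
  functions. The values of \<open>u\<close> outside \<open>[0,T)\<close> are irrelevant.\<close>

definition mild_solution ::
  "real \<Rightarrow> complex \<Rightarrow> ('a::euclidean_space \<Rightarrow>\<^sub>C complex) \<Rightarrow> ereal \<Rightarrow> (real \<Rightarrow> 'a \<Rightarrow>\<^sub>C complex) \<Rightarrow> bool"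
where
  "mild_solution \<alpha> \<kappa> u0 T u \<longleftrightarrow>
     0 < T \<and>
     continuous_on {t. 0 \<le> t \<and> ereal t < T} u \<and>
     (\<forall>t. 0 \<le> t \<and> ereal t < T \<longrightarrow>
        u t \<in> C0 \<and>
        (\<lambda>\<sigma>. heat_semigroup (t - \<sigma>) (power_nonlin \<alpha> (u \<sigma>))) integrable_on {0..t} \<and>
        (\<forall>x. u t x = heat_semigroup t u0 x +
           \<kappa> * integral {0..t} (\<lambda>\<sigma>. heat_semigroup (t - \<sigma>) (power_nonlin \<alpha> (u \<sigma>))) x))"

definition maximal_solution ::
  "real \<Rightarrow> complex \<Rightarrow> ('a::euclidean_space \<Rightarrow>\<^sub>C complex) \<Rightarrow> ereal \<Rightarrow> (real \<Rightarrow> 'a \<Rightarrow>\<^sub>C complex) \<Rightarrow> bool"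
where
  "maximal_solution \<alpha> \<kappa> u0 Tmax u \<longleftrightarrow>
     mild_solution \<alpha> \<kappa> u0 Tmax u \<and>
     (\<forall>T v. mild_solution \<alpha> \<kappa> u0 T v \<and> Tmax \<le> T \<and>
        (\<forall>t. 0 \<le> t \<and> ereal t < Tmax \<longrightarrow> v t = u t) \<longrightarrow> T = Tmax)"

end

theory Submission
  imports Defs "HOL-Probability.Characteristic_Functions" "HOL-Probability.Sinc_Integral"
    "HOL-Real_Asymp.Real_Asymp"
begin

text \<open>In fact \<open>u(t)\<close> is not in \<open>H\<^sup>s\<^sup>,\<^sup>p\<close> for every small \<open>t > 0\<close>. Take a smooth odd datum with
  \<open>u\<^sub>0(x) = b (x \<bullet> e) + o(|x|)\<close> at the origin, where \<open>b > 0\<close>. The solution stays odd and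
  Lipschitz, and \<open>u(\<sigma>,x) = b (x \<bullet> e) + o(|x|)\<close> as \<open>\<sigma>\<close> and \<open>|x|\<close> tend to \<open>0\<close>, so that \<open>|u|^\<alpha> u\<close>
  has at the origin the singularity of \<open>|x \<bullet> e|^\<alpha> (x \<bullet> e)\<close>. It is detected by the functions \<open>E\<^sub>r\<close>
  with Fourier transform \<open>(\<xi> \<bullet> e)^m exp(- r |\<xi>|^2)\<close>, where \<open>m\<close> is odd and large. The heat
  semigroup maps \<open>E\<^sub>r\<close> to \<open>E\<^sub>r\<^sub>+\<^sub>s\<close> in time \<open>s\<close>, hence by Duhamel's formula the pairing of \<open>u(t)\<close>
  with \<open>E\<^sub>r\<close> is the pairing of \<open>u\<^sub>0\<close> with \<open>E\<^sub>r\<^sub>+\<^sub>t\<close> plus \<open>\<kappa>\<close> times the integral over \<open>\<sigma> \<in> [0,t]\<close> of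
  the pairings of \<open>|u|^\<alpha> u(\<sigma>)\<close> with \<open>E\<^sub>r\<^sub>+\<^sub>t\<^sub>-\<^sub>\<sigma>\<close>. For \<open>r = h^2\<close> and \<open>h \<rightarrow> 0\<close> the integral has the
  exact order \<open>h^(3 + \<alpha> - m)\<close>, whereas \<open>u(t) \<in> H\<^sup>s\<^sup>,\<^sup>p\<close> would give the smaller order \<open>h^(s' - N/p -
  m)\<close> for the left-hand side, with any \<open>s' < s\<close> such that \<open>s' > 3 + N/p + \<alpha>\<close>.\<close>

subsection \<open>Integration on Euclidean spaces and the heat kernel\<close>

text \<open>The solution is only known to be odd and Lipschitz in space, so no derivative of it at
  the origin is formed: pairing with \<open>herm\<close> is linear, commutes with the time integral,
  and turns orders of vanishing into powers of h. The number 3 + \<alpha> is a count of powers: |x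
  \<bullet> e|^\<alpha> (x \<bullet> e) is homogeneous of degree 1 + \<alpha>, and the times
  \<sigma> within h^2 of t contribute two further powers of h. Contributions of different \<sigma>
  might cancel in the complex-valued time integral; this is excluded because the deviation from the
  model is at most half of the model term, uniformly in \<sigma>, and the model has the same
  coefficient for every \<sigma>. Oddness fixes u(t,0) = 0 and lets the heat semigroup act on
  differences at x and -x, so that errors are relative to |x|. For even m the model would pair to 0
  by parity; a large m makes the pairing of the datum, which stays bounded because t > 0,
  negligible. Passing from s to s' makes a Gamma integral converge at 0 and is affordable because
  the assumption on s is strict.\<close>

abbreviation fexp :: "'a::euclidean_space \<Rightarrow> 'a \<Rightarrow> complex" where
  "fexp y x \<equiv> exp (- (\<i> * complex_of_real (y \<bullet> x)))"

section \<open>Affine changes of variable in Lebesgue integrals\<close>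

lemma nn_integral_lborel_affine:
  fixes f :: "'a::euclidean_space \<Rightarrow> ennreal"
  assumes [measurable]: "f \<in> borel_measurable borel" and c: "c \<noteq> 0"
  shows "(\<integral>\<^sup>+x. f x \<partial>lborel) = \<bar>c\<bar> ^ DIM('a) * (\<integral>\<^sup>+x. f (t + c *\<^sub>R x) \<partial>lborel)"
  by (subst lborel_affine[OF c, of t])
     (simp add: nn_integral_density nn_integral_distr nn_integral_cmult ennreal_power)

lemma integrable_lborel_affine:
  fixes f :: "'a::euclidean_space \<Rightarrow> 'b::{banach, second_countable_topology}"
  assumes f: "integrable lborel f" and c: "c \<noteq> 0"
  shows "integrable lborel (\<lambda>x. f (t + c *\<^sub>R x))"
proof -
  have [measurable]: "f \<in> borel_measurable borel"
    using borel_measurable_integrable[OF f] by simp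
  show ?thesis
    using f c unfolding integrable_iff_bounded
    by (subst (asm) nn_integral_lborel_affine[where c=c and t=t])
      (auto simp: ennreal_mult_less_top ennreal_power[symmetric])
qed

lemma integrable_lborel_affine_iff:
  fixes f :: "'a::euclidean_space \<Rightarrow> 'b::{banach, second_countable_topology}"
  assumes c: "c \<noteq> 0"
  shows "integrable lborel (\<lambda>x. f (t + c *\<^sub>R x)) \<longleftrightarrow> integrable lborel f"
proof
  assume "integrable lborel (\<lambda>x. f (t + c *\<^sub>R x))"
  from integrable_lborel_affine[OF this, of "1/c" "-(1/c) *\<^sub>R t"] c
  show "integrable lborel f" by (simp add: scaleR_diff_right algebra_simps)
qed (use integrable_lborel_affine c in blast)

lemma integral_lborel_affine:
  fixes f :: "'a::euclidean_space \<Rightarrow> 'b::{banach, second_countable_topology}"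
  assumes c: "c \<noteq> 0"
  shows "(LINT x|lborel. f (t + c *\<^sub>R x)) = (LINT x|lborel. f x) /\<^sub>R \<bar>c\<bar> ^ DIM('a)"
proof (cases "integrable lborel f")
  case True
  have [measurable]: "f \<in> borel_measurable borel"
    using borel_measurable_integrable[OF True] by simp
  have "(LINT x|lborel. f x) = \<bar>c\<bar> ^ DIM('a) *\<^sub>R (LINT x|lborel. f (t + c *\<^sub>R x))"
    by (subst lborel_affine[OF c, of t])
       (simp add: integral_density integral_distr ennreal_power)
  then show ?thesis using c by simp
next
  \<comment> \<open>Integrability is invariant under the substitution, so here both integrals have
    the default value 0 of a non-integrable function.\<close>
  case False
  then show ?thesis
    using integrable_lborel_affine_iff[OF c, of f t] by (simp add: not_integrable_integral_eq)
qed

lemma integral_lborel_reflect: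
  fixes f :: "'a::euclidean_space \<Rightarrow> 'b::{banach, second_countable_topology}"
  shows "(LINT x|lborel. f (a - x)) = (LINT x|lborel. f x)"
  using integral_lborel_affine[of "-1" f a] by simp

lemma integral_lborel_shift:
  fixes f :: "'a::euclidean_space \<Rightarrow> 'b::{banach, second_countable_topology}"
  shows "(LINT x|lborel. f (a + x)) = (LINT x|lborel. f x)"
  using integral_lborel_affine[of "1" f a] by simp

section \<open>Integrability from polynomial decay\<close>

lemma integrable_inverse_one_plus_square: "integrable lborel (\<lambda>x::real. inverse (1 + x\<^sup>2))"
proof -
  let ?f = "\<lambda>x::real. inverse (1 + x\<^sup>2)"
  have "set_integrable lborel {0<..} ?f"
    using integrable_I0i_1_div_plus_square by (simp add: interval_lebesgue_integrable_def
        einterval_def greaterThan_def inverse_eq_divide)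
  then have 1: "integrable lborel (\<lambda>x. indicator {0<..} x *\<^sub>R ?f x)"
    by (simp add: set_integrable_def)
  from lborel_integrable_real_affine[OF 1, of "-1" 0]
  have 2: "integrable lborel (\<lambda>x. indicator {0<..} (-x) *\<^sub>R ?f x)" by simp
  show ?thesis
  proof (rule integrable_cong_AE_imp[OF Bochner_Integration.integrable_add[OF 1 2]])
    show "AE x in lborel. indicator {0<..} x *\<^sub>R ?f x + indicator {0<..} (-x) *\<^sub>R ?f x = ?f x"
      using AE_lborel_singleton[of "0::real"]
      by eventually_elim (auto simp: indicator_def)
  qed auto
qed

text \<open>Each factor 1 + (x \<bullet> b)^2 is at most (1 + |x|)^2, so with 2
  \<open>DIM('a)\<close> powers the weight is dominated by a product of one-dimensional weights and
  Tonelli over the coordinates applies. This is where the exponent 2 \<open>DIM('a)\<close> of the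
  later decay estimates comes from.\<close>

lemma integrable_decay:
  assumes "2 * DIM('a) \<le> k"
  shows "integrable lborel (\<lambda>x::'a::euclidean_space. inverse ((1 + norm x) ^ k))"
proof (rule integrableI_nonneg)
  have 1: "inverse ((1 + norm x) ^ k) \<le> (\<Prod>b\<in>Basis. inverse (1 + (x \<bullet> b)\<^sup>2))" for x :: 'a
  proof -
    have *: "1 + (x \<bullet> b)\<^sup>2 \<le> (1 + norm x)\<^sup>2" if "b \<in> Basis" for b
    proof -
      have "(x \<bullet> b)\<^sup>2 \<le> (norm x)\<^sup>2"
        using Basis_le_norm[OF that, of x] by (metis abs_ge_zero power2_abs power_mono)
      then show ?thesis using norm_ge_zero[of x] by (simp add: power2_sum del: norm_ge_zero)
    qed
    have "(\<Prod>b\<in>(Basis::'a set). 1 + (x \<bullet> b)\<^sup>2) \<le> (\<Prod>b\<in>(Basis::'a set). (1 + norm x)\<^sup>2)"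
      using * by (intro prod_mono) auto
    also have "\<dots> = (1 + norm x) ^ (2 * DIM('a))"
      by (simp add: power_mult)
    also have "\<dots> \<le> (1 + norm x) ^ k"
      using assms by (intro power_increasing) auto
    finally have "inverse ((1 + norm x) ^ k) \<le> inverse (\<Prod>b\<in>(Basis::'a set). 1 + (x \<bullet> b)\<^sup>2)"
      by (intro le_imp_inverse_le prod_pos) (auto intro: add_pos_nonneg)
    then show ?thesis by (simp add: prod_inversef[symmetric] comp_def)
  qed
  have "(\<integral>\<^sup>+ x. ennreal (inverse ((1 + norm (x::'a)) ^ k)) \<partial>lborel)
     \<le> (\<integral>\<^sup>+ (x::'a). (\<Prod>b\<in>Basis. ennreal (inverse (1 + (x \<bullet> b)\<^sup>2))) \<partial>lborel)"
    using 1 by (intro nn_integral_mono) (simp add: prod_ennreal ennreal_leI)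
  also have "\<dots> = (\<Prod>b\<in>(Basis::'a set). (\<integral>\<^sup>+ x. ennreal (inverse (1 + x\<^sup>2)) \<partial>lborel))"
    by (intro nn_integral_lborel_prod) auto
  also have "\<dots> < \<infinity>"
    using integrable_inverse_one_plus_square
    by (subst (asm) integrable_iff_bounded) (auto simp: power_less_top_ennreal)
  finally show "(\<integral>\<^sup>+ x. ennreal (inverse ((1 + norm (x::'a)) ^ k)) \<partial>lborel) < \<infinity>" .
qed auto

lemma integrable_of_decay:
  fixes f :: "'a::euclidean_space \<Rightarrow> 'b::{banach, second_countable_topology}"
  assumes [measurable]: "f \<in> borel_measurable borel" and k: "2 * DIM('a) \<le> k"
    and bd: "\<And>x. (1 + norm x) ^ k * norm (f x) \<le> C"
  shows "integrable lborel f"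
proof (rule Bochner_Integration.integrable_bound)
  show "integrable lborel (\<lambda>x::'a. C * inverse ((1 + norm x) ^ k))"
    by (intro integrable_mult_right integrable_decay k)
  have "norm (f x) \<le> C * inverse ((1 + norm x) ^ k)" for x
    using bd[of x] by (simp add: field_simps add_pos_nonneg)
  then show "AE x in lborel. norm (f x) \<le> norm (C * inverse ((1 + norm x) ^ k))"
    by (intro AE_I2) (metis abs_ge_self order_trans real_norm_def)
qed auto

section \<open>Gaussian integrals and the heat kernel\<close>

lemma integral_lborel_prod:
  fixes f :: "'a::euclidean_space \<Rightarrow> real \<Rightarrow> complex"
  assumes "\<And>b. b \<in> Basis \<Longrightarrow> integrable lborel (f b)"
  shows "(LINT x|lborel. (\<Prod>b\<in>Basis. f b (x \<bullet> b))) = (\<Prod>b\<in>Basis. (LINT x|lborel. f b x))"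
proof -
  interpret product_sigma_finite "\<lambda>b::'a. lborel :: real measure" by standard
  have [measurable]: "f b \<in> borel_measurable borel" if "b \<in> Basis" for b
    using borel_measurable_integrable[OF assms[OF that]] by simp
  have "(LINT x|lborel. (\<Prod>b\<in>Basis. f b ((x::'a) \<bullet> b))) =
    (LINT x|Pi\<^sub>M (Basis::'a set) (\<lambda>b. lborel). (\<Prod>b\<in>Basis. f b ((\<Sum>c\<in>Basis. x c *\<^sub>R c) \<bullet> b)))"
    by (subst lborel_eq, subst integral_distr) auto
  also have "\<dots> = (LINT x|Pi\<^sub>M (Basis::'a set) (\<lambda>b. lborel). (\<Prod>b\<in>Basis. f b (x b)))"
    by (intro Bochner_Integration.integral_cong prod.cong refl)
       (simp add: inner_sum_left inner_Basis if_distrib cong: if_cong)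
  also have "\<dots> = (\<Prod>b\<in>Basis. (LINT x|lborel. f b x))"
    by (intro product_integral_prod assms) auto
  finally show ?thesis .
qed

text \<open>The function exp(-x^2/4) is the profile of the heat kernel at time 1. The value is read
  off from the characteristic function of the standard normal law at sqrt 2 u, after the
  substitution x -> sqrt 2 x.\<close>

lemma gauss_fourier_real:
  "(LINT x|lborel. complex_of_real (exp (- x\<^sup>2 / 4)) * iexp (x * u))
    = complex_of_real (sqrt (4 * pi) * exp (- u\<^sup>2))"
  and gauss_fourier_real_integrable:
  "integrable lborel (\<lambda>x. complex_of_real (exp (- x\<^sup>2 / 4)) * iexp (x * u))"
proof -
  let ?f = "\<lambda>x. complex_of_real (exp (- x\<^sup>2 / 4)) * iexp (x * u)"
  have "integrable lborel (\<lambda>x. exp (- x\<^sup>2 / 4) :: real)"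
    using integrable_gauss_euclidean[of 4, where 'a=real] by simp
  then show int: "integrable lborel ?f"
    by (rule Bochner_Integration.integrable_bound) (auto simp: norm_mult)
  have "char std_normal_distribution (sqrt 2 * u)
      = (LINT x|lborel. std_normal_density x *\<^sub>R iexp (sqrt 2 * u * x))"
    unfolding char_def by (subst integral_density) (auto simp: normal_density_nonneg)
  also have "\<dots> = (LINT x|lborel. (1 / sqrt (2 * pi)) *\<^sub>R ?f (sqrt 2 * x))"
    by (intro Bochner_Integration.integral_cong refl)
       (simp add: std_normal_density_def scaleR_conv_of_real power_mult_distrib mult_ac)
  also have "\<dots> = (1 / sqrt (2 * pi)) *\<^sub>R (LINT x|lborel. ?f (sqrt 2 * x))"
    by (rule integral_scaleR_right)
  also have "(LINT x|lborel. ?f (sqrt 2 * x)) = (LINT x|lborel. ?f x) /\<^sub>R sqrt 2"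
    using lborel_integral_real_affine[of "sqrt 2" ?f 0] by simp
  finally have "char std_normal_distribution (sqrt 2 * u) = (LINT x|lborel. ?f x) / sqrt (4 * pi)"
    by (simp add: scaleR_conv_of_real real_sqrt_mult field_simps flip: of_real_mult)
  moreover have "char std_normal_distribution (sqrt 2 * u) = complex_of_real (exp (- u\<^sup>2))"
    by (simp add: char_std_normal_distribution power_mult_distrib)
  ultimately show "(LINT x|lborel. ?f x) = complex_of_real (sqrt (4 * pi) * exp (- u\<^sup>2))"
    by (simp add: field_simps)
qed

lemma heat_kernel_nonneg: "0 \<le> heat_kernel t y"
  by (simp add: heat_kernel_def)

lemma heat_kernel_minus: "heat_kernel t (- y) = heat_kernel t y"
  by (simp add: heat_kernel_def)

lemma heat_kernel_measurable [measurable]: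
  "(heat_kernel t :: 'a::euclidean_space \<Rightarrow> real) \<in> borel_measurable borel"
  unfolding heat_kernel_def[abs_def] by simp

lemma heat_kernel_scale:
  assumes "0 < t"
  shows "heat_kernel t (sqrt t *\<^sub>R y :: 'a::euclidean_space) = heat_kernel 1 y / sqrt t ^ DIM('a)"
proof -
  have "(4 * pi * t) powr (- real DIM('a) / 2)
      = (4 * pi) powr (- real DIM('a) / 2) * t powr (- real DIM('a) / 2)"
    using assms by (simp add: powr_mult)
  also have "t powr (- real DIM('a) / 2) = 1 / sqrt t ^ DIM('a)"
    using assms by (simp add: powr_half_sqrt[symmetric] powr_powr powr_minus_divide flip:
        powr_realpow)
  finally show ?thesis
    using assms by (simp add: heat_kernel_def power_mult_distrib)
qed

text \<open>Moves the time from the kernel into the argument of f. The right-hand side still makes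
  sense at t = 0, and limits in t become limits of f under a fixed integrable weight.\<close>

lemma heat_kernel_rescale:
  fixes f :: "'a::euclidean_space \<Rightarrow> 'b::{banach, second_countable_topology}"
  assumes t: "0 < t"
  shows "(LINT y|lborel. heat_kernel t y *\<^sub>R f y)
      = (LINT y|lborel. heat_kernel 1 y *\<^sub>R f (sqrt t *\<^sub>R y))"
proof -
  have "(LINT y|lborel. heat_kernel t y *\<^sub>R f y)
      = sqrt t ^ DIM('a) *\<^sub>R (LINT y|lborel. heat_kernel t (sqrt t *\<^sub>R y) *\<^sub>R f (sqrt t *\<^sub>R y))"
    using t integral_lborel_affine[of "sqrt t" "\<lambda>y. heat_kernel t y *\<^sub>R f y" 0] by simp
  also have "\<dots> = (LINT y|lborel. heat_kernel 1 y *\<^sub>R f (sqrt t *\<^sub>R y))"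
    using t by (subst integral_scaleR_right[symmetric]) (simp add: heat_kernel_scale)
  finally show ?thesis .
qed

lemma norm_sq_Basis: "(norm (y::'a::euclidean_space))\<^sup>2 = (\<Sum>b\<in>Basis. (y \<bullet> b)\<^sup>2)"
  unfolding power2_norm_eq_inner by (subst euclidean_inner) (simp add: power2_eq_square)

lemma heat_kernel_fourier:
  fixes \<xi> :: "'a::euclidean_space"
  assumes t: "0 < t"
  shows "(LINT y|lborel. heat_kernel t y *\<^sub>R iexp (y \<bullet> \<xi>))
    = complex_of_real (exp (- t * (norm \<xi>)\<^sup>2))"
proof -
  have 1: "(LINT y|lborel. heat_kernel 1 y *\<^sub>R iexp (y \<bullet> \<xi>))
    = complex_of_real (exp (- (norm \<xi>)\<^sup>2))" for \<xi> :: 'a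
  proof -
    have "exp (- (norm y)\<^sup>2 / 4) = (\<Prod>b\<in>Basis. exp (- (y \<bullet> b)\<^sup>2 / 4))" for y :: 'a
      by (simp add: norm_sq_Basis exp_sum[symmetric] sum_negf sum_divide_distrib)
    moreover have "iexp (y \<bullet> \<xi>)
        = (\<Prod>b\<in>Basis. iexp ((y \<bullet> b) * (\<xi> \<bullet> b)))" for y :: 'a
      by (subst euclidean_inner) (simp add: exp_sum[symmetric] sum_distrib_left)
    ultimately have "(LINT y|lborel. heat_kernel 1 y *\<^sub>R iexp (y \<bullet> \<xi>))
      = (LINT y|lborel. (4 * pi) powr (- real DIM('a) / 2) *\<^sub>R
        (\<Prod>b\<in>Basis. complex_of_real (exp (- (y \<bullet> b)\<^sup>2 / 4)) * iexp ((y \<bullet> b) * (\<xi> \<bullet> b))))"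
      by (intro Bochner_Integration.integral_cong refl)
        (simp add: heat_kernel_def prod.distrib scaleR_conv_of_real)
    also have "\<dots> = (4 * pi) powr (- real DIM('a) / 2) *\<^sub>R
       (LINT y|lborel. (\<Prod>b\<in>Basis. complex_of_real (exp (- (y \<bullet> b)\<^sup>2 / 4)) * iexp
           ((y \<bullet> b) * (\<xi> \<bullet> b))))"
      by (rule integral_scaleR_right)
    also have "(LINT y|lborel. (\<Prod>b\<in>Basis. complex_of_real (exp (- (y \<bullet> b)\<^sup>2 / 4))
        * iexp ((y \<bullet> b) * (\<xi> \<bullet> b))))
      = (\<Prod>b\<in>(Basis::'a set). complex_of_real (sqrt (4 * pi) * exp (- (\<xi> \<bullet> b)\<^sup>2)))"
      by (subst integral_lborel_prod[OF gauss_fourier_real_integrable])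
          (simp only: gauss_fourier_real)
    also have "\<dots> = complex_of_real (sqrt (4 * pi) ^ DIM('a) * exp (- (norm \<xi>)\<^sup>2))"
      by (simp add: norm_sq_Basis prod.distrib exp_sum sum_negf[symmetric])
    also have "(4 * pi) powr (- real DIM('a) / 2) *\<^sub>R \<dots>
        = complex_of_real (((4 * pi) powr (- real DIM('a) / 2) * sqrt (4 * pi) ^ DIM('a))
        * exp (- (norm \<xi>)\<^sup>2))"
      by (simp add: scaleR_conv_of_real)
    also have "(4 * pi) powr (- real DIM('a) / 2) * sqrt (4 * pi) ^ DIM('a) = 1"
    proof -
      have "sqrt (4 * pi) ^ DIM('a) = (4 * pi) powr (real DIM('a) / 2)"
        by (subst powr_realpow[symmetric]) (simp_all add: powr_half_sqrt[symmetric] powr_powr)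
      then show ?thesis by (simp flip: powr_add)
    qed
    finally show ?thesis by simp
  qed
  show ?thesis
    using 1[of "sqrt t *\<^sub>R \<xi>"] t
    by (subst heat_kernel_rescale[OF t]) (simp add: power_mult_distrib)
qed

lemma integral_heat_kernel:
  assumes "0 < t"
  shows "(LINT y|lborel. heat_kernel t (y::'a::euclidean_space)) = 1"
proof -
  have "complex_of_real (LINT y|lborel. heat_kernel t (y::'a)) = 1"
    using heat_kernel_fourier[OF assms, of "0::'a"]
    by (simp add: scaleR_conv_of_real)
  then show ?thesis by simp
qed

lemma heat_kernel_decay:
  "\<exists>C. \<forall>y::'a::euclidean_space. (1 + norm y) ^ k * heat_kernel 1 y \<le> C"
proof -
  have "((\<lambda>x::real. (1 + x) ^ k * exp (- x\<^sup>2 / 4)) \<longlongrightarrow> 0) at_top"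
    by real_asymp
  from tendstoD[OF this, of 1]
  obtain X :: real where X: "\<And>x. x \<ge> X \<Longrightarrow> \<bar>(1 + x) ^ k * exp (- x\<^sup>2 / 4)\<bar> < 1"
    by (auto simp: eventually_at_top_linorder)
  have "continuous_on {0..X} (\<lambda>x::real. (1 + x) ^ k * exp (- x\<^sup>2 / 4))"
    by (intro continuous_intros) auto
  then have "bounded ((\<lambda>x::real. (1 + x) ^ k * exp (- x\<^sup>2 / 4)) ` {0..X})"
    by (intro compact_imp_bounded compact_continuous_image) auto
  then obtain B where B: "\<forall>x\<in>{0..X}. \<bar>(1 + x) ^ k * exp (- x\<^sup>2 / 4)\<bar> \<le> B"
    unfolding bounded_iff by auto
  have *: "(1 + norm y) ^ k * exp (- (norm y)\<^sup>2 / 4) \<le> max B 1" for y :: 'a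
    using X[of "norm y"] B[rule_format, of "norm y"]
        by (cases "norm y \<ge> X") (auto simp: abs_le_iff abs_less_iff)
  have "(1 + norm y) ^ k * heat_kernel 1 y \<le> (4 * pi) powr (- real DIM('a) / 2) * max B 1"
      for y :: 'a
    using mult_left_mono[OF *[of y], of "(4 * pi) powr (- real DIM('a) / 2)"]
    by (simp add: heat_kernel_def mult_ac)
  then show ?thesis by blast
qed

subsection \<open>Spaces of functions closed under partial derivatives\<close>

text \<open>Members of such a set are smooth by induction on the multi-index, and if all members
  decay rapidly they are Schwartz functions. Explicit formulas are therefore needed for first
  derivatives only.\<close>

definition deriv_closed :: "('a::euclidean_space \<Rightarrow> complex) set \<Rightarrow> bool" where
  "deriv_closed A \<longleftrightarrow> (\<forall>f\<in>A. (\<forall>x. f differentiable (at x)) \<and>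
     (\<forall>b\<in>Basis. (\<lambda>x. frechet_derivative f (at x) b) \<in> A))"

lemma deriv_closed_iter:
  assumes "deriv_closed A" "f \<in> A" "set es \<subseteq> Basis"
  shows "iter_deriv es f \<in> A"
  using assms(3)
proof (induction es)
  case (Cons e es)
  then show ?case using assms(1) by (auto simp: deriv_closed_def)
qed (use assms in simp)

lemma deriv_closed_smooth: "deriv_closed A \<Longrightarrow> f \<in> A \<Longrightarrow> smooth f"
  unfolding smooth_def using deriv_closed_iter deriv_closed_def by metis

definition rapid :: "('a::euclidean_space \<Rightarrow> complex) \<Rightarrow> bool" where
  "rapid f \<longleftrightarrow> (\<forall>k. \<exists>C. \<forall>x. (1 + norm x) ^ k * norm (f x) \<le> C)"

lemma deriv_closed_schwartz:
  assumes "deriv_closed A" "\<And>f. f \<in> A \<Longrightarrow> rapid f" "f \<in> A"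
  shows "f \<in> schwartz"
  using deriv_closed_smooth[OF assms(1,3)] assms(2)[OF deriv_closed_iter[OF assms(1,3)]]
  unfolding schwartz_def rapid_def bounded_iff by (auto simp: abs_of_nonneg)

text \<open>The module generated by \<open>G\<close> over the polynomials in the coordinates. Once
  the first derivatives of the generators lie in it, the product rule keeps all derivatives in it;
  this serves both for the Gaussian family and for the bump family.\<close>

inductive_set poly_span :: "('a::euclidean_space \<Rightarrow> complex) set \<Rightarrow> ('a \<Rightarrow> complex) set" for G where
  base: "g \<in> G \<Longrightarrow> g \<in> poly_span G"
| add: "f \<in> poly_span G \<Longrightarrow> g \<in> poly_span G \<Longrightarrow> (\<lambda>x. f x + g x) \<in> poly_span G"
| scale: "f \<in> poly_span G \<Longrightarrow> (\<lambda>x. c * f x) \<in> poly_span G"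
| coord: "f \<in> poly_span G \<Longrightarrow> b \<in> Basis \<Longrightarrow> (\<lambda>x. complex_of_real (x \<bullet> b) * f x) \<in> poly_span G"

lemma poly_span_power:
  assumes "f \<in> poly_span G" "b \<in> Basis"
  shows "(\<lambda>x. complex_of_real ((x \<bullet> b) ^ m) * f x) \<in> poly_span G"
proof (induction m)
  case (Suc m)
  from poly_span.coord[OF Suc assms(2)] show ?case by (simp add: mult_ac)
qed (use assms in simp)

lemma poly_span_has_derivative:
  assumes G: "\<And>g. g \<in> G \<Longrightarrow> \<exists>g'. (\<forall>x. (g has_derivative g' x) (at x)) \<and>
      (\<forall>b\<in>Basis. (\<lambda>x. g' x b) \<in> poly_span G)"
    and f: "f \<in> poly_span G"
  shows "\<exists>f'. (\<forall>x. (f has_derivative f' x) (at x)) \<and> (\<forall>b\<in>Basis. (\<lambda>x. f' x b) \<in> poly_span G)"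
  using f
proof induction
  case (base g)
  then show ?case using G by blast
next
  case (add f g)
  then obtain f' g' where "\<And>x. (f has_derivative f' x) (at x)" "\<And>b. b\<in>Basis
      \<Longrightarrow> (\<lambda>x. f' x b) \<in> poly_span G"
     "\<And>x. (g has_derivative g' x) (at x)" "\<And>b. b\<in>Basis \<Longrightarrow> (\<lambda>x. g' x b) \<in> poly_span G"
    by blast
  then show ?case
    by (intro exI[of _ "\<lambda>x d. f' x d + g' x d"]) (auto intro!: derivative_intros poly_span.add)
next
  case (scale f c)
  then obtain f' where "\<And>x. (f has_derivative f' x) (at x)" "\<And>b. b\<in>Basis
      \<Longrightarrow> (\<lambda>x. f' x b) \<in> poly_span G"
    by blast
  then show ?case
    by (intro exI[of _ "\<lambda>x d. c * f' x d"]) (auto intro!: derivative_intros poly_span.scale)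
next
  case (coord f b)
  then obtain f' where f': "\<And>x. (f has_derivative f' x) (at x)" "\<And>b. b\<in>Basis
      \<Longrightarrow> (\<lambda>x. f' x b) \<in> poly_span G"
    by blast
  have "((\<lambda>x. complex_of_real (x \<bullet> b) * f x) has_derivative
     (\<lambda>d. complex_of_real (x \<bullet> b) * f' x d + complex_of_real (d \<bullet> b) * f x)) (at x)" for x
    by (intro has_derivative_mult has_derivative_of_real has_derivative_inner_left f'(1)
        has_derivative_ident)
  then show ?case using f'(2) coord
    by (intro exI[of _ "\<lambda>x d. complex_of_real (x \<bullet> b) * f' x d + complex_of_real (d \<bullet> b) * f x"])
      (auto intro!: poly_span.add poly_span.scale poly_span.coord)
qed

lemma poly_span_deriv_closed:
  assumes G: "\<And>g. g \<in> G \<Longrightarrow> \<exists>g'. (\<forall>x. (g has_derivative g' x) (at x)) \<and>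
      (\<forall>b\<in>Basis. (\<lambda>x. g' x b) \<in> poly_span G)"
  shows "deriv_closed (poly_span G)"
  unfolding deriv_closed_def
proof (intro ballI conjI allI)
  fix f x assume f: "f \<in> poly_span G"
  obtain f' where f': "\<And>x. (f has_derivative f' x) (at x)" "\<And>b. b\<in>Basis
      \<Longrightarrow> (\<lambda>x. f' x b) \<in> poly_span G"
    using poly_span_has_derivative[OF G f] by blast
  show "f differentiable (at x)"
    using f'(1) unfolding differentiable_def by blast
  fix b :: 'a assume "b \<in> Basis"
  then show "(\<lambda>x. frechet_derivative f (at x) b) \<in> poly_span G"
    using f'(2) by (simp add: frechet_derivative_at[OF f'(1), symmetric])
qed

lemma poly_span_rapid:
  assumes G: "\<And>g. g \<in> G \<Longrightarrow> rapid g" and f: "f \<in> poly_span G"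
  shows "rapid f"
  using f
proof induction
  case (base g)
  then show ?case using G by blast
next
  case (add f g)
  show ?case unfolding rapid_def
  proof
    fix k
    obtain C D where C: "\<And>x. (1 + norm x) ^ k * norm (f x) \<le> C"
        and D: "\<And>x. (1 + norm x) ^ k * norm (g x) \<le> D"
      using add unfolding rapid_def by metis
    have "(1 + norm x) ^ k * norm (f x + g x) \<le> C + D" for x
    proof -
      have "(1 + norm x) ^ k * norm (f x + g x) \<le> (1 + norm x) ^ k * (norm (f x) + norm (g x))"
        by (intro mult_left_mono norm_triangle_ineq) auto
      then show ?thesis using C[of x] D[of x] by (simp add: distrib_left)
    qed
    then show "\<exists>C. \<forall>x. (1 + norm x) ^ k * norm (f x + g x) \<le> C" by blast
  qed
next
  case (scale f c)
  show ?case unfolding rapid_def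
  proof
    fix k
    obtain C where C: "\<And>x. (1 + norm x) ^ k * norm (f x) \<le> C"
      using scale unfolding rapid_def by metis
    have "(1 + norm x) ^ k * norm (c * f x) \<le> norm c * C" for x
      using mult_left_mono[OF C[of x] norm_ge_zero[of c]] by (simp add: norm_mult mult_ac)
    then show "\<exists>C. \<forall>x. (1 + norm x) ^ k * norm (c * f x) \<le> C" by blast
  qed
next
  case (coord f b)
  show ?case unfolding rapid_def
  proof
    fix k
    obtain C where C: "\<And>x. (1 + norm x) ^ Suc k * norm (f x) \<le> C"
      using coord unfolding rapid_def by metis
    have "(1 + norm x) ^ k * norm (complex_of_real (x \<bullet> b) * f x) \<le> C" for x
    proof -
      have "\<bar>x \<bullet> b\<bar> \<le> 1 + norm x"
        using Basis_le_norm[OF coord(2), of x] by simp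
      then have "(1 + norm x) ^ k * norm (complex_of_real (x \<bullet> b) * f x)
          \<le> (1 + norm x) ^ k * ((1 + norm x) * norm (f x))"
        unfolding norm_mult norm_of_real by (intro mult_left_mono mult_right_mono) auto
      then show ?thesis using C[of x] by (simp add: mult_ac)
    qed
    then show "\<exists>C. \<forall>x. (1 + norm x) ^ k * norm (complex_of_real (x \<bullet> b) * f x) \<le> C" by blast
  qed
qed

section \<open>Gaussians with powers of 1 + |x|^2\<close>

definition gauss_gen :: "('a::euclidean_space \<Rightarrow> complex) set" where
  "gauss_gen = {\<lambda>x. complex_of_real ((1 + (norm x)\<^sup>2) powr a
      * exp (- c * (norm x)\<^sup>2)) | a c. 0 < c}"

definition gauss_span :: "('a::euclidean_space \<Rightarrow> complex) set" where
  "gauss_span = poly_span gauss_gen"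

lemma has_derivative_norm_sq:
  "((\<lambda>x::'a::euclidean_space. (norm x)\<^sup>2) has_derivative (\<lambda>d. 2 * (x \<bullet> d))) (at x)"
  unfolding power2_norm_eq_inner
  by (auto intro!: derivative_eq_intros simp: inner_commute)

text \<open>The real exponent a is present because the family has to contain the symbols (1 +
  |\<xi>|^2)^(-s/2) (\<xi> \<bullet> e)^m exp(-t |\<xi>|^2); differentiation lowers a by one at the
  price of a coordinate factor.\<close>

lemma gauss_gen_deriv:
  assumes "g \<in> gauss_gen"
  shows "\<exists>g'. (\<forall>x. (g has_derivative g' x) (at x)) \<and> (\<forall>b\<in>Basis. (\<lambda>x. g' x b) \<in> poly_span gauss_gen)"
proof -
  obtain a c where g: "g = (\<lambda>x. complex_of_real ((1 + (norm x)\<^sup>2) powr a * exp (- c * (norm x)\<^sup>2)))"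
      and c: "0 < c"
    using assms unfolding gauss_gen_def by blast
  define h where "h a = (\<lambda>x::'a. complex_of_real ((1 + (norm x)\<^sup>2) powr a
      * exp (- c * (norm x)\<^sup>2)))" for a
  have h: "h a \<in> poly_span gauss_gen" for a
    using c by (intro poly_span.base) (auto simp: h_def gauss_gen_def)
  \<comment> \<open>The profile is differentiated as a function of r = |x|^2, which is smooth in x,
    so the origin needs no separate treatment.\<close>
  have D: "((\<lambda>r. (1 + r) powr a * exp (- c * r)) has_real_derivative
      (a * (1 + r) powr (a - 1) * exp (- c * r) - c * ((1 + r) powr a * exp (- c * r)))) (at
          r)" if "0 \<le> r" for r
    using that by (auto intro!: derivative_eq_intros simp: algebra_simps)
  have "(g has_derivative (\<lambda>d. complex_of_real (2 * (x \<bullet> d))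
      * (of_real a * h (a - 1) x - of_real c * h a x))) (at x)" for x
  proof -
    have "((\<lambda>x::'a. (1 + (norm x)\<^sup>2) powr a * exp (- c * (norm x)\<^sup>2)) has_derivative
       (\<lambda>d. (2 * (x \<bullet> d)) * (a * (1 + (norm x)\<^sup>2) powr (a - 1) * exp (- c * (norm x)\<^sup>2) - c *
           ((1 + (norm x)\<^sup>2) powr a * exp (- c * (norm x)\<^sup>2))))) (at x)"
      using has_derivative_compose[OF has_derivative_norm_sq D[unfolded has_field_derivative_def],
          of x]
      by (simp add: mult_ac)
    from has_derivative_of_real[OF this] show ?thesis
      unfolding g by (rule has_derivative_eq_rhs) (simp add: h_def fun_eq_iff mult_ac)
  qed
  moreover have "(\<lambda>x. complex_of_real (2 * (x \<bullet> b))
      * (of_real a * h (a - 1) x - of_real c * h a x)) \<in> poly_span gauss_gen" if "b \<in> Basis" for b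
    using poly_span.coord[OF poly_span.add[OF poly_span.scale[OF h[of "a-1"], of "2 * of_real a"]
        poly_span.scale[OF h[of a], of "- 2 * of_real c"]] that]
    by (simp add: algebra_simps)
  ultimately show ?thesis
    by - (rule exI[of _ "\<lambda>x d. complex_of_real (2 * (x \<bullet> d))
        * (of_real a * h (a - 1) x - of_real c * h a x)"], blast)
qed

lemma gauss_gen_rapid:
  assumes "g \<in> gauss_gen"
  shows "rapid g"
proof -
  obtain a c where g: "g = (\<lambda>x. complex_of_real ((1 + (norm x)\<^sup>2) powr a * exp (- c * (norm x)\<^sup>2)))"
      and c: "0 < c"
    using assms unfolding gauss_gen_def by blast
  show ?thesis unfolding rapid_def
  proof
    fix k
    let ?f = "\<lambda>x::real. (1 + x) ^ k * ((1 + x\<^sup>2) powr a * exp (- c * x\<^sup>2))"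
    have "(?f \<longlongrightarrow> 0) at_top"
      using c by real_asymp
    from tendstoD[OF this, of 1]
    obtain X :: real where X: "\<And>x. x \<ge> X \<Longrightarrow> \<bar>?f x\<bar> < 1"
      by (auto simp: eventually_at_top_linorder)
    have "continuous_on {0..X} ?f"
      by (intro continuous_intros) (auto simp: add_nonneg_eq_0_iff)
    then have "bounded (?f ` {0..X})"
      by (intro compact_imp_bounded compact_continuous_image) auto
    then obtain B where B: "\<forall>x\<in>{0..X}. \<bar>?f x\<bar> \<le> B"
      unfolding bounded_iff by auto
    have *: "\<bar>?f (norm x)\<bar> \<le> max B 1" for x :: 'a
      using X[of "norm x"] B[rule_format, of "norm x"]
          by (cases "norm x \<ge> X") (auto simp del: abs_mult)
    then show "\<exists>C. \<forall>x. (1 + norm x) ^ k * norm (g x) \<le> C"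
      unfolding g by (intro exI[of _ "max B 1"]) (simp add: abs_mult norm_mult)
  qed
qed

lemma gauss_span_deriv_closed: "deriv_closed gauss_span"
  unfolding gauss_span_def by (intro poly_span_deriv_closed gauss_gen_deriv)

lemma gauss_span_rapid: "f \<in> gauss_span \<Longrightarrow> rapid f"
  unfolding gauss_span_def by (rule poly_span_rapid) (auto intro: gauss_gen_rapid)

section \<open>A smooth bump\<close>

definition bump1 :: "nat \<Rightarrow> real \<Rightarrow> real" where
  "bump1 k w = (if 0 < w then (1 / w) ^ k * exp (- 1 / w) else 0)"

lemma bump1_tendsto_0: "(bump1 k \<longlongrightarrow> 0) (at 0)"
proof -
  have "((\<lambda>w::real. (1 / w) ^ k * exp (- 1 / w)) \<longlongrightarrow> 0) (at_right 0)"
    by real_asymp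
  then have "(bump1 k \<longlongrightarrow> 0) (at_right 0)"
    by (rule Lim_transform_eventually) (auto simp: bump1_def eventually_at_filter)
  moreover have "((\<lambda>w::real. 0) \<longlongrightarrow> (0::real)) (at_left 0)" by simp
  then have "(bump1 k \<longlongrightarrow> 0) (at_left 0)"
    by (rule Lim_transform_eventually) (auto simp: bump1_def eventually_at_filter)
  ultimately show ?thesis
    by (simp add: filterlim_split_at)
qed

text \<open>For k = 0 this is the flat function exp(-1/w); the factors w^(-k) are exactly those that
  differentiation produces, so the indexed family is closed under it.\<close>

lemma bump1_deriv: "(bump1 k has_real_derivative (bump1 (k + 2) w - k * bump1 (k + 1) w)) (at w)"
proof (cases w "0::real" rule: linorder_cases)
  case less
  have "((\<lambda>w. 0) has_real_derivative 0) (at w)" by simp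
  then have "(bump1 k has_real_derivative 0) (at w)"
    by (rule has_field_derivative_transform_within_open[of _ _ _ "{..<0}"])
        (use less in \<open>auto simp: bump1_def\<close>)
  then show ?thesis using less by (simp add: bump1_def)
next
  case equal
  \<comment> \<open>The difference quotient at 0 is \<open>bump1 (Suc k)\<close>, which tends to
    0.\<close>
  have "((\<lambda>h. (bump1 k (0 + h) - bump1 k 0) / h) \<longlongrightarrow> 0) (at 0)"
    by (rule Lim_transform_eventually[OF bump1_tendsto_0[of "Suc k"]])
       (auto simp: bump1_def eventually_at_filter)
  then show ?thesis using equal by (simp add: DERIV_def bump1_def)
next
  case greater
  have "((\<lambda>w. (1 / w) ^ k * exp (- 1 / w)) has_real_derivative (bump1 (k + 2) w - k
      * bump1 (k + 1) w)) (at w)"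
    using greater
    by (auto intro!: derivative_eq_intros simp: bump1_def field_simps power2_eq_square)
       (cases k; simp add: field_simps)
  then show ?thesis
    by (rule has_field_derivative_transform_within_open[of _ _ _ "{0<..}"])
        (use greater in \<open>auto simp: bump1_def\<close>)
qed

definition bump_gen :: "('a::euclidean_space \<Rightarrow> complex) set" where
  "bump_gen = {\<lambda>x. complex_of_real (bump1 k (1 - (norm x)\<^sup>2)) | k. True}"

definition bump_span :: "('a::euclidean_space \<Rightarrow> complex) set" where
  "bump_span = poly_span bump_gen"

lemma bump_gen_deriv:
  assumes "g \<in> bump_gen"
  shows "\<exists>g'. (\<forall>x. (g has_derivative g' x) (at x)) \<and> (\<forall>b\<in>Basis. (\<lambda>x. g' x b) \<in> poly_span bump_gen)"
proof -
  define h where "h k = (\<lambda>x::'a. complex_of_real (bump1 k (1 - (norm x)\<^sup>2)))" for k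
  obtain k where g: "g = h k"
    using assms unfolding bump_gen_def h_def by blast
  have h: "h k \<in> poly_span bump_gen" for k
    by (intro poly_span.base) (auto simp: h_def bump_gen_def)
  have "(g has_derivative (\<lambda>d. complex_of_real (- 2 * (x \<bullet> d))
      * (h (k + 2) x - of_nat k * h (k + 1) x))) (at x)" for x
  proof -
    have "((\<lambda>x::'a. 1 - (norm x)\<^sup>2) has_derivative (\<lambda>d. - (2 * (x \<bullet> d)))) (at x)"
      by (rule has_derivative_eq_rhs[OF has_derivative_diff[OF has_derivative_const
          has_derivative_norm_sq]]) simp
    from has_derivative_compose[OF this bump1_deriv[unfolded has_field_derivative_def, of k]]
    have "((\<lambda>x::'a. bump1 k (1 - (norm x)\<^sup>2)) has_derivative
       (\<lambda>d. (- 2 * (x \<bullet> d)) * (bump1 (k + 2) (1 - (norm x)\<^sup>2) - k * bump1 (k + 1)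
           (1 - (norm x)\<^sup>2)))) (at x)"
      by (simp add: mult_ac)
    from has_derivative_of_real[OF this] show ?thesis
      unfolding g h_def by (rule has_derivative_eq_rhs) (simp add: fun_eq_iff)
  qed
  moreover have "(\<lambda>x. complex_of_real (- 2 * (x \<bullet> b))
      * (h (k + 2) x - of_nat k * h (k + 1) x)) \<in> poly_span bump_gen" if "b \<in> Basis" for b
    using poly_span.coord[OF poly_span.add[OF poly_span.scale[OF h[of "k+2"], of "-2"]
        poly_span.scale[OF h[of "k+1"], of "2 * of_nat k"]] that]
    by (simp add: algebra_simps)
  ultimately show ?thesis
    by - (rule exI[of _ "\<lambda>x d. complex_of_real (- 2 * (x \<bullet> d))
        * (h (k + 2) x - of_nat k * h (k + 1) x)"], blast)
qed

lemma bump_span_deriv_closed: "deriv_closed bump_span"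
  unfolding bump_span_def by (intro poly_span_deriv_closed bump_gen_deriv)

lemma bump_span_support:
  assumes "f \<in> bump_span" "1 \<le> norm x"
  shows "f x = 0"
  using assms(1) unfolding bump_span_def
proof induction
  case (base g)
  have "1 \<le> (norm x)\<^sup>2" using assms(2) by simp
  with base show ?case by (auto simp: bump_gen_def bump1_def)
qed auto

lemma bump_span_continuous: "f \<in> bump_span \<Longrightarrow> continuous_on S f"
  using bump_span_deriv_closed unfolding deriv_closed_def
  by (metis continuous_at_imp_continuous_on differentiable_imp_continuous_within)

lemma bump_span_bounded:
  assumes "f \<in> bump_span"
  shows "\<exists>B. \<forall>x. norm (f x) \<le> B"
proof -
  have "bounded (f ` cball 0 1)"
    using assms by (intro compact_imp_bounded compact_continuous_image bump_span_continuous) auto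
  then obtain B where B: "\<forall>x\<in>cball 0 1. norm (f x) \<le> B"
    unfolding bounded_iff by auto
  have "norm (f x) \<le> max B 0" for x
    using B[rule_format, of x] bump_span_support[OF assms, of x] by (cases "norm x \<le> 1") auto
  then show ?thesis by blast
qed

lemma bump_span_Cc_smooth:
  assumes "f \<in> bump_span"
  shows "f \<in> Cc_smooth"
proof -
  have "{x. f x \<noteq> 0} \<subseteq> cball 0 1"
    using bump_span_support[OF assms] by (auto simp: not_le intro: ccontr)
  then have "bounded {x. f x \<noteq> 0}"
    using bounded_cball bounded_subset by blast
  then show ?thesis
    using deriv_closed_smooth[OF bump_span_deriv_closed assms]
        by (simp add: Cc_smooth_def compact_closure)
qed

subsection \<open>The Fourier transform on Gaussian functions\<close>

text \<open>In every exchange of integrals below the integrand has a majorant of product form, so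
  integrability on the product space is reduced to two separate integrals.\<close>

lemma lborel_fubini:
  fixes f :: "'a::euclidean_space \<Rightarrow> 'b::euclidean_space \<Rightarrow> complex"
  assumes f [measurable]: "(\<lambda>(x, y). f x y) \<in> borel_measurable (borel \<Otimes>\<^sub>M borel)"
    and bd: "\<And>x y. norm (f x y) \<le> g x * h y"
    and g: "integrable lborel g" and h: "integrable lborel h"
  shows "(LINT x|lborel. (LINT y|lborel. f x y)) = (LINT y|lborel. (LINT x|lborel. f x y))"
proof -
  have [measurable]: "g \<in> borel_measurable borel" "h \<in> borel_measurable borel"
    using borel_measurable_integrable[OF g] borel_measurable_integrable[OF h] by simp_all
  have "integrable (lborel \<Otimes>\<^sub>M lborel) (\<lambda>(x, y). norm (g x) * norm (h y))"
  proof (rule lborel_pair.Fubini_integrable)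
    have "(LINT y|lborel. norm (case (x, y) of (x, y) \<Rightarrow> norm (g x) * norm (h y)))
        = norm (g x) * (LINT y|lborel. norm (h y))" for x
      by (simp add: abs_mult)
    then show "integrable lborel (\<lambda>x. LINT y|lborel. norm (case (x, y) of (x, y) \<Rightarrow> norm (g x)
        * norm (h y)))"
      using g by simp
    show "AE x in lborel. integrable lborel (\<lambda>y. case (x, y) of (x, y) \<Rightarrow> norm (g x) * norm (h y))"
      using h by simp
  qed measurable
  then have "integrable (lborel \<Otimes>\<^sub>M lborel) (\<lambda>(x, y). f x y)"
  proof (rule Bochner_Integration.integrable_bound)
    have "norm (f x y) \<le> \<bar>g x\<bar> * \<bar>h y\<bar>" for x y
      using bd[of x y] by (metis abs_ge_self abs_mult order_trans)
    then show "AE z in lborel \<Otimes>\<^sub>M lborel. norm (case z of (x, y) \<Rightarrow> f x y)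
        \<le> norm (case z of (x, y) \<Rightarrow> norm (g x) * norm (h y))"
      by (auto simp: abs_mult)
  qed simp
  from lborel_pair.Fubini_integral[OF this] show ?thesis by simp
qed

text \<open>By translation invariance each difference quotient of f has integral 0. The decay of the
  partial derivative, through the mean value inequality, dominates these quotients, so the limit has
  integral 0 as well. This is integration by parts without boundary terms.\<close>

lemma integral_partial_deriv_zero:
  fixes f :: "'a::euclidean_space \<Rightarrow> complex"
  assumes D: "\<And>x. (f has_derivative D x) (at x)" and f: "integrable lborel f"
    and b: "b \<in> Basis" and k: "2 * DIM('a) \<le> k"
    and [measurable]: "(\<lambda>x. D x b) \<in> borel_measurable borel"
    and bd: "\<And>x. (1 + norm x) ^ k * norm (D x b) \<le> C"
  shows "(LINT x|lborel. D x b) = 0"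
proof -
  define h where "h n = inverse (real (Suc n))" for n
  have h: "0 < h n" "h n \<le> 1" for n by (auto simp: h_def field_simps)
  define g where "g n x = (f (h n *\<^sub>R b + x) - f x) /\<^sub>R h n" for n x
  have [measurable]: "f \<in> borel_measurable borel"
    using borel_measurable_integrable[OF f] by simp
  have int: "integrable lborel (\<lambda>x. f (h n *\<^sub>R b + x))" for n
    using integrable_lborel_affine[OF f, of 1 "h n *\<^sub>R b"] by simp
  have "(LINT x|lborel. g n x) = 0" for n
    unfolding g_def using int f
    by (simp add: integral_lborel_shift)
  moreover have "(\<lambda>n. LINT x|lborel. g n x) \<longlonglongrightarrow> (LINT x|lborel. D x b)"
  proof (rule integral_dominated_convergence)
    \<comment> \<open>The factor 2^k pays for moving the point by at most \<open>h n\<close> \<le>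
      1, since 1 + |x| is then at most twice 1 + |s b + x|.\<close>
    show "integrable lborel (\<lambda>x::'a. (2 ^ k * C) * inverse ((1 + norm x) ^ k))"
      by (intro integrable_mult_right integrable_decay k)
    show "AE x in lborel. (\<lambda>n. g n x) \<longlonglongrightarrow> D x b"
    proof (rule AE_I2)
      fix x
      have lim: "(\<lambda>e. norm (f (x + e) - f x - D x e) / norm e) \<midarrow>0\<rightarrow> 0"
          and lin: "bounded_linear (D x)"
        using D[of x] unfolding has_derivative_at by auto
      have "h \<longlonglongrightarrow> 0"
        unfolding h_def by (rule LIMSEQ_inverse_real_of_nat)
      then have "(\<lambda>n. h n *\<^sub>R b) \<longlonglongrightarrow> 0" by (auto intro!: tendsto_eq_intros)
      then have "filterlim (\<lambda>n. h n *\<^sub>R b) (at 0) sequentially"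
        unfolding filterlim_at using h(1) b by (auto simp: nonzero_Basis less_imp_neq[symmetric])
      from filterlim_compose[OF lim this]
      have "(\<lambda>n. norm (f (x + h n *\<^sub>R b) - f x - D x (h n *\<^sub>R b)) / norm (h n *\<^sub>R b)) \<longlonglongrightarrow> 0" .
      also have "(\<lambda>n. norm (f (x + h n *\<^sub>R b) - f x - D x (h n *\<^sub>R b)) / norm (h n *\<^sub>R b))
          = (\<lambda>n. norm (g n x - D x b))"
      proof
        fix n
        have "g n x - D x b = (f (x + h n *\<^sub>R b) - f x - D x (h n *\<^sub>R b)) /\<^sub>R h n"
          using h(1)[of n] linear_scale[OF bounded_linear.linear[OF lin]]
          by (simp add: g_def scaleR_diff_right add.commute less_imp_neq[symmetric])
        then show "norm (f (x + h n *\<^sub>R b) - f x - D x (h n *\<^sub>R b)) / norm (h n *\<^sub>R b)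
            = norm (g n x - D x b)"
          using h(1)[of n] b by (simp add: divide_inverse mult.commute abs_of_pos)
      qed
      finally show "(\<lambda>n. g n x) \<longlonglongrightarrow> D x b"
        using tendsto_norm_zero_iff[of "\<lambda>n. g n x - D x b"] LIM_zero_iff[of "\<lambda>n. g n x"] by blast
    qed
    fix n
    have "norm (g n x) \<le> 2 ^ k * C * inverse ((1 + norm x) ^ k)" for x
    proof -
      define B where "B = 2 ^ k * C * inverse ((1 + norm x) ^ k)"
      have Db: "norm (D (s *\<^sub>R b + x) b) \<le> B" if "0 < s" "s < h n" for s
      proof -
        have "norm (s *\<^sub>R b) \<le> 1" using that h(2)[of n] b by simp
        then have "1 + norm x \<le> 2 * (1 + norm (s *\<^sub>R b + x))"
          using norm_triangle_ineq4[of "s *\<^sub>R b + x" "s *\<^sub>R b"] norm_ge_zero[of "s *\<^sub>R b + x"]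
          unfolding add_diff_cancel_left' by argo
        then have "(1 + norm x) ^ k \<le> (2 * (1 + norm (s *\<^sub>R b + x))) ^ k"
          by (intro power_mono) auto
        then have "(1 + norm x) ^ k * norm (D (s *\<^sub>R b + x) b)
            \<le> 2 ^ k * ((1 + norm (s *\<^sub>R b + x)) ^ k * norm (D (s *\<^sub>R b + x) b))"
          unfolding power_mult_distrib mult.assoc[symmetric] by (rule mult_right_mono) auto
        also have "\<dots> \<le> 2 ^ k * C"
          using bd by (intro mult_left_mono) auto
        finally show ?thesis
          unfolding B_def by (simp add: field_simps add_pos_nonneg)
      qed
      have der: "((\<lambda>s. f (s *\<^sub>R b + x)) has_vector_derivative D (s *\<^sub>R b + x) b) (at s)" for s
      proof -
        have "((\<lambda>s. s *\<^sub>R b + x) has_derivative (\<lambda>d. d *\<^sub>R b)) (at s)"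
          by (auto intro!: derivative_eq_intros)
        from has_derivative_compose[OF this D]
        have "((\<lambda>s. f (s *\<^sub>R b + x)) has_derivative (\<lambda>d. D (s *\<^sub>R b + x) (d *\<^sub>R b))) (at s)" .
        moreover have "D (s *\<^sub>R b + x) (d *\<^sub>R b) = d *\<^sub>R D (s *\<^sub>R b + x) b" for d
          using linear_scale[OF has_derivative_linear[OF D]] by blast
        ultimately show ?thesis by (simp add: has_vector_derivative_def)
      qed
      have "norm (f (h n *\<^sub>R b + x) - f (0 *\<^sub>R b + x)) \<le> B * h n - B * 0"
      proof (rule differentiable_bound_general[where f = "\<lambda>s. f (s *\<^sub>R b + x)" and \<phi> = "\<lambda>s. B * s"])
        show "continuous_on {0..h n} (\<lambda>s. f (s *\<^sub>R b + x))"
          using der by (meson continuous_at_imp_continuous_on has_vector_derivative_continuous)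
        show "((\<lambda>s. B * s) has_vector_derivative B) (at s)" for s
          unfolding has_vector_derivative_def by (auto intro!: derivative_eq_intros)
      qed (use h der Db in \<open>auto intro!: continuous_intros\<close>)
      moreover have "norm (g n x) = norm (f (h n *\<^sub>R b + x) - f x) / h n"
        using h(1)[of n] by (simp add: g_def divide_inverse mult.commute)
      ultimately show ?thesis
        using h(1)[of n] unfolding B_def[symmetric] by (simp add: pos_divide_le_eq)
    qed
    then show "AE x in lborel. norm (g n x) \<le> 2 ^ k * C * inverse ((1 + norm x) ^ k)" by simp
  qed (auto simp: g_def)
  ultimately show ?thesis
    by (simp add: LIMSEQ_const_iff)
qed

lemma rapid_integrable:
  assumes "rapid f" "f \<in> borel_measurable borel"
  shows "integrable lborel (f :: 'a::euclidean_space \<Rightarrow> complex)"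
    and "integrable lborel (\<lambda>x. norm x ^ j * norm (f x))"
proof -
  obtain C where C: "\<And>x. (1 + norm x) ^ (2 * DIM('a)) * norm (f x) \<le> C"
    using assms(1) unfolding rapid_def by metis
  show "integrable lborel f"
    by (rule integrable_of_decay[OF assms(2) order_refl C])
  obtain C where C: "\<And>x. (1 + norm x) ^ (j + 2 * DIM('a)) * norm (f x) \<le> C"
    using assms(1) unfolding rapid_def by metis
  have "(1 + norm x) ^ (2 * DIM('a)) * norm (norm x ^ j * norm (f x)) \<le> C" for x
  proof -
    have "norm x ^ j \<le> (1 + norm x) ^ j" by (intro power_mono) auto
    then have "(1 + norm x) ^ (2 * DIM('a)) * norm (norm x ^ j * norm (f x))
        \<le> (1 + norm x) ^ (2 * DIM('a)) * ((1 + norm x) ^ j * norm (f x))"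
      by (auto simp: abs_mult intro!: mult_left_mono mult_right_mono)
    also have "\<dots> \<le> C" using C[of x] by (simp add: power_add mult_ac)
    finally show ?thesis .
  qed
  then show "integrable lborel (\<lambda>x. norm x ^ j * norm (f x))"
    using assms(2) by (intro integrable_of_decay[OF _ order_refl]) auto
qed

lemma deriv_closed_measurable:
  assumes "deriv_closed A" "f \<in> A"
  shows "f \<in> borel_measurable borel"
proof (rule borel_measurable_continuous_onI)
  show "continuous_on UNIV f"
    using assms unfolding deriv_closed_def
    by (metis continuous_at_imp_continuous_on differentiable_imp_continuous_within)
qed

lemmas gauss_span_measurable = deriv_closed_measurable[OF gauss_span_deriv_closed]

lemma gauss_span_integrable: "f \<in> gauss_span \<Longrightarrow> integrable lborel f"
  by (intro rapid_integrable gauss_span_rapid gauss_span_measurable)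

lemma fourier_cmult: "fourier (\<lambda>y. c * f y) x = c * fourier f x"
  unfolding fourier_def by (subst integral_mult_right_zero[symmetric]) (simp add: mult_ac)

lemma integrable_fourier:
  assumes "integrable lborel f"
  shows "integrable lborel (\<lambda>y. fexp y x * f y)"
proof -
  have [measurable]: "f \<in> borel_measurable borel"
    using borel_measurable_integrable[OF assms] by simp
  show ?thesis
    by (rule Bochner_Integration.integrable_bound[OF assms]) (auto simp: norm_mult)
qed

lemma norm_fourier_le:
  assumes "integrable lborel f"
  shows "norm (fourier f x) \<le> (LINT y|lborel. norm (f y))"
proof -
  have "norm (fourier f x) \<le> (LINT y|lborel. norm (fexp y x * f y))"
    unfolding fourier_def by (rule integral_norm_bound)
  then show ?thesis by (simp add: norm_mult)
qed

lemma fourier_add: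
  assumes "integrable lborel f" "integrable lborel g"
  shows "fourier (\<lambda>y. f y + g y) x = fourier f x + fourier g x"
  unfolding fourier_def distrib_left
  by (intro Bochner_Integration.integral_add integrable_fourier assms)

text \<open>The second-order Taylor bound |exp(-iv) - 1 + iv| \<le> v^2 gives a remainder of at most
  |z - x|^2 times the second moment of f, so no limit has to be exchanged with the integral.\<close>

lemma fourier_has_derivative:
  fixes f :: "'a::euclidean_space \<Rightarrow> complex"
  assumes f: "rapid f" and [measurable]: "f \<in> borel_measurable borel"
  shows "(fourier f has_derivative (\<lambda>d. fourier (\<lambda>y. - \<i> * (complex_of_real (y \<bullet> d) * f y)) x))
      (at x)"
proof -
  define D where "D d = fourier (\<lambda>y. - \<i> * (complex_of_real (y \<bullet> d) * f y)) x" for d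
  note int = rapid_integrable[OF f assms(2)]
  have intd: "integrable lborel (\<lambda>y. - \<i> * (complex_of_real (y \<bullet> d) * f y))" for d
  proof (rule Bochner_Integration.integrable_bound)
    show "integrable lborel (\<lambda>y. norm d * (norm y ^ 1 * norm (f y)))"
      by (intro integrable_mult_right int)
    have "\<bar>y \<bullet> d\<bar> * norm (f y) \<le> norm d * (norm y * norm (f y))" for y
      using mult_right_mono[OF Cauchy_Schwarz_ineq2[of y d] norm_ge_zero[of "f y"]]
          by (simp add: mult_ac)
    then show "AE y in lborel. norm (- \<i> * (complex_of_real (y \<bullet> d) * f y))
        \<le> norm (norm d * (norm y ^ 1 * norm (f y)))"
      by (auto simp: norm_mult abs_mult)
  qed measurable
  have lin: "bounded_linear D"
  proof (rule bounded_linear_intro)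
    fix d e r
    show "D (d + e) = D d + D e"
      unfolding D_def by (subst fourier_add[symmetric, OF intd intd])
          (simp add: inner_add_right algebra_simps)
    show "D (r *\<^sub>R d) = r *\<^sub>R D d"
      unfolding D_def scaleR_conv_of_real by (subst fourier_cmult[symmetric]) (simp add: mult_ac)
    have "norm (D d) \<le> (LINT y|lborel. norm (- \<i> * (complex_of_real (y \<bullet> d) * f y)))"
      unfolding D_def by (rule norm_fourier_le[OF intd])
    also have "\<dots> \<le> (LINT y|lborel. norm d * (norm y ^ 1 * norm (f y)))"
    proof (rule Bochner_Integration.integral_mono)
      show "norm (- \<i> * (complex_of_real (y \<bullet> d) * f y)) \<le> norm d * (norm y ^ 1 * norm (f y))" for y
        using mult_right_mono[OF Cauchy_Schwarz_ineq2[of y d] norm_ge_zero[of "f y"]]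
            by (simp add: mult_ac norm_mult)
    qed (intro integrable_norm intd, intro integrable_mult_right int)
    also have "\<dots> = norm d * (LINT y|lborel. (norm y ^ 1 * norm (f y)))"
      by (rule integral_mult_right_zero)
    finally show "norm (D d) \<le> norm d * (LINT y|lborel. (norm y ^ 1 * norm (f y)))" .
  qed
  define C where "C = (LINT y|lborel. norm y ^ 2 * norm (f y))"
  have bd: "norm (fourier f z - fourier f x - D (z - x)) \<le> C * (norm (z - x))\<^sup>2" for z
  proof -
    let ?e = "\<lambda>x y. fexp y x"
    let ?g = "\<lambda>y. ?e z y * f y - ?e x y * f y - ?e x y
        * (- \<i> * (complex_of_real (y \<bullet> (z - x)) * f y))"
    have intg: "integrable lborel ?g"
      by (intro Bochner_Integration.integrable_diff integrable_fourier int intd)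
    have "fourier f z - fourier f x - D (z - x) = (LINT y|lborel. ?g y)"
      unfolding fourier_def D_def
      by (subst Bochner_Integration.integral_diff[OF Bochner_Integration.integrable_diff]
          Bochner_Integration.integral_diff;
          (intro integrable_fourier int intd)?)+ simp
    also have "norm \<dots> \<le> (LINT y|lborel. (norm (z - x))\<^sup>2 * (norm y ^ 2 * norm (f y)))"
    proof (rule order_trans[OF integral_norm_bound], rule Bochner_Integration.integral_mono)
      fix y
      define v where "v = y \<bullet> (z - x)"
      have "y \<bullet> z = y \<bullet> x + v" by (simp add: v_def inner_diff_right)
      then have "?e z y = ?e x y * iexp (- v)"
        by (simp add: exp_add[symmetric] algebra_simps)
      then have "?g y = ?e x y * f y * (iexp (- v) - 1 + \<i> * of_real v)"
        unfolding v_def[symmetric] by (simp add: algebra_simps)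
      then have "norm (?g y) = norm (f y) * norm (iexp (- v) - 1 + \<i> * of_real v)"
        by (simp add: norm_mult)
      moreover have "norm (iexp (- v) - 1 + \<i> * of_real v) \<le> v\<^sup>2"
      proof -
        have "2 * norm (iexp (- v) - 1 + \<i> * of_real v) \<le> v\<^sup>2"
        using iexp_approx1[of "- v" 1]
          by (simp add: power2_eq_square abs_mult[symmetric] algebra_simps)
        then show ?thesis using norm_ge_zero[of "iexp (- v) - 1 + \<i> * of_real v"] by linarith
      qed
      moreover have "v\<^sup>2 \<le> (norm y * norm (z - x))\<^sup>2"
        unfolding v_def using Cauchy_Schwarz_ineq2[of y "z - x"]
            by (metis abs_ge_zero power2_abs power_mono)
      ultimately have "norm (?g y) \<le> norm (f y) * (norm y * norm (z - x))\<^sup>2"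
        by (metis mult_left_mono norm_ge_zero order_trans)
      then show "norm (?g y) \<le> (norm (z - x))\<^sup>2 * (norm y ^ 2 * norm (f y))"
        by (simp only: power_mult_distrib mult_ac)
    qed (intro integrable_norm intg, intro integrable_mult_right int)
    also have "\<dots> = (norm (z - x))\<^sup>2 * C"
      unfolding C_def by (rule integral_mult_right_zero)
    finally show ?thesis by (simp add: mult.commute)
  qed
  have "(fourier f has_derivative D) (at x)"
  proof (rule has_derivativeI_sandwich[of 1])
    show "norm (fourier f z - fourier f x - D (z - x)) / norm (z - x) \<le> C * norm (z - x)" if "z \<noteq> x"
        for z
      using bd[of z] that by (simp add: field_simps power2_eq_square)
    show "((\<lambda>z. C * norm (z - x)) \<longlongrightarrow> 0) (at x)"
      by (auto intro!: tendsto_eq_intros)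
  qed (use lin in auto)
  then show ?thesis by (simp add: D_def[abs_def])
qed

lemma gauss_span_cmult: "f \<in> gauss_span \<Longrightarrow> (\<lambda>x. c * f x) \<in> gauss_span"
  unfolding gauss_span_def by (rule poly_span.scale)

lemma gauss_span_coord: "f \<in> gauss_span \<Longrightarrow> b \<in> Basis
    \<Longrightarrow> (\<lambda>x. complex_of_real (x \<bullet> b) * f x) \<in> gauss_span"
  unfolding gauss_span_def by (rule poly_span.coord)

lemma gauss_span_deriv:
  assumes "f \<in> gauss_span"
  shows "(f has_derivative frechet_derivative f (at x)) (at x)"
    and "b \<in> Basis \<Longrightarrow> (\<lambda>x. frechet_derivative f (at x) b) \<in> gauss_span"
  using assms gauss_span_deriv_closed unfolding deriv_closed_def frechet_derivative_works by auto

lemma fourier_frechet: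
  assumes "f \<in> gauss_span" "b \<in> Basis"
  shows "frechet_derivative (fourier f) (at x) b
      = - \<i> * fourier (\<lambda>y. complex_of_real (y \<bullet> b) * f y) x"
  using frechet_derivative_at[OF fourier_has_derivative[OF gauss_span_rapid gauss_span_measurable,
      OF assms(1) assms(1)], of x, symmetric]
  by (simp add: fourier_cmult[of "-\<i>", simplified])

text \<open>Integration by parts: the partial derivative of the product of the exponential with f
  has integral 0 and splits into the two terms of the claim.\<close>

lemma fourier_deriv:
  fixes f :: "'a::euclidean_space \<Rightarrow> complex"
  assumes f: "f \<in> gauss_span" and b: "b \<in> Basis"
  shows "fourier (\<lambda>y. frechet_derivative f (at y) b) x = \<i> * complex_of_real (x \<bullet> b) * fourier f x"
proof -
  let ?e = "\<lambda>y. fexp y x"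
  let ?f' = "\<lambda>y. frechet_derivative f (at y)"
  define D where "D y d = ?e y * ?f' y d + (?e y * (- \<i> * complex_of_real (d \<bullet> x))) * f y" for y d
  note f' = gauss_span_deriv(2)[OF f b]
  have Db: "D y b = ?e y * ?f' y b + (- \<i> * complex_of_real (x \<bullet> b)) * (?e y * f y)" for y
    by (simp add: D_def inner_commute mult_ac)
  obtain B where B: "\<And>x. (1 + norm x) ^ (2 * DIM('a)) * norm (f x) \<le> B"
    using gauss_span_rapid[OF f] unfolding rapid_def by metis
  obtain B' where B': "\<And>x. (1 + norm x) ^ (2 * DIM('a)) * norm (?f' x b) \<le> B'"
    using gauss_span_rapid[OF f'] unfolding rapid_def by metis
  have "(LINT y|lborel. D y b) = 0"
  proof (rule integral_partial_deriv_zero[OF _ integrable_fourier[OF gauss_span_integrable[OF f]] b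
      order_refl])
    fix y
    have "((\<lambda>y. - (\<i> * complex_of_real (y \<bullet> x))) has_derivative (\<lambda>d.
        - (\<i> * complex_of_real (d \<bullet> x)))) (at y)"
      by (intro derivative_intros has_derivative_of_real)
    from has_derivative_compose[OF this DERIV_exp[unfolded has_field_derivative_def]]
    have e: "(?e has_derivative (\<lambda>d. ?e y * (- \<i> * complex_of_real (d \<bullet> x)))) (at y)"
      by simp
    show "((\<lambda>y. ?e y * f y) has_derivative D y) (at y)"
      unfolding D_def[abs_def] by (rule has_derivative_mult[OF e gauss_span_deriv(1)[OF f]])
    have [measurable]: "f \<in> borel_measurable borel" "(\<lambda>x. ?f' x b) \<in> borel_measurable borel"
      using gauss_span_measurable f f' by auto
    show "(\<lambda>y. D y b) \<in> borel_measurable borel"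
      unfolding Db by measurable
    have "norm (D y b) \<le> norm (?f' y b) + \<bar>x \<bullet> b\<bar> * norm (f y)"
      unfolding Db by (rule order_trans[OF norm_triangle_ineq]) (simp add: norm_mult)
    then have "(1 + norm y) ^ (2 * DIM('a)) * norm (D y b)
        \<le> (1 + norm y) ^ (2 * DIM('a)) * (norm (?f' y b) + \<bar>x \<bullet> b\<bar> * norm (f y))"
      by (intro mult_left_mono) auto
    also have "\<dots> \<le> B' + \<bar>x \<bullet> b\<bar> * B"
      using B'[of y] mult_left_mono[OF B[of y], of "\<bar>x \<bullet> b\<bar>"] by (simp add: algebra_simps)
    finally show "(1 + norm y) ^ (2 * DIM('a)) * norm (D y b) \<le> B' + \<bar>x \<bullet> b\<bar> * B" .
  qed
  moreover have "(LINT y|lborel. D y b) = fourier (\<lambda>y. ?f' y b) x + (- \<i> * complex_of_real (x \<bullet> b))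
      * fourier f x"
    unfolding Db fourier_def
    by (subst Bochner_Integration.integral_add, intro integrable_fourier gauss_span_integrable f',
        intro integrable_mult_right integrable_fourier gauss_span_integrable f) simp
  ultimately show ?thesis by (simp add: algebra_simps)
qed

text \<open>Multiplying the transform by a coordinate amounts to differentiating f, which stays in
  \<open>gauss_span\<close>. The induction on the power k therefore runs over all members of the
  family at once.\<close>

lemma fourier_rapid:
  fixes f :: "'a::euclidean_space \<Rightarrow> complex"
  assumes "f \<in> gauss_span"
  shows "rapid (fourier f)"
proof -
  have "\<forall>f\<in>gauss_span. \<exists>C. \<forall>x::'a. (1 + norm x) ^ k * norm (fourier f x) \<le> C" for k
  proof (induction k)
    case 0
    then show ?case using norm_fourier_le[OF gauss_span_integrable] by auto
  next
    case (Suc k)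
    show ?case
    proof
      fix f :: "'a \<Rightarrow> complex" assume f: "f \<in> gauss_span"
      obtain C where C: "\<And>x. (1 + norm x) ^ k * norm (fourier f x) \<le> C"
        using Suc f by blast
      have "\<forall>b\<in>Basis. \<exists>C. \<forall>x. (1 + norm x) ^ k * norm (complex_of_real (x \<bullet> b) * fourier f x) \<le> C"
      proof
        fix b :: 'a assume b: "b \<in> Basis"
        obtain C where C: "\<And>x. (1 + norm x) ^ k
            * norm (fourier (\<lambda>y. frechet_derivative f (at y) b) x) \<le> C"
          using Suc gauss_span_deriv(2)[OF f b] by blast
        then show "\<exists>C. \<forall>x. (1 + norm x) ^ k * norm (complex_of_real (x \<bullet> b) * fourier f x) \<le> C"
          by (intro exI[of _ C]) (simp add: fourier_deriv[OF f b] norm_mult)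
      qed
      then obtain D where D: "\<And>b x. b \<in> Basis \<Longrightarrow> (1 + norm x) ^ k
          * norm (complex_of_real (x \<bullet> b) * fourier f x) \<le> D b"
        by metis
      have "(1 + norm x) ^ Suc k * norm (fourier f x) \<le> C + (\<Sum>b\<in>Basis. D b)" for x
      proof -
        have "norm x \<le> (\<Sum>b\<in>Basis. \<bar>x \<bullet> b\<bar>)" by (rule norm_le_l1)
        then have "norm x * ((1 + norm x) ^ k * norm (fourier f x))
            \<le> (\<Sum>b\<in>Basis. \<bar>x \<bullet> b\<bar>) * ((1 + norm x) ^ k * norm (fourier f x))"
          by (intro mult_right_mono) auto
        also have "\<dots> = (\<Sum>b\<in>Basis. (1 + norm x) ^ k * norm (complex_of_real (x \<bullet> b) * fourier f x))"
          by (subst sum_distrib_right) (simp add: norm_mult mult_ac)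
        also have "\<dots> \<le> (\<Sum>b\<in>Basis. D b)"
          by (intro sum_mono D)
        finally show ?thesis using C[of x] by (simp add: algebra_simps)
      qed
      then show "\<exists>C. \<forall>x. (1 + norm x) ^ Suc k * norm (fourier f x) \<le> C" by blast
    qed
  qed
  with assms show ?thesis by (auto simp: rapid_def)
qed

lemma fourier_deriv_closed: "deriv_closed (fourier ` gauss_span)"
  unfolding deriv_closed_def
proof (intro ballI conjI allI; elim imageE; hypsubst)
  fix x f assume f: "f \<in> (gauss_span :: ('a \<Rightarrow> complex) set)"
  show "fourier f differentiable (at x)"
    using fourier_has_derivative[OF gauss_span_rapid gauss_span_measurable, OF f f]
    unfolding differentiable_def by blast
  fix b :: 'a assume b: "b \<in> Basis"
  show "(\<lambda>x. frechet_derivative (fourier f) (at x) b) \<in> fourier ` gauss_span"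
    unfolding fourier_frechet[OF f b] fourier_cmult[symmetric]
    by (intro imageI gauss_span_cmult gauss_span_coord f b)
qed

lemma fourier_schwartz: "f \<in> gauss_span \<Longrightarrow> fourier f \<in> schwartz"
  by (rule deriv_closed_schwartz[OF fourier_deriv_closed]) (auto intro: fourier_rapid)

lemma fourier_measurable: "f \<in> gauss_span \<Longrightarrow> fourier f \<in> borel_measurable borel"
  by (rule deriv_closed_measurable[OF fourier_deriv_closed]) auto

lemma fourier_integrable: "f \<in> gauss_span \<Longrightarrow> integrable lborel (fourier f)"
  by (intro rapid_integrable fourier_rapid fourier_measurable)

subsection \<open>The heat semigroup\<close>

text \<open>The function exp(-e |\<xi>|^2) is a multiple of the heat kernel at time 1/(4e), whose
  transform is known; only the constants have to be matched.\<close>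

lemma gauss_fourier_inverse:
  fixes z :: "'a::euclidean_space"
  assumes e: "0 < e"
  shows "(LINT \<xi>|lborel. exp (- e * (norm \<xi>)\<^sup>2) *\<^sub>R iexp (\<xi> \<bullet> z))
    = ((2 * pi) ^ DIM('a) * heat_kernel e z) *\<^sub>R 1"
proof -
  let ?I = "LINT \<xi>|lborel. exp (- e * (norm \<xi>)\<^sup>2) *\<^sub>R iexp (\<xi> \<bullet> z)"
  let ?c = "(pi / e) powr (- real DIM('a) / 2)"
  have "heat_kernel (1 / (4 * e)) y = ?c * exp (- e * (norm y)\<^sup>2)" for y :: 'a
    using e by (simp add: heat_kernel_def field_simps)
  then have "?c *\<^sub>R ?I = complex_of_real (exp (- (norm z)\<^sup>2 / (4 * e)))"
    using heat_kernel_fourier[of "1 / (4 * e)" z] e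
    by (simp del: integral_scaleR_right add: integral_scaleR_right[symmetric] field_simps)
  moreover have "(2 * pi) ^ DIM('a) * heat_kernel e z * ?c = exp (- (norm z)\<^sup>2 / (4 * e))"
  proof -
    have "(2 * pi) ^ DIM('a) = (2 * pi) powr real DIM('a)"
      by (simp add: powr_realpow)
    also have "\<dots> = ((2 * pi) powr 2) powr (real DIM('a) / 2)"
      by (subst powr_powr) simp
    also have "(2 * pi) powr 2 = (4 * pi * e) * (pi / e)"
      using e by (simp add: power2_eq_square)
    also have "\<dots> powr (real DIM('a) / 2) = (4 * pi * e) powr (real DIM('a) / 2)
        * (pi / e) powr (real DIM('a) / 2)"
      by (rule powr_mult)
    finally have "(2 * pi) ^ DIM('a) * (4 * pi * e) powr (- real DIM('a) / 2) * ?c = 1"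
      using e by (simp add: powr_minus field_simps)
    then show ?thesis
      by (simp add: heat_kernel_def mult_ac)
  qed
  moreover have "?c \<noteq> 0" using e by simp
  ultimately show ?thesis
    by (metis (no_types, lifting) mult.commute of_real_def scaleR_left_imp_eq scaleR_scaleR)
qed

lemma heat_kernel_integrable_mult:
  fixes f :: "'a::euclidean_space \<Rightarrow> 'b::{banach, second_countable_topology}"
  assumes "0 < t" and [measurable]: "f \<in> borel_measurable borel" and bd: "\<And>y. norm (f y) \<le> B"
  shows "integrable lborel (\<lambda>y. heat_kernel t y *\<^sub>R f y)"
proof (rule Bochner_Integration.integrable_bound)
  show "integrable lborel (\<lambda>y::'a. heat_kernel t y * B)"
    by (intro integrable_mult_left integrable_heat_kernel assms(1))
  have "0 \<le> B" using bd norm_ge_zero order_trans by blast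
  then show "AE y in lborel. norm (heat_kernel t y *\<^sub>R f y) \<le> norm (heat_kernel t y * B)"
    using bd by (auto simp: abs_mult heat_kernel_nonneg intro!: mult_left_mono)
qed simp

lemma heat_kernel_approx:
  fixes f :: "'a::euclidean_space \<Rightarrow> complex"
  assumes c: "continuous_on UNIV f" and bd: "\<And>y. norm (f y) \<le> B" and e: "e \<longlonglongrightarrow> 0"
  shows "(\<lambda>n. LINT y|lborel. heat_kernel 1 y *\<^sub>R f (x - e n *\<^sub>R y)) \<longlonglongrightarrow> f x"
proof -
  have [measurable]: "f \<in> borel_measurable borel"
    using c by (rule borel_measurable_continuous_onI)
  have "0 \<le> B" using bd norm_ge_zero order_trans by blast
  have "(\<lambda>n. LINT y|lborel. heat_kernel 1 y *\<^sub>R f (x - e n *\<^sub>R y))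
      \<longlonglongrightarrow> (LINT y|lborel. heat_kernel 1 (y::'a) *\<^sub>R f x)"
  proof (rule integral_dominated_convergence)
    show "integrable lborel (\<lambda>y::'a. heat_kernel 1 y * B)"
      by (intro integrable_mult_left integrable_heat_kernel) auto
    have "(\<lambda>n. f (x - e n *\<^sub>R y)) \<longlonglongrightarrow> f x" for y
    proof (rule continuous_on_tendsto_compose[OF c])
      show "(\<lambda>n. x - e n *\<^sub>R y) \<longlonglongrightarrow> x" using e by (auto intro!: tendsto_eq_intros)
    qed auto
    then show "AE y in lborel. (\<lambda>n. heat_kernel 1 y *\<^sub>R f (x - e n *\<^sub>R y))
        \<longlonglongrightarrow> heat_kernel 1 y *\<^sub>R f x"
      by (auto intro!: tendsto_intros)
    show "AE y in lborel. norm (heat_kernel 1 y *\<^sub>R f (x - e n *\<^sub>R y)) \<le> heat_kernel 1 y * B" for n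
      using bd by (auto simp: heat_kernel_nonneg intro!: mult_left_mono)
  qed auto
  also have "(LINT y|lborel. heat_kernel 1 (y::'a) *\<^sub>R f x) = f x"
    using integral_heat_kernel[of 1, where 'a='a] integrable_heat_kernel[of 1, where 'a='a]
    by (subst integral_scaleR_left) auto
  finally show ?thesis .
qed

text \<open>Gaussian summation: the inversion integral is damped by exp(-e |\<xi>|^2) with e -> 0.
  Dominated convergence gives the undamped integral, while Fubini turns the damped one into the
  average of f against the heat kernel at time e, which tends to f x.\<close>

lemma inv_fourier_fourier:
  fixes f :: "'a::euclidean_space \<Rightarrow> complex"
  assumes f: "f \<in> gauss_span"
  shows "inv_fourier (fourier f) = f"
proof
  fix x
  define e where "e n = inverse (real (Suc n))" for n
  have e: "0 < e n" for n by (simp add: e_def)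
  have e0: "e \<longlonglongrightarrow> 0" unfolding e_def by (rule LIMSEQ_inverse_real_of_nat)
  have [measurable]: "f \<in> borel_measurable borel" "fourier f \<in> borel_measurable borel"
    using gauss_span_measurable[OF f] fourier_measurable[OF f] by auto
  define A where "A n = (LINT \<xi>|lborel. exp (- e n * (norm \<xi>)\<^sup>2) *\<^sub>R (iexp (x \<bullet> \<xi>) * fourier f \<xi>))"
      for n
  have 1: "A \<longlonglongrightarrow> (LINT \<xi>|lborel. iexp (x \<bullet> \<xi>) * fourier f \<xi>)"
    unfolding A_def
  proof (rule integral_dominated_convergence)
    show "integrable lborel (\<lambda>\<xi>. norm (fourier f \<xi>))"
      by (intro integrable_norm fourier_integrable f)
    have "(\<lambda>n. exp (- e n * (norm \<xi>)\<^sup>2)) \<longlonglongrightarrow> 1" for \<xi> :: 'a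
    proof -
      have "(\<lambda>n. exp (- e n * (norm \<xi>)\<^sup>2)) \<longlonglongrightarrow> exp (- 0 * (norm \<xi>)\<^sup>2)"
        by (intro tendsto_intros e0)
      then show ?thesis by simp
    qed
    then have "(\<lambda>n. exp (- e n * (norm \<xi>)\<^sup>2) *\<^sub>R c) \<longlonglongrightarrow> 1 *\<^sub>R c" for \<xi> :: 'a and c :: complex
      by (intro tendsto_intros)
    then show "AE \<xi> in lborel. (\<lambda>n. exp (- e n * (norm \<xi>)\<^sup>2) *\<^sub>R (iexp (x \<bullet> \<xi>) * fourier f \<xi>))
        \<longlonglongrightarrow> iexp (x \<bullet> \<xi>) * fourier f \<xi>"
      by simp
    show "AE \<xi> in lborel. norm (exp (- e n * (norm \<xi>)\<^sup>2) *\<^sub>R (iexp (x \<bullet> \<xi>) * fourier f \<xi>))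
        \<le> norm (fourier f \<xi>)" for n
      using e[of n] by (intro AE_I2) (auto simp: norm_mult intro!: mult_left_le_one_le)
  qed measurable
  have A: "A n = ((2 * pi) ^ DIM('a)) *\<^sub>R (LINT y|lborel. heat_kernel 1 y
      *\<^sub>R f (x - sqrt (e n) *\<^sub>R y))" for n
  proof -
    let ?g = "\<lambda>\<xi> y. (exp (- e n * (norm \<xi>)\<^sup>2) *\<^sub>R iexp (\<xi> \<bullet> (x - y))) * f y"
    have "A n = (LINT \<xi>|lborel. (LINT y|lborel. ?g \<xi> y))"
      unfolding A_def fourier_def
    proof (intro Bochner_Integration.integral_cong refl)
      fix \<xi> :: 'a
      have "exp (- e n * (norm \<xi>)\<^sup>2) *\<^sub>R (iexp (x \<bullet> \<xi>) * (LINT y|lborel. fexp y \<xi> * f y))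
        = (LINT y|lborel. exp (- e n * (norm \<xi>)\<^sup>2) *\<^sub>R (iexp (x \<bullet> \<xi>) * (fexp y \<xi> * f y)))"
        by simp
      also have "\<dots> = (LINT y|lborel. ?g \<xi> y)"
        by (intro Bochner_Integration.integral_cong refl)
          (simp add: inner_diff_right inner_commute right_diff_distrib exp_diff exp_minus
              field_simps)
      finally show "exp (- e n * (norm \<xi>)\<^sup>2) *\<^sub>R (iexp (x \<bullet> \<xi>) * (LINT y|lborel. fexp y \<xi> * f y))
          = (LINT y|lborel. ?g \<xi> y)" .
    qed
    also have "\<dots> = (LINT y|lborel. (LINT \<xi>|lborel. ?g \<xi> y))"
    proof (rule lborel_fubini)
      show "integrable lborel (\<lambda>\<xi>::'a. exp (- (norm \<xi>)\<^sup>2 / (1 / e n)))"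
        using e by (intro integrable_gauss_euclidean) simp
      show "integrable lborel (\<lambda>y. norm (f y))"
        by (intro integrable_norm gauss_span_integrable f)
    qed (auto simp: norm_mult mult_ac)
    also have "\<dots> = (LINT y|lborel. ((2 * pi) ^ DIM('a)) *\<^sub>R (heat_kernel (e n) (x - y) *\<^sub>R f y))"
      by (simp only: integral_mult_left_zero gauss_fourier_inverse[OF e])
         (simp only: mult_scaleR_left mult_1_left scaleR_scaleR)
    also have "\<dots> = (LINT y|lborel. ((2 * pi) ^ DIM('a)) *\<^sub>R (heat_kernel (e n) y *\<^sub>R f (x - y)))"
      by (subst integral_lborel_reflect[symmetric, of _ x]) simp
    also have "\<dots> = ((2 * pi) ^ DIM('a)) *\<^sub>R (LINT y|lborel. heat_kernel (e n) y *\<^sub>R f (x - y))"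
      by (rule integral_scaleR_right)
    also have "(LINT y|lborel. heat_kernel (e n) y *\<^sub>R f (x - y))
        = (LINT y|lborel. heat_kernel 1 y *\<^sub>R f (x - sqrt (e n) *\<^sub>R y))"
      by (rule heat_kernel_rescale[OF e])
    finally show ?thesis .
  qed
  have lim: "(\<lambda>n. LINT y|lborel. heat_kernel 1 y *\<^sub>R f (x - sqrt (e n) *\<^sub>R y)) \<longlonglongrightarrow> f x"
  proof -
    obtain B where "\<And>x. (1 + norm x) ^ 0 * norm (f x) \<le> B"
      using gauss_span_rapid[OF f] unfolding rapid_def by metis
    moreover have "continuous_on UNIV f"
      using gauss_span_deriv(1)[OF f] has_derivative_continuous continuous_at_imp_continuous_on
          by blast
    moreover have "(\<lambda>n. sqrt (e n)) \<longlonglongrightarrow> 0"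
      using tendsto_real_sqrt[OF e0] by simp
    ultimately show ?thesis by (intro heat_kernel_approx[where B = B]) auto
  qed
  have "A \<longlonglongrightarrow> ((2 * pi) ^ DIM('a)) *\<^sub>R f x"
    unfolding ext[of A, OF A] by (intro tendsto_intros lim)
  from LIMSEQ_unique[OF 1 this] show "inv_fourier (fourier f) x = f x"
    by (simp add: inv_fourier_def scaleR_conv_of_real)
qed

lemma bcontfun_measurable [measurable]:
  "apply_bcontfun (f :: 'a::euclidean_space \<Rightarrow>\<^sub>C complex) \<in> borel_measurable borel"
  by (rule borel_measurable_continuous_onI) auto

text \<open>One formula for all real t: for t \<le> 0 the argument of f is frozen and the unit mass
  of the kernel returns f, as in the default branch of \<open>heat_semigroup\<close>. Integrands in
  t - \<sigma> can thus be treated on whole rectangles, without the constraint \<sigma> \<le>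
  t.\<close>

lemma heat_semigroup_eq:
  fixes f :: "'a::euclidean_space \<Rightarrow>\<^sub>C complex"
  shows "heat_semigroup t f x = (LINT y|lborel. heat_kernel 1 y *\<^sub>R f (x - sqrt (max 0 t) *\<^sub>R y))"
proof (cases "0 < t")
  case True
  then show ?thesis
    using heat_kernel_rescale[OF True, of "\<lambda>y. f (x - y)"]
        by (simp add: apply_heat_semigroup max_def)
next
  case False
  then show ?thesis
    using integral_heat_kernel[of 1, where 'a='a] integrable_heat_kernel[of 1, where 'a='a]
    by (simp add: heat_semigroup_def max_def)
qed

lemma heat_integrable:
  fixes f :: "'a::euclidean_space \<Rightarrow>\<^sub>C complex"
  shows "integrable lborel (\<lambda>y. heat_kernel 1 y *\<^sub>R f (x - c *\<^sub>R y))"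
  by (rule heat_kernel_integrable_mult[of _ _ "norm f"]) (auto simp: norm_bounded)

lemma heat_kernel_mean_le:
  fixes g :: "'a::euclidean_space \<Rightarrow> complex"
  assumes "integrable lborel (\<lambda>y. heat_kernel 1 y *\<^sub>R g y)" "\<And>y. norm (g y) \<le> h y"
    "integrable lborel (\<lambda>y. heat_kernel 1 y * h y)"
  shows "norm (LINT y|lborel. heat_kernel 1 y *\<^sub>R g y) \<le> (LINT y|lborel. heat_kernel 1 y * h y)"
proof -
  have "norm (LINT y|lborel. heat_kernel 1 y *\<^sub>R g y)
      \<le> (LINT y|lborel. norm (heat_kernel 1 y *\<^sub>R g y))"
    by (rule integral_norm_bound)
  also have "\<dots> \<le> (LINT y|lborel. heat_kernel 1 y * h y)"
    using assms by (intro Bochner_Integration.integral_mono integrable_norm)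
        (auto simp: heat_kernel_nonneg intro!: mult_left_mono)
  finally show ?thesis .
qed

lemma heat_kernel_mean_le_const:
  fixes g :: "'a::euclidean_space \<Rightarrow> complex"
  assumes "integrable lborel (\<lambda>y. heat_kernel 1 y *\<^sub>R g y)" "\<And>y. norm (g y) \<le> B"
  shows "norm (LINT y|lborel. heat_kernel 1 y *\<^sub>R g y) \<le> B"
  using heat_kernel_mean_le[OF assms(1), of "\<lambda>_. B"] assms(2)
    integral_heat_kernel[of 1, where 'a='a] integrable_heat_kernel[of 1, where 'a='a]
  by simp

lemma norm_heat_semigroup_le: "norm (heat_semigroup t f)
    \<le> norm (f :: 'a::euclidean_space \<Rightarrow>\<^sub>C complex)"
  by (rule norm_bound) (auto simp: heat_semigroup_eq norm_bounded intro!: heat_kernel_mean_le_const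
      heat_integrable)

lemma heat_semigroup_diff:
  "heat_semigroup t (f - g) = heat_semigroup t f
      - heat_semigroup t (g :: 'a::euclidean_space \<Rightarrow>\<^sub>C complex)"
proof (rule bcontfun_eqI)
  fix x
  show "heat_semigroup t (f - g) x = (heat_semigroup t f - heat_semigroup t g) x"
    by (simp add: heat_semigroup_eq scaleR_diff_right
        Bochner_Integration.integral_diff[OF heat_integrable heat_integrable])
qed

lemma dist_heat_semigroup_le:
  "dist (heat_semigroup t f) (heat_semigroup t g) \<le> dist f (g :: 'a::euclidean_space \<Rightarrow>\<^sub>C complex)"
  unfolding dist_norm heat_semigroup_diff[symmetric] by (rule norm_heat_semigroup_le)

section \<open>Odd and Lipschitz functions under the heat semigroup\<close>

definition odd_fun :: "('a::euclidean_space \<Rightarrow> complex) \<Rightarrow> bool" where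
  "odd_fun f \<longleftrightarrow> (\<forall>x. f (- x) = - f x)"

definition lip_fun :: "real \<Rightarrow> ('a::euclidean_space \<Rightarrow> complex) \<Rightarrow> bool" where
  "lip_fun L f \<longleftrightarrow> (\<forall>x y. norm (f x - f y) \<le> L * norm (x - y))"

lemma heat_semigroup_odd:
  fixes f :: "'a::euclidean_space \<Rightarrow>\<^sub>C complex"
  assumes "odd_fun f"
  shows "odd_fun (heat_semigroup t f)"
  unfolding odd_fun_def
proof
  fix x
  let ?c = "sqrt (max 0 t)"
  have "f (- x + ?c *\<^sub>R y) = - f (x - ?c *\<^sub>R y)" for y
    using assms[unfolded odd_fun_def, rule_format, of "x - ?c *\<^sub>R y"] by simp
  moreover have "heat_semigroup t f (- x) = (LINT y|lborel. heat_kernel 1 y *\<^sub>R f (- x + ?c *\<^sub>R y))"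
    unfolding heat_semigroup_eq
    by (subst integral_lborel_reflect[symmetric, of _ 0]) (simp add: heat_kernel_minus)
  ultimately show "heat_semigroup t f (- x) = - heat_semigroup t f x"
    by (simp add: heat_semigroup_eq)
qed

lemma heat_semigroup_lip:
  fixes f :: "'a::euclidean_space \<Rightarrow>\<^sub>C complex"
  assumes "lip_fun L f"
  shows "lip_fun L (heat_semigroup t f)"
  unfolding lip_fun_def
proof (intro allI)
  fix x z
  let ?c = "sqrt (max 0 t)"
  have "heat_semigroup t f x - heat_semigroup t f z
      = (LINT y|lborel. heat_kernel 1 y *\<^sub>R (f (x - ?c *\<^sub>R y) - f (z - ?c *\<^sub>R y)))"
    by (simp add: heat_semigroup_eq scaleR_diff_right
        Bochner_Integration.integral_diff[OF heat_integrable heat_integrable])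
  also have "norm \<dots> \<le> L * norm (x - z)"
  proof (rule heat_kernel_mean_le_const)
    show "integrable lborel (\<lambda>y. heat_kernel 1 y *\<^sub>R (f (x - ?c *\<^sub>R y) - f (z - ?c *\<^sub>R y)))"
      unfolding scaleR_diff_right by (intro Bochner_Integration.integrable_diff heat_integrable)
    show "norm (f (x - ?c *\<^sub>R y) - f (z - ?c *\<^sub>R y)) \<le> L * norm (x - z)" for y
      using assms[unfolded lip_fun_def, rule_format, of "x - ?c *\<^sub>R y" "z - ?c *\<^sub>R y"] by simp
  qed
  finally show "norm (heat_semigroup t f x - heat_semigroup t f z) \<le> L * norm (x - z)" .
qed

definition heat_moment :: "'a::euclidean_space itself \<Rightarrow> real" where
  "heat_moment _ = (LINT y|lborel. heat_kernel 1 (y::'a) * norm y)"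

lemma heat_moment_integrable: "integrable lborel (\<lambda>y::'a::euclidean_space. heat_kernel 1 y
    * norm y)"
proof -
  obtain C where C: "\<And>y::'a. (1 + norm y) ^ (Suc (2 * DIM('a))) * heat_kernel 1 y \<le> C"
    using heat_kernel_decay by metis
  have "(1 + norm y) ^ (2 * DIM('a)) * norm (heat_kernel 1 y * norm y) \<le> C" for y :: 'a
  proof -
    have "(1 + norm y) ^ (2 * DIM('a)) * (heat_kernel 1 y * norm y)
        \<le> (1 + norm y) ^ (2 * DIM('a)) * (heat_kernel 1 y * (1 + norm y))"
      by (intro mult_left_mono) (auto simp: heat_kernel_nonneg)
    then show ?thesis using C[of y] by (simp add: heat_kernel_nonneg abs_mult mult_ac)
  qed
  then show ?thesis by (intro integrable_of_decay[OF _ order_refl]) auto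
qed

lemma heat_moment_nonneg: "0 \<le> heat_moment TYPE('a::euclidean_space)"
  unfolding heat_moment_def by (intro integral_nonneg_AE) (auto simp: heat_kernel_nonneg)

text \<open>For a Lipschitz function the displacement by a multiple of y costs at most a multiple of
  |y|, so the first moment of the kernel yields a modulus of continuity in sqrt t, in the sup norm.
  This supplies the time continuity of the Duhamel integrand.\<close>

lemma heat_semigroup_lip_time:
  fixes f :: "'a::euclidean_space \<Rightarrow>\<^sub>C complex"
  assumes f: "lip_fun L f"
  shows "dist (heat_semigroup s f) (heat_semigroup t f)
      \<le> L * heat_moment TYPE('a) * \<bar>sqrt (max 0 s) - sqrt (max 0 t)\<bar>"
proof (rule dist_bound)
  fix x
  let ?c = "sqrt (max 0 s)" and ?d = "sqrt (max 0 t)"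
  have "heat_semigroup s f x - heat_semigroup t f x
      = (LINT y|lborel. heat_kernel 1 y *\<^sub>R (f (x - ?c *\<^sub>R y) - f (x - ?d *\<^sub>R y)))"
    by (simp add: heat_semigroup_eq scaleR_diff_right
        Bochner_Integration.integral_diff[OF heat_integrable heat_integrable])
  also have "norm \<dots> \<le> (LINT y|lborel. heat_kernel 1 (y::'a) * ((L * \<bar>?c - ?d\<bar>) * norm y))"
  proof (rule heat_kernel_mean_le)
    show "integrable lborel (\<lambda>y. heat_kernel 1 y *\<^sub>R (f (x - ?c *\<^sub>R y) - f (x - ?d *\<^sub>R y)))"
      unfolding scaleR_diff_right by (intro Bochner_Integration.integrable_diff heat_integrable)
    show "norm (f (x - ?c *\<^sub>R y) - f (x - ?d *\<^sub>R y)) \<le> (L * \<bar>?c - ?d\<bar>) * norm y" for y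
    proof -
      have "norm ((x - ?c *\<^sub>R y) - (x - ?d *\<^sub>R y)) = \<bar>?c - ?d\<bar> * norm y"
        by (simp add: scaleR_diff_left[symmetric] abs_minus_commute del: real_sqrt_eq_iff)
      then show ?thesis
        using f[unfolded lip_fun_def, rule_format, of "x - ?c *\<^sub>R y" "x - ?d *\<^sub>R y"]
            by (simp add: mult_ac)
    qed
    show "integrable lborel (\<lambda>y::'a. heat_kernel 1 y * ((L * \<bar>?c - ?d\<bar>) * norm y))"
      using integrable_mult_right[OF heat_moment_integrable, of "L * \<bar>?c - ?d\<bar>"]
          by (simp add: mult_ac)
  qed
  also have "\<dots> = (LINT y|lborel. (L * \<bar>?c - ?d\<bar>) * (heat_kernel 1 (y::'a) * norm y))"
    by (intro Bochner_Integration.integral_cong refl) (simp add: mult_ac)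
  also have "\<dots> = (L * \<bar>?c - ?d\<bar>) * heat_moment TYPE('a)"
    unfolding heat_moment_def by (rule integral_mult_right_zero)
  finally show "dist (heat_semigroup s f x) (heat_semigroup t f x)
      \<le> L * heat_moment TYPE('a) * \<bar>?c - ?d\<bar>"
    by (simp add: dist_norm mult_ac)
qed

text \<open>Only the limit has to be Lipschitz: \<open>f x\<close> and \<open>l\<close> are compared
  at the same time by contraction, and the change of time is applied to \<open>l\<close>
  alone.\<close>

lemma heat_semigroup_tendsto:
  fixes f :: "'b \<Rightarrow> 'a::euclidean_space \<Rightarrow>\<^sub>C complex"
  assumes f: "(f \<longlongrightarrow> l) F" and s: "(s \<longlongrightarrow> a) F" and l: "lip_fun L l"
  shows "((\<lambda>x. heat_semigroup (s x) (f x)) \<longlongrightarrow> heat_semigroup a l) F"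
proof (rule metric_tendsto_imp_tendsto)
  let ?g = "\<lambda>x. dist (f x) l + L * heat_moment TYPE('a) * \<bar>sqrt (max 0 (s x)) - sqrt (max 0 a)\<bar>"
  have "(?g \<longlongrightarrow> dist l l + L * heat_moment TYPE('a) * \<bar>sqrt (max 0 a) - sqrt (max 0 a)\<bar>) F"
    by (intro tendsto_intros f s)
  then show "(?g \<longlongrightarrow> 0) F" by simp
  have "dist (heat_semigroup (s x) (f x)) (heat_semigroup a l) \<le> ?g x" for x
    using dist_triangle[of "heat_semigroup (s x) (f x)" "heat_semigroup a l"
        "heat_semigroup (s x) l"]
      dist_heat_semigroup_le[of "s x" "f x" l] heat_semigroup_lip_time[OF l, of "s x" a] by linarith
  then show "\<forall>\<^sub>F x in F. dist (heat_semigroup (s x) (f x)) (heat_semigroup a l) \<le> dist (?g x) 0"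
    by (intro always_eventually allI) (metis abs_ge_self diff_zero dist_real_def order_trans)
qed

text \<open>Dominated convergence speaks about sequences; this form of vanishing at infinity makes
  it applicable to heat averages and to time integrals.\<close>

lemma C0_iff_seq:
  "f \<in> C0 \<longleftrightarrow> (\<forall>X. filterlim X at_infinity sequentially \<longrightarrow> (\<lambda>n. apply_bcontfun f (X n)) \<longlonglongrightarrow> 0)"
proof
  assume "f \<in> C0"
  then show "\<forall>X. filterlim X at_infinity sequentially \<longrightarrow> (\<lambda>n. apply_bcontfun f (X n)) \<longlonglongrightarrow> 0"
    unfolding C0_def using filterlim_compose by blast
next
  assume *: "\<forall>X. filterlim X at_infinity sequentially \<longrightarrow> (\<lambda>n. apply_bcontfun f (X n)) \<longlonglongrightarrow> 0"
  show "f \<in> C0"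
  proof (rule ccontr)
    assume "f \<notin> C0"
    then obtain e where e: "e > 0" "\<And>B. \<exists>x. B \<le> norm x \<and> \<not> dist (f x) 0 < e"
      unfolding C0_def tendsto_iff eventually_at_infinity by auto
    have "\<forall>n. \<exists>x. real n \<le> norm x \<and> \<not> dist (f x) 0 < e"
      using e(2) by blast
    then obtain X where X: "\<And>n. real n \<le> norm (X n) \<and> \<not> dist (f (X n)) 0 < e"
      unfolding choice_iff by blast
    have "filterlim X at_infinity sequentially"
      unfolding filterlim_at_infinity_conv_norm_at_top
      by (rule filterlim_at_top_mono[OF filterlim_real_sequentially]) (use X in auto)
    with * have "(\<lambda>n. f (X n)) \<longlonglongrightarrow> 0" by blast
    from tendstoD[OF this e(1)] X show False
      by (auto simp: eventually_sequentially)
  qed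
qed

lemma filterlim_diff_const_at_infinity:
  fixes X :: "nat \<Rightarrow> 'a::real_normed_vector"
  assumes "filterlim X at_infinity F"
  shows "filterlim (\<lambda>n. X n - c) at_infinity F"
  using tendsto_add_filterlim_at_infinity[OF tendsto_const[of "- c"] assms] by simp

lemma heat_semigroup_C0:
  fixes f :: "'a::euclidean_space \<Rightarrow>\<^sub>C complex"
  assumes f: "f \<in> C0"
  shows "heat_semigroup t f \<in> C0"
  unfolding C0_iff_seq
proof (intro allI impI)
  fix X :: "nat \<Rightarrow> 'a" assume X: "filterlim X at_infinity sequentially"
  let ?c = "sqrt (max 0 t)"
  have "(\<lambda>n. LINT y|lborel. heat_kernel 1 y *\<^sub>R f (X n - ?c *\<^sub>R y))
      \<longlonglongrightarrow> (LINT y|lborel. heat_kernel 1 (y::'a) *\<^sub>R 0)"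
  proof (rule integral_dominated_convergence)
    show "integrable lborel (\<lambda>y::'a. heat_kernel 1 y * norm f)"
      by (intro integrable_mult_left integrable_heat_kernel) auto
    have "(\<lambda>n. f (X n - ?c *\<^sub>R y)) \<longlonglongrightarrow> 0" for y
      using f[unfolded C0_iff_seq] filterlim_diff_const_at_infinity[OF X] by blast
    then show "AE y in lborel. (\<lambda>n. heat_kernel 1 y *\<^sub>R f (X n - ?c *\<^sub>R y)) \<longlonglongrightarrow> heat_kernel 1 y *\<^sub>R 0"
      by (intro AE_I2 tendsto_intros)
    show "AE y in lborel. norm (heat_kernel 1 y *\<^sub>R f (X n - ?c *\<^sub>R y)) \<le> heat_kernel 1 y * norm f"
        for n
      by (auto simp: heat_kernel_nonneg norm_bounded intro!: mult_left_mono)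
  qed auto
  then show "(\<lambda>n. heat_semigroup t f (X n)) \<longlonglongrightarrow> 0"
    by (simp add: heat_semigroup_eq)
qed

text \<open>Assume |w| \<le> |z| and let q = |w| / |z|. Since \<alpha> \<le> 1, q \<le> q^\<alpha>,
  and this bounds (|z|^\<alpha> - |w|^\<alpha>) |w| by |z|^\<alpha> |z - w|. The term |z|^\<alpha>
  (z - w) contributes the same amount, whence the constant 2.\<close>

lemma nonlin_lip:
  fixes z w :: complex
  assumes \<alpha>: "0 < \<alpha>" "\<alpha> \<le> 1" and M: "norm z \<le> M" "norm w \<le> M"
  shows "norm (of_real (norm z powr \<alpha>) * z - of_real (norm w powr \<alpha>) * w)
      \<le> 2 * M powr \<alpha> * norm (z - w)"
proof -
  have *: "norm (of_real (norm z powr \<alpha>) * z - of_real (norm w powr \<alpha>) * w)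
      \<le> 2 * M powr \<alpha> * norm (z - w)"
    if le: "norm w \<le> norm z" and M: "norm z \<le> M" for z w :: complex
  proof (cases "norm z = 0")
    case False
    then have z: "0 < norm z" by simp
    define q where "q = norm w / norm z"
    have q: "0 \<le> q" "q \<le> 1" using le z by (auto simp: q_def)
    have "norm w powr \<alpha> = norm z powr \<alpha> * q powr \<alpha>"
      using z q by (simp add: q_def powr_mult[symmetric])
    moreover have "q \<le> q powr \<alpha>"
      using powr_mono'[of \<alpha> 1 q] q \<alpha> by (cases "q = 0") auto
    ultimately have "norm z powr \<alpha> * q \<le> norm w powr \<alpha>"
      by (simp add: mult_left_mono)
    then have "(norm z powr \<alpha> - norm w powr \<alpha>) * norm w \<le> (norm z powr \<alpha> * (1 - q)) * norm w"
      by (intro mult_right_mono) (auto simp: algebra_simps)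
    also have "\<dots> \<le> (norm z powr \<alpha> * (1 - q)) * norm z"
      using le q by (intro mult_left_mono) auto
    also have "\<dots> = norm z powr \<alpha> * (norm z - norm w)"
      using z by (simp add: q_def algebra_simps)
    also have "\<dots> \<le> norm z powr \<alpha> * norm (z - w)"
      by (intro mult_left_mono norm_triangle_ineq2) auto
    finally have 1: "(norm z powr \<alpha> - norm w powr \<alpha>) * norm w \<le> norm z powr \<alpha> * norm (z - w)" .
    have "of_real (norm z powr \<alpha>) * z - of_real (norm w powr \<alpha>) * w
        = of_real (norm z powr \<alpha>) * (z - w) + of_real (norm z powr \<alpha> - norm w powr \<alpha>) * w"
      by (simp add: algebra_simps)
    also have "norm \<dots> \<le> norm z powr \<alpha> * norm (z - w) + (norm z powr \<alpha> - norm w powr \<alpha>) * norm w"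
      using powr_mono2[of \<alpha> "norm w" "norm z"] le \<alpha>
      by (intro order_trans[OF norm_triangle_ineq]) (simp add: norm_mult del: of_real_diff)
    also have "\<dots> \<le> 2 * norm z powr \<alpha> * norm (z - w)"
      using 1 by (simp add: mult_ac)
    also have "\<dots> \<le> 2 * M powr \<alpha> * norm (z - w)"
      using powr_mono2[of \<alpha> "norm z" M] M \<alpha> by (intro mult_right_mono) auto
    finally show ?thesis .
  qed (use le in simp)
  show ?thesis
    using *[of w z] *[of z w] M by (cases "norm w \<le> norm z") (auto simp: norm_minus_commute)
qed

subsection \<open>The Cauchy problem\<close>

instance bcontfun :: (metric_space, banach) banach ..

lemma power_nonlin_dist:
  fixes f g :: "'a::euclidean_space \<Rightarrow>\<^sub>C complex"
  assumes \<alpha>: "0 < \<alpha>" "\<alpha> \<le> 1" and M: "norm f \<le> M" "norm g \<le> M"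
  shows "dist (power_nonlin \<alpha> f) (power_nonlin \<alpha> g) \<le> 2 * M powr \<alpha> * dist f g"
proof (rule dist_bound)
  fix x
  have "norm (f x) \<le> M" "norm (g x) \<le> M"
    using M norm_bounded order_trans by blast+
  from nonlin_lip[OF \<alpha> this]
  have "dist (power_nonlin \<alpha> f x) (power_nonlin \<alpha> g x) \<le> 2 * M powr \<alpha> * dist (f x) (g x)"
    using \<alpha> by (simp add: apply_power_nonlin dist_norm)
  also have "\<dots> \<le> 2 * M powr \<alpha> * dist f g"
    by (intro mult_left_mono dist_bounded) auto
  finally show "dist (power_nonlin \<alpha> f x) (power_nonlin \<alpha> g x) \<le> 2 * M powr \<alpha> * dist f g" .
qed

lemma power_nonlin_0: "0 < \<alpha> \<Longrightarrow> power_nonlin \<alpha> 0 = (0 :: 'a::euclidean_space \<Rightarrow>\<^sub>C complex)"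
  by (rule bcontfun_eqI) (simp add: apply_power_nonlin)

lemma power_nonlin_norm:
  fixes f :: "'a::euclidean_space \<Rightarrow>\<^sub>C complex"
  assumes \<alpha>: "0 < \<alpha>" "\<alpha> \<le> 1" and M: "norm f \<le> M"
  shows "norm (power_nonlin \<alpha> f) \<le> 2 * M powr \<alpha> * M"
proof -
  have "0 \<le> M" using M norm_ge_zero order_trans by blast
  then have "norm (power_nonlin \<alpha> f) \<le> 2 * M powr \<alpha> * norm f"
    using power_nonlin_dist[OF \<alpha> M, of 0] \<alpha> by (simp add: power_nonlin_0 dist_norm)
  also have "\<dots> \<le> 2 * M powr \<alpha> * M" using M by (intro mult_left_mono) auto
  finally show ?thesis .
qed

lemma power_nonlin_odd:
  assumes "0 < \<alpha>" "odd_fun (apply_bcontfun (f :: 'a::euclidean_space \<Rightarrow>\<^sub>C complex))"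
  shows "odd_fun (power_nonlin \<alpha> f)"
  using assms by (simp add: odd_fun_def apply_power_nonlin)

lemma power_nonlin_lip:
  fixes f :: "'a::euclidean_space \<Rightarrow>\<^sub>C complex"
  assumes \<alpha>: "0 < \<alpha>" "\<alpha> \<le> 1" and M: "norm f \<le> M" and L: "lip_fun L f"
  shows "lip_fun (2 * M powr \<alpha> * L) (power_nonlin \<alpha> f)"
  unfolding lip_fun_def
proof (intro allI)
  fix x y
  have "norm (f x) \<le> M" "norm (f y) \<le> M"
    using M norm_bounded order_trans by blast+
  from nonlin_lip[OF \<alpha> this]
  have "norm (power_nonlin \<alpha> f x - power_nonlin \<alpha> f y) \<le> 2 * M powr \<alpha> * norm (f x - f y)"
    using \<alpha> by (simp add: apply_power_nonlin)
  also have "\<dots> \<le> 2 * M powr \<alpha> * (L * norm (x - y))"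
    using L by (intro mult_left_mono) (auto simp: lip_fun_def)
  finally show "norm (power_nonlin \<alpha> f x - power_nonlin \<alpha> f y) \<le> 2 * M powr \<alpha> * L * norm (x - y)"
    by (simp add: mult_ac)
qed

lemma power_nonlin_C0:
  fixes f :: "'a::euclidean_space \<Rightarrow>\<^sub>C complex"
  assumes \<alpha>: "0 < \<alpha>" "\<alpha> \<le> 1" and f: "f \<in> C0"
  shows "power_nonlin \<alpha> f \<in> C0"
proof -
  have "norm (power_nonlin \<alpha> f x) \<le> norm (f x) * (norm f powr \<alpha>)" for x
    using \<alpha> norm_bounded[of f x]
    by (simp add: apply_power_nonlin norm_mult mult.commute[of "norm (f x)"] mult_right_mono
        powr_mono2)
  moreover have "((\<lambda>x. norm (f x) * (norm f powr \<alpha>)) \<longlongrightarrow> 0) at_infinity"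
    using f unfolding C0_def by (intro tendsto_mult_left_zero tendsto_norm_zero) simp
  ultimately show ?thesis
    unfolding C0_def by (metis (no_types, lifting) Lim_null_comparison always_eventually
        mem_Collect_eq)
qed

lemma bounded_linear_apply_bcontfun: "bounded_linear
    (\<lambda>f :: 'a::topological_space \<Rightarrow>\<^sub>C 'b::real_normed_vector. f x)"
  by (rule bounded_linear_intro[of _ 1]) (auto simp: norm_bounded)

lemma integral_apply_bcontfun:
  fixes g :: "real \<Rightarrow> 'a::topological_space \<Rightarrow>\<^sub>C complex"
  assumes "g integrable_on S"
  shows "(\<lambda>s. g s x) integrable_on S" and "integral S g x = integral S (\<lambda>s. g s x)"
  using integrable_linear[OF assms bounded_linear_apply_bcontfun]
      integral_linear[OF assms bounded_linear_apply_bcontfun]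
  by (auto simp: comp_def)

text \<open>Complex multiples, on top of the real vector space structure of the type, for the
  coefficient \<open>\<kappa>\<close> of the nonlinearity.\<close>

definition cmul_bcontfun :: "complex \<Rightarrow> ('a::topological_space \<Rightarrow>\<^sub>C complex) \<Rightarrow> 'a \<Rightarrow>\<^sub>C complex" where
  "cmul_bcontfun c f = Bcontfun (\<lambda>x. c * f x)"

lemma apply_cmul_bcontfun [simp]: "cmul_bcontfun c f x = c * f x"
proof -
  have "(\<lambda>x. c * f x) \<in> bcontfun"
    by (rule bcontfun_normI[of _ "norm c * norm f"])
       (auto simp: norm_mult norm_bounded intro!: continuous_intros mult_left_mono)
  then show ?thesis by (simp add: cmul_bcontfun_def Bcontfun_inverse)
qed

lemma bounded_linear_cmul_bcontfun: "bounded_linear (cmul_bcontfun c)"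
proof (rule bounded_linear_intro[of _ "norm c"])
  show "norm (cmul_bcontfun c f) \<le> norm f * norm c" for f :: "'a \<Rightarrow>\<^sub>C complex"
    by (rule norm_bound) (simp add: norm_mult mult.commute mult_left_mono norm_bounded)
qed (auto intro!: bcontfun_eqI simp: algebra_simps)

lemma norm_cmul_bcontfun: "norm (cmul_bcontfun c f) \<le> norm c * norm f"
  by (rule norm_bound) (simp add: norm_mult mult_left_mono norm_bounded)

text \<open>Each condition survives the heat semigroup and the nonlinearity, up to the constants M
  and L, and is closed under uniform limits. A fixed point inherits them; oddness and the Lipschitz
  bound together give |f(x)| \<le> L |x|.\<close>

definition lip_ball :: "real \<Rightarrow> real \<Rightarrow> ('a::euclidean_space \<Rightarrow>\<^sub>C complex) set" where
  "lip_ball M L = {f. norm f \<le> M \<and> f \<in> C0 \<and> odd_fun f \<and> lip_fun L f}"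

lemma closed_lip_ball: "closed (lip_ball M L)"
  unfolding closed_sequential_limits
proof (intro allI impI)
  fix f :: "nat \<Rightarrow> 'a \<Rightarrow>\<^sub>C complex" and l
  assume *: "(\<forall>n. f n \<in> lip_ball M L) \<and> f \<longlonglongrightarrow> l"
  then have Q: "\<And>n. norm (f n) \<le> M" "\<And>n. f n \<in> C0" "\<And>n. odd_fun (f n)" "\<And>n. lip_fun L (f n)"
    and lim: "f \<longlonglongrightarrow> l"
    by (auto simp: lip_ball_def)
  have pt: "(\<lambda>n. f n x) \<longlonglongrightarrow> l x" for x
    by (rule bounded_linear.tendsto[OF bounded_linear_apply_bcontfun lim])
  have "norm l \<le> M"
    using Q(1) by (intro Lim_norm_ubound[OF _ lim]) auto
  moreover have "l \<in> C0"
    unfolding C0_def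
  proof (simp, rule tendstoI)
    fix e :: real assume e: "0 < e"
    from tendstoD[OF lim, of "e/2"] e obtain n where n: "dist (f n) l < e / 2"
      by (auto simp: eventually_sequentially)
    have "\<forall>\<^sub>F x in at_infinity. dist (f n x) 0 < e / 2"
      using Q(2)[of n] e tendstoD unfolding C0_def by (metis half_gt_zero mem_Collect_eq)
    then show "\<forall>\<^sub>F x in at_infinity. dist (l x) 0 < e"
    proof eventually_elim
      case (elim x)
      have "dist (l x) 0 \<le> dist (f n x) (l x) + dist (f n x) 0"
        by (metis dist_triangle3)
      also have "dist (f n x) (l x) \<le> dist (f n) l" by (rule dist_bounded)
      finally show ?case using elim n by linarith
    qed
  qed
  moreover have "odd_fun l"
    unfolding odd_fun_def
  proof
    fix x
    have "(\<lambda>n. f n (- x)) \<longlonglongrightarrow> - l x"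
      using Q(3) tendsto_minus[OF pt[of x]] by (simp add: odd_fun_def)
    then show "l (- x) = - l x"
      using LIMSEQ_unique pt by blast
  qed
  moreover have "lip_fun L l"
    unfolding lip_fun_def
  proof (intro allI)
    fix x y
    show "norm (l x - l y) \<le> L * norm (x - y)"
      by (rule Lim_norm_ubound[OF _ tendsto_diff[OF pt pt]]) (use Q(4) in \<open>auto simp: lip_fun_def\<close>)
  qed
  ultimately show "l \<in> lip_ball M L" by (simp add: lip_ball_def)
qed

lemma power_nonlin_continuous:
  fixes w :: "'b::topological_space \<Rightarrow> 'a::euclidean_space \<Rightarrow>\<^sub>C complex"
  assumes \<alpha>: "0 < \<alpha>" "\<alpha> \<le> 1" and w: "continuous_on S w" and M: "\<And>s. s \<in> S \<Longrightarrow> norm (w s) \<le> M"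
  shows "continuous_on S (\<lambda>s. power_nonlin \<alpha> (w s))"
  unfolding continuous_on_def
proof
  fix s assume s: "s \<in> S"
  show "((\<lambda>s. power_nonlin \<alpha> (w s)) \<longlongrightarrow> power_nonlin \<alpha> (w s)) (at s within S)"
  proof (rule metric_tendsto_imp_tendsto)
    have "((\<lambda>x. 2 * M powr \<alpha> * dist (w x) (w s)) \<longlongrightarrow> 2 * M powr \<alpha> * dist (w s) (w s)) (at s within S)"
      using w s by (intro tendsto_intros) (auto simp: continuous_on_def)
    then show "((\<lambda>x. 2 * M powr \<alpha> * dist (w x) (w s)) \<longlongrightarrow> 0) (at s within S)" by simp
    show "\<forall>\<^sub>F x in at s within S. dist (power_nonlin \<alpha> (w x)) (power_nonlin \<alpha> (w s))
        \<le> dist (2 * M powr \<alpha> * dist (w x) (w s)) 0"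
      using power_nonlin_dist[OF \<alpha> M M[OF s]]
      by (auto simp: eventually_at_filter abs_mult)
  qed
qed

lemma integral_C0:
  fixes g :: "real \<Rightarrow> 'a::euclidean_space \<Rightarrow>\<^sub>C complex"
  assumes g: "continuous_on {a..b} g" and C0: "\<And>s. s \<in> {a..b} \<Longrightarrow> g s \<in> C0"
  shows "integral {a..b} g \<in> C0"
  unfolding C0_iff_seq
proof (intro allI impI)
  fix X :: "nat \<Rightarrow> 'a" assume X: "filterlim X at_infinity sequentially"
  have int: "g integrable_on {a..b}" by (rule integrable_continuous_real[OF g])
  have "bounded (g ` {a..b})"
    by (intro compact_imp_bounded compact_continuous_image g) auto
  then obtain B where B': "\<forall>s\<in>{a..b}. norm (g s) \<le> B"
    unfolding bounded_iff by auto
  then have B: "\<And>s. s \<in> {a..b} \<Longrightarrow> norm (g s) \<le> B" by blast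
  have "(\<lambda>n. integral {a..b} (\<lambda>s. g s (X n))) \<longlonglongrightarrow> integral {a..b} (\<lambda>s. 0)"
  proof (rule dominated_convergence(2))
    show "(\<lambda>s. g s (X n)) integrable_on {a..b}" for n
      by (rule integral_apply_bcontfun(1)[OF int])
    show "(\<lambda>s. B) integrable_on {a..b}" by (rule integrable_const_ivl)
    show "norm (g s (X n)) \<le> B" if "s \<in> {a..b}" for n s
      using B[OF that] norm_bounded order_trans by blast
    show "(\<lambda>n. g s (X n)) \<longlonglongrightarrow> 0" if "s \<in> {a..b}" for s
      using C0[OF that] X by (auto simp: C0_iff_seq)
  qed
  then show "(\<lambda>n. integral {a..b} g (X n)) \<longlonglongrightarrow> 0"
    by (simp add: integral_apply_bcontfun(2)[OF int])
qed

lemma integral_norm_le_const: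
  fixes g :: "real \<Rightarrow> 'b::banach"
  assumes "g integrable_on {0..t}" "\<And>s. s \<in> {0..t} \<Longrightarrow> norm (g s) \<le> B" "0 \<le> t"
  shows "norm (integral {0..t} g) \<le> B * t"
  using integral_norm_bound_integral[of g "{0..t}" "\<lambda>_. B"] assms
  by (simp add: mult.commute integrable_const_ivl)

section \<open>The Duhamel integral and local existence\<close>

definition duhamel :: "real \<Rightarrow> (real \<Rightarrow> 'a::euclidean_space \<Rightarrow>\<^sub>C complex) \<Rightarrow> real \<Rightarrow> 'a \<Rightarrow>\<^sub>C complex"
    where
  "duhamel \<alpha> w t = integral {0..t} (\<lambda>\<sigma>. heat_semigroup (t - \<sigma>) (power_nonlin \<alpha> (w \<sigma>)))"

lemma duhamel_integrand_continuous:
  fixes w :: "real \<Rightarrow> 'a::euclidean_space \<Rightarrow>\<^sub>C complex"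
  assumes \<alpha>: "0 < \<alpha>" "\<alpha> \<le> 1" and w: "continuous_on S w" and Q: "\<And>s. s \<in> S \<Longrightarrow> w s \<in> lip_ball M L"
  shows "continuous_on (T \<times> S) (\<lambda>(t, \<sigma>). heat_semigroup (t - \<sigma>) (power_nonlin \<alpha> (w \<sigma>)))"
  unfolding continuous_on_def
proof (clarify)
  fix t \<sigma> assume t: "t \<in> T" and s: "\<sigma> \<in> S"
  have M: "norm (w s) \<le> M" if "s \<in> S" for s using Q[OF that] by (simp add: lip_ball_def)
  have L: "lip_fun L (w s)" if "s \<in> S" for s using Q[OF that] by (simp add: lip_ball_def)
  have c: "continuous_on (T \<times> S) (\<lambda>p. power_nonlin \<alpha> (w (snd p)))"
    by (rule continuous_on_compose2[OF power_nonlin_continuous[OF \<alpha> w M]])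
        (auto intro: continuous_intros)
  have "((\<lambda>p. heat_semigroup (fst p - snd p) (power_nonlin \<alpha> (w (snd p)))) \<longlongrightarrow>
     heat_semigroup (t - \<sigma>) (power_nonlin \<alpha> (w \<sigma>))) (at (t, \<sigma>) within T \<times> S)"
  proof (rule heat_semigroup_tendsto)
    show "((\<lambda>p. power_nonlin \<alpha> (w (snd p))) \<longlongrightarrow> power_nonlin \<alpha> (w \<sigma>)) (at (t, \<sigma>) within T \<times> S)"
      using c t s unfolding continuous_on_def by force
    show "((\<lambda>p. fst p - snd p) \<longlongrightarrow> t - \<sigma>) (at (t, \<sigma>) within T \<times> S)"
      by (auto intro!: tendsto_eq_intros)
    show "lip_fun (2 * M powr \<alpha> * L) (power_nonlin \<alpha> (w \<sigma>))"
      by (rule power_nonlin_lip[OF \<alpha> M[OF s] L[OF s]])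
  qed
  then show "((\<lambda>(t, \<sigma>). heat_semigroup (t - \<sigma>) (power_nonlin \<alpha> (w \<sigma>))) \<longlongrightarrow>
     heat_semigroup (t - \<sigma>) (power_nonlin \<alpha> (w \<sigma>))) (at (t, \<sigma>) within T \<times> S)"
    by (simp add: case_prod_unfold)
qed

lemma duhamel_props:
  fixes w :: "real \<Rightarrow> 'a::euclidean_space \<Rightarrow>\<^sub>C complex"
  assumes \<alpha>: "0 < \<alpha>" "\<alpha> \<le> 1" and w: "continuous_on {0..\<tau>} w"
    and Q: "\<forall>s\<in>{0..\<tau>}. w s \<in> lip_ball M L" and t: "0 \<le> t" "t \<le> \<tau>"
  shows "(\<lambda>\<sigma>. heat_semigroup (t - \<sigma>) (power_nonlin \<alpha> (w \<sigma>))) integrable_on {0..t}"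
    and "norm (duhamel \<alpha> w t) \<le> 2 * M powr \<alpha> * M * t"
    and "duhamel \<alpha> w t \<in> C0" and "odd_fun (duhamel \<alpha> w t)"
    and "lip_fun (2 * M powr \<alpha> * L * t) (duhamel \<alpha> w t)"
proof -
  let ?g = "\<lambda>\<sigma>. heat_semigroup (t - \<sigma>) (power_nonlin \<alpha> (w \<sigma>))"
  have Qd: "norm (w s) \<le> M" "w s \<in> C0" "odd_fun (w s)" "lip_fun L (w s)" if "s \<in> {0..t}" for s
    using Q[rule_format, of s] that t by (auto simp: lip_ball_def)
  have sub: "{0..t} \<subseteq> {0..\<tau>}" using t by auto
  have "continuous_on ({t} \<times> {0..t}) (\<lambda>(t, \<sigma>). heat_semigroup (t - \<sigma>) (power_nonlin \<alpha> (w \<sigma>)))"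
    using Q sub by (intro duhamel_integrand_continuous[OF \<alpha> continuous_on_subset[OF w sub], where M
        = M and L = L]) auto
  from continuous_on_compose2[OF this, of "{0..t}" "\<lambda>\<sigma>. (t, \<sigma>)"]
  have cont: "continuous_on {0..t} ?g"
    by (auto simp: continuous_on_Pair)
  show int: "?g integrable_on {0..t}" by (rule integrable_continuous_real[OF cont])
  note [simp] = integral_apply_bcontfun(2)[OF int]
  have "norm (?g s) \<le> 2 * M powr \<alpha> * M" if "s \<in> {0..t}" for s
    using norm_heat_semigroup_le power_nonlin_norm[OF \<alpha> Qd(1)[OF that]] order_trans by blast
  then show "norm (duhamel \<alpha> w t) \<le> 2 * M powr \<alpha> * M * t"
    unfolding duhamel_def by (intro integral_norm_le_const int t)
  show "duhamel \<alpha> w t \<in> C0"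
    unfolding duhamel_def using Qd by (intro integral_C0 cont heat_semigroup_C0 power_nonlin_C0 \<alpha>)
  have odd: "odd_fun (?g s)" if "s \<in> {0..t}" for s
    using Qd[OF that] by (intro heat_semigroup_odd power_nonlin_odd \<alpha>)
  show "odd_fun (duhamel \<alpha> w t)"
    unfolding odd_fun_def duhamel_def
  proof
    fix x
    have "integral {0..t} ?g (- x) = integral {0..t} (\<lambda>s. - ?g s x)"
      unfolding integral_apply_bcontfun(2)[OF int]
      by (rule integral_cong) (use odd in \<open>simp add: odd_fun_def\<close>)
    then show "integral {0..t} ?g (- x) = - integral {0..t} ?g x" by simp
  qed
  show "lip_fun (2 * M powr \<alpha> * L * t) (duhamel \<alpha> w t)"
    unfolding lip_fun_def duhamel_def
  proof (intro allI)
    fix x y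
    have "integral {0..t} ?g x - integral {0..t} ?g y = integral {0..t} (\<lambda>s. ?g s x - ?g s y)"
      by (simp add: Henstock_Kurzweil_Integration.integral_diff integral_apply_bcontfun(1)[OF int])
    also have "norm \<dots> \<le> (2 * M powr \<alpha> * L * norm (x - y)) * t"
    proof (rule integral_norm_le_const)
      show "(\<lambda>s. ?g s x - ?g s y) integrable_on {0..t}"
        by (intro integrable_diff integral_apply_bcontfun(1) int)
      fix s assume s: "s \<in> {0..t}"
      have "lip_fun (2 * M powr \<alpha> * L) (?g s)"
        using Qd[OF s] by (intro heat_semigroup_lip power_nonlin_lip \<alpha>)
      then show "norm (?g s x - ?g s y) \<le> 2 * M powr \<alpha> * L * norm (x - y)"
        by (simp add: lip_fun_def)
    qed (rule t)
    finally show "norm (integral {0..t} ?g x - integral {0..t} ?g y)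
        \<le> 2 * M powr \<alpha> * L * t * norm (x - y)"
      by (simp add: mult_ac)
  qed
qed

text \<open>The variable upper limit is removed: for \<sigma> > t the semigroup at t - \<sigma> is
  the identity, so the Duhamel integral is a parameter integral over the fixed interval [0, \<tau>]
  minus the integral of the nonlinearity over [t, \<tau>]. Both are continuous in t.\<close>

lemma duhamel_continuous:
  fixes w :: "real \<Rightarrow> 'a::euclidean_space \<Rightarrow>\<^sub>C complex"
  assumes \<alpha>: "0 < \<alpha>" "\<alpha> \<le> 1" and w: "continuous_on {0..\<tau>} w"
    and Q: "\<forall>s\<in>{0..\<tau>}. w s \<in> lip_ball M L"
  shows "continuous_on {0..\<tau>} (duhamel \<alpha> w)"
proof -
  let ?h = "\<lambda>t \<sigma>. heat_semigroup (t - \<sigma>) (power_nonlin \<alpha> (w \<sigma>))"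
  let ?F = "\<lambda>\<sigma>. power_nonlin \<alpha> (w \<sigma>)"
  have M: "norm (w s) \<le> M" if "s \<in> {0..\<tau>}" for s using Q that by (simp add: lip_ball_def)
  have h: "continuous_on ({0..\<tau>} \<times> {0..\<tau>}) (\<lambda>(t, \<sigma>). ?h t \<sigma>)"
    by (rule duhamel_integrand_continuous[OF \<alpha> w Q[rule_format]])
  have "continuous_on {0..\<tau>} (\<lambda>t. integral (cbox 0 \<tau>) (?h t))"
    using h by (intro integral_continuous_on_param) simp
  moreover have "?F integrable_on {0..\<tau>}"
    by (intro integrable_continuous_real power_nonlin_continuous[OF \<alpha> w M])
  from indefinite_integral_continuous_1'[OF this]
  have "continuous_on {0..\<tau>} (\<lambda>t. integral {t..\<tau>} ?F)" .
  ultimately have "continuous_on {0..\<tau>} (\<lambda>t. integral (cbox 0 \<tau>) (?h t) - integral {t..\<tau>} ?F)"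
    by (intro continuous_intros)
  moreover have "integral (cbox 0 \<tau>) (?h t) - integral {t..\<tau>} ?F = duhamel \<alpha> w t" if t: "t \<in> {0..\<tau>}"
      for t
  proof -
    have "continuous_on {0..\<tau>} (?h t)"
      using continuous_on_compose2[OF h, of "{0..\<tau>}" "\<lambda>\<sigma>. (t, \<sigma>)"] t
      by (simp add: continuous_on_Pair image_subset_iff)
    then have "?h t integrable_on {0..\<tau>}" by (rule integrable_continuous_real)
    from Henstock_Kurzweil_Integration.integral_combine[OF _ _ this, of t]
    have "integral {0..t} (?h t) + integral {t..\<tau>} (?h t) = integral {0..\<tau>} (?h t)"
      using t by simp
    moreover have "integral {t..\<tau>} (?h t) = integral {t..\<tau>} ?F"
      by (rule integral_cong) (simp add: heat_semigroup_def)
    ultimately show ?thesis by (simp add: duhamel_def algebra_simps)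
  qed
  ultimately show ?thesis by (subst continuous_on_cong[OF refl, symmetric]) auto
qed

text \<open>Besides a solution, the contraction argument has to provide oddness and a Lipschitz
  bound on a closed time interval. These are built into the set on which the fixed point is sought,
  with the Lipschitz constant of the datum doubled.\<close>

lemma local_existence:
  fixes u0 :: "'a::euclidean_space \<Rightarrow>\<^sub>C complex"
  assumes \<alpha>: "0 < \<alpha>" "\<alpha> \<le> 1" and u0: "u0 \<in> C0" "odd_fun u0" "lip_fun L u0" and L: "0 \<le> L"
  shows "\<exists>\<tau> M w. 0 < \<tau> \<and> mild_solution \<alpha> \<kappa> u0 (ereal \<tau>) w \<and> continuous_on {0..\<tau>} w \<and>
     (\<forall>t\<in>{0..\<tau>}. w t \<in> lip_ball M (2 * L))"
proof -
  \<comment> \<open>Half of M is for the datum and half for the Duhamel term; adding 1 keeps M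
    positive for a zero datum.\<close>
  define M where "M = 2 * (norm u0 + 1)"
  have M: "0 < M" "2 * norm u0 \<le> M" by (auto simp: M_def add_nonneg_pos)
  \<comment> \<open>The single inequality 4 |\<kappa>| M^\<alpha> \<tau> \<le> 1 gives all three
    requirements: the sup bound M, the Lipschitz bound 2 L and the contraction factor 1/2. The
    summand 1 keeps the denominator positive.\<close>
  define \<tau> where "\<tau> = 1 / (4 * (1 + norm \<kappa>) * M powr \<alpha>)"
  have \<tau>: "0 < \<tau>" using M by (auto simp: \<tau>_def add_pos_nonneg)
  have \<tau>': "4 * norm \<kappa> * M powr \<alpha> * \<tau> \<le> 1"
    using M by (simp add: \<tau>_def divide_le_eq add_pos_nonneg field_simps)
  \<comment> \<open>Clamping time to [0, \<tau>] extends paths by constants, so the fixed point can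
    be taken in the complete space of bounded continuous functions of a real time variable.\<close>
  define c where "c t = max 0 (min t \<tau>)" for t
  have c: "c t \<in> {0..\<tau>}" "t \<in> {0..\<tau>} \<Longrightarrow> c t = t" for t using \<tau> by (auto simp: c_def)
  define G where "G w t = heat_semigroup t u0 + cmul_bcontfun \<kappa> (duhamel \<alpha> (apply_bcontfun w) t)"
      for w t
  define S where "S = PiC (UNIV :: real set) (\<lambda>_. lip_ball M (2 * L) :: ('a \<Rightarrow>\<^sub>C complex) set)"
  have S: "w \<in> S \<longleftrightarrow> (\<forall>t. w t \<in> lip_ball M (2 * L))" for w
    by (auto simp: S_def mem_PiC_iff)
  have GQ: "G w t \<in> lip_ball M (2 * L)" if w: "w \<in> S" and t: "t \<in> {0..\<tau>}" for w t
  proof -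
    have Qw: "\<forall>s\<in>{0..\<tau>}. w s \<in> lip_ball M (2 * L)" using w by (simp add: S)
    note D = duhamel_props[OF \<alpha> continuous_on_apply_bcontfun Qw, of t]
    have t0: "0 \<le> t" "t \<le> \<tau>" using t by auto
    have kt: "4 * norm \<kappa> * M powr \<alpha> * t \<le> 1"
      using t0 M by (intro order_trans[OF mult_left_mono \<tau>']) auto
    have "norm (G w t) \<le> norm (heat_semigroup t u0) + norm \<kappa> * norm (duhamel \<alpha> w t)"
      unfolding G_def by (intro order_trans[OF norm_triangle_ineq] add_left_mono norm_cmul_bcontfun)
    also have "\<dots> \<le> norm u0 + norm \<kappa> * (2 * M powr \<alpha> * M * t)"
      using D(2) t0 by (intro add_mono norm_heat_semigroup_le mult_left_mono) auto
    also have "\<dots> \<le> M / 2 + M / 2"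
      using M mult_right_mono[OF kt, of "M / 2"] by (intro add_mono) (auto simp: mult_ac)
    finally have "norm (G w t) \<le> M" by simp
    moreover have "G w t \<in> C0"
    proof -
      have "(heat_semigroup t u0 \<longlongrightarrow> 0) at_infinity" "(duhamel \<alpha> w t \<longlongrightarrow> 0) at_infinity"
        using D(3)[OF t0] heat_semigroup_C0[OF u0(1)] by (auto simp: C0_def)
      then have "((\<lambda>x. heat_semigroup t u0 x + \<kappa> * duhamel \<alpha> w t x) \<longlongrightarrow> 0 + \<kappa> * 0) at_infinity"
        by (intro tendsto_intros)
      then show ?thesis by (simp add: C0_def G_def)
    qed
    moreover have "odd_fun (G w t)"
      using D(4)[OF t0] heat_semigroup_odd[OF u0(2), of t] by (simp add: odd_fun_def G_def)
    moreover have "lip_fun (2 * L) (G w t)"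
      unfolding lip_fun_def
    proof (intro allI)
      fix x y
      have "G w t x - G w t y = (heat_semigroup t u0 x - heat_semigroup t u0 y) + \<kappa>
          * (duhamel \<alpha> w t x - duhamel \<alpha> w t y)"
        by (simp add: G_def algebra_simps)
      also have "norm \<dots> \<le> L * norm (x - y) + norm \<kappa> * (2 * M powr \<alpha> * (2 * L) * t * norm (x - y))"
        using heat_semigroup_lip[OF u0(3), of t] D(5)[OF t0]
        by (intro order_trans[OF norm_triangle_ineq] add_mono)
            (auto simp: lip_fun_def norm_mult intro!: mult_left_mono)
      also have "\<dots> = L * norm (x - y) + (4 * norm \<kappa> * M powr \<alpha> * t) * (L * norm (x - y))"
        by (simp add: mult_ac)
      also have "\<dots> \<le> L * norm (x - y) + 1 * (L * norm (x - y))"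
        using L by (intro add_left_mono mult_right_mono kt) auto
      finally show "norm (G w t x - G w t y) \<le> 2 * L * norm (x - y)" by simp
    qed
    ultimately show ?thesis by (simp add: lip_ball_def)
  qed
  have Gc: "continuous_on {0..\<tau>} (G w)" if w: "w \<in> S" for w
  proof -
    have "continuous_on {0..\<tau>} (\<lambda>t. heat_semigroup t u0)"
      unfolding continuous_on_def using u0(3) by
          (auto intro!: heat_semigroup_tendsto tendsto_intros)
    moreover have "continuous_on {0..\<tau>} (duhamel \<alpha> w)"
      using w by (intro duhamel_continuous[OF \<alpha>, where M = M and L = "2 * L"]) (auto simp: S)
    ultimately show ?thesis
      unfolding G_def[abs_def]
      by (intro continuous_intros bounded_linear.continuous_on[OF bounded_linear_cmul_bcontfun])
  qed
  define \<Phi> where "\<Phi> w = Bcontfun (\<lambda>t. G w (c t))" for w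
  have \<Phi>: "\<Phi> w t = G w (c t)" if w: "w \<in> S" for w t
  proof -
    have "continuous_on UNIV (\<lambda>t. G w (c t))"
      by (rule continuous_on_compose2[OF Gc[OF w]])
          (auto simp: c_def \<tau> less_imp_le intro!: continuous_intros)
    moreover have "norm (G w (c t)) \<le> M" for t
      using GQ[OF w c(1)] by (simp add: lip_ball_def)
    ultimately have "(\<lambda>t. G w (c t)) \<in> bcontfun" by (rule bcontfun_normI)
    then show ?thesis by (simp add: \<Phi>_def Bcontfun_inverse)
  qed
  have "\<exists>!w\<in>S. \<Phi> w = w"
  proof (rule Banach_fix[of _ "1/2"])
    show "complete S"
      unfolding complete_eq_closed S_def by (intro closed_PiC closed_lip_ball)
    have "const_bcontfun 0 \<in> S"
      using M L by (auto simp: S lip_ball_def const_bcontfun.rep_eq C0_def odd_fun_def lip_fun_def)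
    then show "S \<noteq> {}" by blast
    show "\<Phi> ` S \<subseteq> S"
      using GQ c(1) by (auto simp: S \<Phi>)
    fix v w assume v: "v \<in> S" and w: "w \<in> S"
    show "dist (\<Phi> v) (\<Phi> w) \<le> 1/2 * dist v w"
    proof (rule dist_bound)
      fix t0 :: real
      let ?t = "c t0"
      have t: "0 \<le> ?t" "?t \<le> \<tau>" using c(1)[of t0] by auto
      have Qv: "\<forall>s\<in>{0..\<tau>}. v s \<in> lip_ball M (2 * L)" and Qw: "\<forall>s\<in>{0..\<tau>}. w s \<in> lip_ball M (2 * L)"
        using v w by (auto simp: S)
      let ?h = "\<lambda>w \<sigma>. heat_semigroup (?t - \<sigma>) (power_nonlin \<alpha> (w \<sigma>))"
      have iv: "?h v integrable_on {0..?t}" and iw: "?h w integrable_on {0..?t}"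
        using duhamel_props(1)[OF \<alpha> continuous_on_apply_bcontfun Qv t]
            duhamel_props(1)[OF \<alpha> continuous_on_apply_bcontfun Qw t] by auto
      have "duhamel \<alpha> v ?t - duhamel \<alpha> w ?t = integral {0..?t} (\<lambda>\<sigma>. ?h v \<sigma> - ?h w \<sigma>)"
        unfolding duhamel_def by (rule Henstock_Kurzweil_Integration.integral_diff[OF iv iw,
            symmetric])
      also have "norm \<dots> \<le> (2 * M powr \<alpha> * dist v w) * ?t"
      proof (rule integral_norm_le_const)
        fix s assume "s \<in> {0..?t}"
        have "norm (v s) \<le> M" "norm (w s) \<le> M" using v w by (auto simp: S lip_ball_def)
        from power_nonlin_dist[OF \<alpha> this]
        have "dist (?h v s) (?h w s) \<le> 2 * M powr \<alpha> * dist (v s) (w s)"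
          using dist_heat_semigroup_le order_trans by blast
        also have "\<dots> \<le> 2 * M powr \<alpha> * dist v w"
          by (intro mult_left_mono dist_bounded) auto
        finally show "norm (?h v s - ?h w s) \<le> 2 * M powr \<alpha> * dist v w"
          by (simp add: dist_norm)
      qed (use t iv iw in \<open>auto intro!: integrable_diff\<close>)
      finally have D: "norm (duhamel \<alpha> v ?t - duhamel \<alpha> w ?t) \<le> 2 * M powr \<alpha> * dist v w * ?t" .
      have "dist (\<Phi> v t0) (\<Phi> w t0) = norm (cmul_bcontfun \<kappa> (duhamel \<alpha> v ?t - duhamel \<alpha> w ?t))"
        by (simp add: \<Phi> v w G_def dist_norm linear_diff[OF
            bounded_linear.linear[OF bounded_linear_cmul_bcontfun]])
      also have "\<dots> \<le> norm \<kappa> * (2 * M powr \<alpha> * dist v w * ?t)"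
        by (rule order_trans[OF norm_cmul_bcontfun mult_left_mono[OF D]]) simp
      also have "\<dots> \<le> norm \<kappa> * (2 * M powr \<alpha> * dist v w * \<tau>)"
        using t by (intro mult_left_mono) auto
      also have "\<dots> \<le> 1/2 * dist v w"
        using mult_right_mono[OF \<tau>', of "dist v w / 2"] by (simp add: mult_ac)
      finally show "dist (\<Phi> v t0) (\<Phi> w t0) \<le> 1/2 * dist v w" .
    qed
  qed auto
  then obtain w where w: "w \<in> S" "\<Phi> w = w" by blast
  have wG: "w t = G w t" if "t \<in> {0..\<tau>}" for t
    using \<Phi>[OF w(1), of t] c(2)[OF that] w(2) by simp
  have Qw: "\<forall>s\<in>{0..\<tau>}. w s \<in> lip_ball M (2 * L)" using w by (simp add: S)
  have "mild_solution \<alpha> \<kappa> u0 (ereal \<tau>) w"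
    unfolding mild_solution_def
  proof (intro conjI allI impI)
    fix t assume t: "0 \<le> t \<and> ereal t < ereal \<tau>"
    show "w t \<in> C0" using Qw[rule_format, of t] t by (simp add: lip_ball_def)
    show "(\<lambda>\<sigma>. heat_semigroup (t - \<sigma>) (power_nonlin \<alpha> (w \<sigma>))) integrable_on {0..t}"
      using t by (intro duhamel_props(1)[OF \<alpha> continuous_on_apply_bcontfun Qw]) auto
    fix x
    have "w t x = G w t x" using wG[of t] t by simp
    then show "w t x = heat_semigroup t u0 x + \<kappa>
        * integral {0..t} (\<lambda>\<sigma>. heat_semigroup (t - \<sigma>) (power_nonlin \<alpha> (w \<sigma>))) x"
      by (simp add: G_def duhamel_def)
  qed (use \<tau> in auto)
  then show ?thesis using \<tau> Qw by blast
qed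

section \<open>Uniqueness and the maximal solution\<close>

lemma ereal_le_less: "s \<le> t \<Longrightarrow> ereal t < T \<Longrightarrow> ereal s < T"
  by (meson ereal_less_eq(3) order.strict_trans1)

text \<open>Continuity bounds both solutions on [0, t] by a common M, on which the nonlinearity is
  Lipschitz; the resulting integral inequality for the distance is closed by an exponential weight.
  The existence times may differ, which permits gluing and the transfer of properties of the local
  solution.\<close>

lemma mild_solution_unique:
  fixes u0 :: "'a::euclidean_space \<Rightarrow>\<^sub>C complex"
  assumes \<alpha>: "0 < \<alpha>" "\<alpha> \<le> 1" and u: "mild_solution \<alpha> \<kappa> u0 T1 u" and v: "mild_solution \<alpha> \<kappa> u0 T2 v"
    and t: "0 \<le> t" "ereal t < T1" "ereal t < T2"
  shows "u t = v t"
proof -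
  have sub: "{0..t} \<subseteq> {s. 0 \<le> s \<and> ereal s < T1}" "{0..t} \<subseteq> {s. 0 \<le> s \<and> ereal s < T2}"
    using t by (auto intro: ereal_le_less)
  have cu: "continuous_on {0..t} u" and cv: "continuous_on {0..t} v"
    using u v sub continuous_on_subset unfolding mild_solution_def by blast+
  have "bounded (u ` {0..t})" "bounded (v ` {0..t})"
    by (intro compact_imp_bounded compact_continuous_image cu cv; simp)+
  then obtain Mu Mv where Mu: "\<forall>s\<in>{0..t}. norm (u s) \<le> Mu" and Mv: "\<forall>s\<in>{0..t}. norm (v s) \<le> Mv"
    unfolding bounded_iff by auto
  define M where "M = max Mu Mv"
  have M: "norm (u s) \<le> M" "norm (v s) \<le> M" if "s \<in> {0..t}" for s
    using Mu Mv that by (auto simp: M_def le_max_iff_disj)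
  define K where "K = norm \<kappa> * (2 * M powr \<alpha>) + 1"
  have K: "0 < K" by (auto simp: K_def add_nonneg_pos)
  define d where "d s = dist (u s) (v s)" for s
  have cd: "continuous_on {0..t} d" unfolding d_def by (intro continuous_intros cu cv)
  have gron: "d s \<le> K * integral {0..s} d" if s: "s \<in> {0..t}" for s
  proof -
    let ?h = "\<lambda>w \<sigma>. heat_semigroup (s - \<sigma>) (power_nonlin \<alpha> (w \<sigma>))"
    have s': "0 \<le> s \<and> ereal s < T1" "0 \<le> s \<and> ereal s < T2" using s sub by auto
    have iu: "?h u integrable_on {0..s}" and iv: "?h v integrable_on {0..s}"
      using u v s' unfolding mild_solution_def by auto
    have id: "d integrable_on {0..s}"
      using s by (intro integrable_continuous_real continuous_on_subset[OF cd]) auto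
    have "u s - v s = cmul_bcontfun \<kappa> (integral {0..s} (?h u) - integral {0..s} (?h v))"
    proof (rule bcontfun_eqI)
      fix x
      have "u s x = heat_semigroup s u0 x + \<kappa> * integral {0..s} (?h u) x"
        "v s x = heat_semigroup s u0 x + \<kappa> * integral {0..s} (?h v) x"
        using u v s' unfolding mild_solution_def by blast+
      then show "(u s - v s) x = cmul_bcontfun \<kappa> (integral {0..s} (?h u)
          - integral {0..s} (?h v)) x"
        by (simp add: algebra_simps)
    qed
    then have "d s = norm (cmul_bcontfun \<kappa> (integral {0..s} (?h u) - integral {0..s} (?h v)))"
      by (simp only: d_def dist_norm)
    also have "\<dots> \<le> norm \<kappa> * norm (integral {0..s} (?h u) - integral {0..s} (?h v))"
      by (rule norm_cmul_bcontfun)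
    also have "integral {0..s} (?h u) - integral {0..s} (?h v)
        = integral {0..s} (\<lambda>\<sigma>. ?h u \<sigma> - ?h v \<sigma>)"
      by (rule Henstock_Kurzweil_Integration.integral_diff[OF iu iv, symmetric])
    also have "norm \<kappa> * norm \<dots> \<le> norm \<kappa> * integral {0..s} (\<lambda>\<sigma>. 2 * M powr \<alpha> * d \<sigma>)"
    proof (intro mult_left_mono integral_norm_bound_integral)
      fix r assume "r \<in> {0..s}"
      then have r: "r \<in> {0..t}" using s by auto
      show "norm (?h u r - ?h v r) \<le> 2 * M powr \<alpha> * d r"
        using order_trans[OF dist_heat_semigroup_le power_nonlin_dist[OF \<alpha> M[OF r]]]
            by (simp add: d_def dist_norm)
    qed (use iu iv id in \<open>auto intro!: integrable_diff integrable_on_mult_right\<close>)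
    also have "\<dots> = (K - 1) * integral {0..s} d"
      by (simp add: K_def)
    also have "\<dots> \<le> K * integral {0..s} d"
      by (intro mult_right_mono integral_nonneg id) (auto simp: d_def)
    finally show ?thesis .
  qed
  \<comment> \<open>At a maximum m of g one has d s \<le> g m exp(2 K s) on [0, t]. Inserted into
    the integral inequality, the rate 2 K produces d m \<le> d m / 2, so g vanishes.\<close>
  define g where "g s = d s * exp (- (2 * K * s))" for s
  have "continuous_on {0..t} g" unfolding g_def by (intro continuous_intros cd)
  then obtain m where m: "m \<in> {0..t}" "\<And>s. s \<in> {0..t} \<Longrightarrow> g s \<le> g m"
    using continuous_attains_sup[of "{0..t}" g] t by auto
  have gm: "0 \<le> g m" by (simp add: g_def d_def)
  have "d s \<le> g m * exp (2 * K * s)" if "s \<in> {0..t}" for s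
    using m(2)[OF that] by (simp add: g_def exp_minus field_simps)
  then have "integral {0..m} d \<le> integral {0..m} (\<lambda>s. g m * exp (2 * K * s))"
    using m(1) by (intro integral_le integrable_continuous_real continuous_on_subset[OF cd]
        continuous_intros) auto
  also have "((\<lambda>s. g m * exp (2 * K * s)) has_integral
      (g m * exp (2 * K * m) / (2 * K) - g m * exp (2 * K * 0) / (2 * K))) {0..m}"
    using m(1) K by (intro fundamental_theorem_of_calculus)
      (auto intro!: derivative_eq_intros simp flip: has_real_derivative_iff_has_vector_derivative)
  from integral_unique[OF this]
  have "integral {0..m} (\<lambda>s. g m * exp (2 * K * s)) \<le> g m * exp (2 * K * m) / (2 * K)"
    using gm K by simp
  finally have "d m \<le> K * (g m * exp (2 * K * m) / (2 * K))"
    using gron[OF m(1)] K mult_left_mono order_trans by (metis less_imp_le)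
  also have "\<dots> = d m / 2"
    using K by (simp add: g_def exp_minus field_simps)
  finally have "d m \<le> 0" by (simp add: d_def)
  then have "g m \<le> 0" by (simp add: g_def mult_nonpos_nonneg)
  with m(2)[of t] t have "g t \<le> 0" by auto
  then have "d t \<le> 0" by (simp add: g_def mult_le_0_iff)
  then show ?thesis by (simp add: d_def)
qed

text \<open>The maximal time is the supremum of all existence times, and the solutions are glued.
  Any extension is itself a solution, so its existence time cannot exceed the supremum.\<close>

lemma maximal_solution_exists:
  fixes u0 :: "'a::euclidean_space \<Rightarrow>\<^sub>C complex"
  assumes \<alpha>: "0 < \<alpha>" "\<alpha> \<le> 1" and w: "mild_solution \<alpha> \<kappa> u0 T w"
  shows "\<exists>Tmax u. maximal_solution \<alpha> \<kappa> u0 Tmax u"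
proof -
  define P where "P = {T. \<exists>v. mild_solution \<alpha> \<kappa> u0 T v}"
  define Tm where "Tm = Sup P"
  have TP: "T \<in> P" using w by (auto simp: P_def)
  have up: "T' \<le> Tm" if "mild_solution \<alpha> \<kappa> u0 T' v" for T' v
    unfolding Tm_def by (rule Sup_upper) (use that in \<open>auto simp: P_def\<close>)
  \<comment> \<open>By uniqueness the chosen value is the common value at time t of all solutions
    that exist beyond t.\<close>
  define u where "u t = (SOME x. \<exists>T v. mild_solution \<alpha> \<kappa> u0 T v \<and> ereal t < T \<and> v t = x)" for t
  have u_eq: "u t = v t" if v: "mild_solution \<alpha> \<kappa> u0 T v" and t: "0 \<le> t" "ereal t < T" for t T v
  proof -
    have "\<exists>T v. mild_solution \<alpha> \<kappa> u0 T v \<and> ereal t < T \<and> v t = u t"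
      unfolding u_def by (rule someI_ex) (use v t in blast)
    then show ?thesis using mild_solution_unique[OF \<alpha>] v t by metis
  qed
  have ex: "\<exists>T v. mild_solution \<alpha> \<kappa> u0 T v \<and> ereal t < T" if "ereal t < Tm" for t
    using that unfolding Tm_def less_Sup_iff P_def by blast
  have "mild_solution \<alpha> \<kappa> u0 Tm u"
    unfolding mild_solution_def
  proof (intro conjI)
    show "0 < Tm"
      using w up[OF w] unfolding mild_solution_def by auto
    show "continuous_on {t. 0 \<le> t \<and> ereal t < Tm} u"
      unfolding continuous_on_eq_continuous_within
    proof clarify
      fix t assume t: "0 \<le> t" "ereal t < Tm"
      obtain T v where v: "mild_solution \<alpha> \<kappa> u0 T v" "ereal t < T" using ex[OF t(2)] by blast
      \<comment> \<open>Continuity is local in time: [0, r) is a neighbourhood of t in the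
        half-line, and u agrees there with the single solution v.\<close>
      obtain r where r: "t < r" "ereal r < T"
        using ereal_dense2[OF v(2)] by auto
      have "continuous_on {t. 0 \<le> t \<and> ereal t < T} v" using v unfolding mild_solution_def by blast
      then have "continuous (at t within {t. 0 \<le> t \<and> ereal t < T}) v"
        using t v by (simp add: continuous_on_eq_continuous_within)
      then have "continuous (at t within {0..<r}) v"
        by (rule continuous_within_subset) (use r in \<open>auto intro: ereal_le_less[OF less_imp_le]\<close>)
      then have 1: "continuous (at t within {0..<r}) u"
        by (rule continuous_transform_within[of _ _ _ 1])
          (use t r in \<open>auto intro!: u_eq[OF v(1), symmetric] ereal_le_less[OF less_imp_le r(2)]\<close>)
      have eq: "at t within {t. 0 \<le> t \<and> ereal t < Tm} = at t within {0..<r}"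
        by (rule at_within_nhd[of _ "{..<r}"])
          (use t r(1) order.strict_trans2[OF ereal_le_less[OF less_imp_le r(2)] up[OF v(1)]] in
              \<open>auto\<close>)
      show "continuous (at t within {t. 0 \<le> t \<and> ereal t < Tm}) u"
        unfolding eq by (rule 1)
    qed
    show "\<forall>t. 0 \<le> t \<and> ereal t < Tm \<longrightarrow> u t \<in> C0 \<and>
        (\<lambda>\<sigma>. heat_semigroup (t - \<sigma>) (power_nonlin \<alpha> (u \<sigma>))) integrable_on {0..t} \<and>
        (\<forall>x. u t x = heat_semigroup t u0 x +
           \<kappa> * integral {0..t} (\<lambda>\<sigma>. heat_semigroup (t - \<sigma>) (power_nonlin \<alpha> (u \<sigma>))) x)"
    proof (intro allI impI, elim conjE)
      fix t assume t: "0 \<le> t" "ereal t < Tm"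
      obtain T v where v: "mild_solution \<alpha> \<kappa> u0 T v" "ereal t < T" using ex[OF t(2)] by blast
      have uv: "u s = v s" if "s \<in> {0..t}" for s
        using that v by (intro u_eq[OF v(1)]) (auto intro: ereal_le_less)
      have *: "v t \<in> C0 \<and>
        (\<lambda>\<sigma>. heat_semigroup (t - \<sigma>) (power_nonlin \<alpha> (v \<sigma>))) integrable_on {0..t} \<and>
        (\<forall>x. v t x = heat_semigroup t u0 x +
           \<kappa> * integral {0..t} (\<lambda>\<sigma>. heat_semigroup (t - \<sigma>) (power_nonlin \<alpha> (v \<sigma>))) x)"
        using v t unfolding mild_solution_def by blast
      have "integral {0..t} (\<lambda>\<sigma>. heat_semigroup (t - \<sigma>) (power_nonlin \<alpha> (u \<sigma>)))
          = integral {0..t} (\<lambda>\<sigma>. heat_semigroup (t - \<sigma>) (power_nonlin \<alpha> (v \<sigma>)))"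
        by (rule integral_cong) (simp add: uv)
      moreover have "(\<lambda>\<sigma>. heat_semigroup (t - \<sigma>) (power_nonlin \<alpha> (u \<sigma>))) integrable_on {0..t}"
        using * by (auto intro: integrable_eq simp: uv)
      ultimately show "u t \<in> C0 \<and>
        (\<lambda>\<sigma>. heat_semigroup (t - \<sigma>) (power_nonlin \<alpha> (u \<sigma>))) integrable_on {0..t} \<and>
        (\<forall>x. u t x = heat_semigroup t u0 x +
           \<kappa> * integral {0..t} (\<lambda>\<sigma>. heat_semigroup (t - \<sigma>) (power_nonlin \<alpha> (u \<sigma>))) x)"
        using * uv[of t] t by simp
    qed
  qed
  moreover have "T' = Tm" if "mild_solution \<alpha> \<kappa> u0 T' v" "Tm \<le> T'" for T' v
    using up[OF that(1)] that(2) by simp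
  ultimately show ?thesis unfolding maximal_solution_def by blast
qed

subsection \<open>Hermite functions and Bessel potentials\<close>

definition herm_symbol :: "'a::euclidean_space \<Rightarrow> nat \<Rightarrow> real \<Rightarrow> 'a \<Rightarrow> complex" where
  "herm_symbol e m t \<xi> = complex_of_real ((\<xi> \<bullet> e) ^ m * exp (- t * (norm \<xi>)\<^sup>2))"

text \<open>Up to the factor i^m (2 pi)^N this is the m-th derivative of
  \<open>heat_kernel t\<close> in direction \<open>e\<close>, that is, a Hermite polynomial in x
  \<bullet> e times a Gaussian.\<close>

definition herm :: "'a::euclidean_space \<Rightarrow> nat \<Rightarrow> real \<Rightarrow> 'a \<Rightarrow> complex" where
  "herm e m t = fourier (herm_symbol e m t)"

abbreviation pairing :: "'a::euclidean_space \<Rightarrow> nat \<Rightarrow> real \<Rightarrow> ('a \<Rightarrow> complex) \<Rightarrow> complex" where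
  "pairing e m r f \<equiv> (LINT x|lborel. f x * herm e m r x)"

text \<open>The exponent -s/2 cancels the multiplier in \<open>bessel_potential s\<close>: testing
  the Bessel potential of f with the transform of this symbol returns the pairing of f with
  \<open>herm e m t\<close>.\<close>

definition bessel_symbol :: "real \<Rightarrow> 'a::euclidean_space \<Rightarrow> nat \<Rightarrow> real \<Rightarrow> 'a \<Rightarrow> complex" where
  "bessel_symbol s e m t \<xi> = complex_of_real ((1 + (norm \<xi>)\<^sup>2) powr (- s / 2))
      * herm_symbol e m t \<xi>"

lemma one_plus_norm_sq_pos: "0 < 1 + (norm x)\<^sup>2"
  by (rule add_pos_nonneg) auto

lemma bessel_symbol_gauss_span:
  assumes "0 < t" "e \<in> Basis"
  shows "bessel_symbol s e m t \<in> gauss_span"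
proof -
  have "(\<lambda>x::'a. complex_of_real ((1 + (norm x)\<^sup>2) powr (- s / 2) * exp (- t * (norm x)\<^sup>2))) \<in>
      poly_span gauss_gen"
    using assms by (intro poly_span.base) (auto simp: gauss_gen_def)
  from poly_span_power[OF this assms(2), of m] show ?thesis
    by (simp add: bessel_symbol_def[abs_def] herm_symbol_def gauss_span_def mult_ac)
qed

lemma herm_symbol_eq_bessel: "herm_symbol e m t = bessel_symbol 0 e m t"
proof
  fix \<xi> :: 'a
  have "(1 + (norm \<xi>)\<^sup>2) powr 0 = 1" using one_plus_norm_sq_pos[of \<xi>] by simp
  then show "herm_symbol e m t \<xi> = bessel_symbol 0 e m t \<xi>" by (simp add: bessel_symbol_def)
qed

lemma herm_symbol_gauss_span: "0 < t \<Longrightarrow> e \<in> Basis \<Longrightarrow> herm_symbol e m t \<in> gauss_span"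
  unfolding herm_symbol_eq_bessel by (rule bessel_symbol_gauss_span)

lemma herm_symbol_measurable [measurable]: "herm_symbol (e::'a::euclidean_space) m t \<in>
    borel_measurable borel"
  unfolding herm_symbol_def[abs_def] by measurable

lemma herm_symbol_add:
  "herm_symbol e m (t + r) \<xi> = herm_symbol e m t \<xi> * complex_of_real (exp (- r * (norm \<xi>)\<^sup>2))"
proof -
  have "exp (- (t + r) * (norm \<xi>)\<^sup>2) = exp (- t * (norm \<xi>)\<^sup>2) * exp (- r * (norm \<xi>)\<^sup>2)"
    by (simp add: exp_add[symmetric] algebra_simps)
  then show ?thesis by (simp only: herm_symbol_def of_real_mult mult.assoc)
qed

lemma herm_measurable: "0 < t \<Longrightarrow> e \<in> Basis \<Longrightarrow> herm e m t \<in> borel_measurable borel"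
  unfolding herm_def by (intro fourier_measurable herm_symbol_gauss_span)

lemma herm_rapid: "0 < t \<Longrightarrow> e \<in> Basis \<Longrightarrow> rapid (herm e m t)"
  unfolding herm_def by (intro fourier_rapid herm_symbol_gauss_span)

lemma herm_integrable: "0 < t \<Longrightarrow> e \<in> Basis \<Longrightarrow> integrable lborel (herm e m t)"
  by (intro rapid_integrable herm_rapid herm_measurable)

text \<open>Substitution of y / sqrt t for y in the Fourier integral: the Jacobian yields
  \<open>DIM('a)\<close> powers of 1 / sqrt t and the monomial yields m.\<close>

lemma herm_scale:
  fixes e :: "'a::euclidean_space"
  assumes t: "0 < t"
  shows "herm e m t x = herm e m 1 (x /\<^sub>R sqrt t) /\<^sub>R sqrt t ^ (DIM('a) + m)"
proof -
  define c where "c = inverse (sqrt t)"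
  have c: "0 < c" "c\<^sup>2 * t = 1" using t by (auto simp: c_def power_inverse)
  let ?f = "\<lambda>y. fexp y x * herm_symbol e m t y"
  have "(LINT y|lborel. ?f y) = c ^ DIM('a) *\<^sub>R (LINT y|lborel. ?f (c *\<^sub>R y))"
    using c integral_lborel_affine[of c ?f 0] by simp
  also have "(LINT y|lborel. ?f (c *\<^sub>R y)) = (LINT y|lborel. c ^ m
      *\<^sub>R (fexp y (c *\<^sub>R x) * herm_symbol e m 1 y))"
  proof (intro Bochner_Integration.integral_cong refl)
    fix y :: 'a
    have "t * (norm (c *\<^sub>R y))\<^sup>2 = (c\<^sup>2 * t) * (norm y)\<^sup>2" by (simp add: power_mult_distrib)
    then have "t * (norm (c *\<^sub>R y))\<^sup>2 = (norm y)\<^sup>2" using c by simp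
    then show "?f (c *\<^sub>R y) = c ^ m *\<^sub>R (fexp y (c *\<^sub>R x) * herm_symbol e m 1 y)"
      by (simp add: herm_symbol_def power_mult_distrib scaleR_conv_of_real del: norm_scaleR)
  qed
  also have "\<dots> = c ^ m *\<^sub>R herm e m 1 (c *\<^sub>R x)"
    unfolding herm_def fourier_def by (rule integral_scaleR_right)
  finally show ?thesis
    by (simp add: herm_def fourier_def c_def power_add power_inverse)
qed

text \<open>A non-integrable f has the default integral 0, so an integrable majorant suffices; this
  spares measurability proofs for the integrands estimated below.\<close>

lemma norm_integral_le:
  fixes f :: "'a \<Rightarrow> 'b::{banach, second_countable_topology}"
  assumes g: "integrable M g" and le: "\<And>x. norm (f x) \<le> g x"
  shows "norm (LINT x|M. f x) \<le> (LINT x|M. g x)"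
proof (cases "integrable M f")
  case True
  have "norm (LINT x|M. f x) \<le> (LINT x|M. norm (f x))" by (rule integral_norm_bound)
  also have "\<dots> \<le> (LINT x|M. g x)"
    using True g le by (intro Bochner_Integration.integral_mono) auto
  finally show ?thesis .
next
  case False
  have "0 \<le> (LINT x|M. g x)"
    by (intro integral_nonneg_AE AE_I2) (meson le norm_ge_zero order_trans)
  then show ?thesis using False by (simp add: not_integrable_integral_eq)
qed

text \<open>Averaging over z + c y with the heat kernel multiplies the symbol by exp(-c^2
  |\<xi>|^2), and this merely shifts the time parameter of the Gaussian.\<close>

lemma herm_heat:
  fixes e :: "'a::euclidean_space"
  assumes t: "0 < t" and e: "e \<in> Basis"
  shows "(LINT y|lborel. heat_kernel 1 y *\<^sub>R herm e m t (z + c *\<^sub>R y)) = herm e m (t + c\<^sup>2) z"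
proof -
  note [measurable] = gauss_span_measurable[OF herm_symbol_gauss_span[OF t e]]
  let ?E = "\<lambda>y \<xi>. fexp \<xi> (z + c *\<^sub>R y)"
  have "(LINT y|lborel. heat_kernel 1 y *\<^sub>R herm e m t (z + c *\<^sub>R y))
      = (LINT y|lborel. (LINT \<xi>|lborel. heat_kernel 1 y *\<^sub>R (?E y \<xi> * herm_symbol e m t \<xi>)))"
    by (simp add: herm_def fourier_def)
  also have "\<dots> = (LINT \<xi>|lborel. (LINT y|lborel. heat_kernel 1 y
      *\<^sub>R (?E y \<xi> * herm_symbol e m t \<xi>)))"
  proof (rule lborel_fubini)
    show "integrable lborel (heat_kernel 1 :: 'a \<Rightarrow> real)" by (rule integrable_heat_kernel) simp
    show "integrable lborel (\<lambda>\<xi>. norm (herm_symbol e m t \<xi>))"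
      by (intro integrable_norm gauss_span_integrable herm_symbol_gauss_span t e)
  qed (auto simp: norm_mult heat_kernel_nonneg)
  also have "\<dots> = (LINT \<xi>|lborel. fexp \<xi> z * herm_symbol e m (t + c\<^sup>2) \<xi>)"
  proof (intro Bochner_Integration.integral_cong refl)
    fix \<xi> :: 'a
    have "(LINT y|lborel. heat_kernel 1 y *\<^sub>R (?E y \<xi> * herm_symbol e m t \<xi>))
      = (LINT y|lborel. (heat_kernel 1 y *\<^sub>R iexp (y \<bullet> ((- c) *\<^sub>R \<xi>))) *
          (fexp \<xi> z * herm_symbol e m t \<xi>))"
      by (intro Bochner_Integration.integral_cong refl)
        (simp add: inner_add_right distrib_left exp_diff exp_minus inner_commute field_simps)
    also have "\<dots> = complex_of_real (exp (- 1 * (norm ((- c) *\<^sub>R \<xi>))\<^sup>2))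
        * (fexp \<xi> z * herm_symbol e m t \<xi>)"
      by (subst integral_mult_left_zero, subst heat_kernel_fourier) auto
    also have "\<dots> = fexp \<xi> z * herm_symbol e m (t + c\<^sup>2) \<xi>"
      by (simp add: herm_symbol_add power_mult_distrib)
    finally show "(LINT y|lborel. heat_kernel 1 y *\<^sub>R (?E y \<xi> * herm_symbol e m t \<xi>))
        = fexp \<xi> z * herm_symbol e m (t + c\<^sup>2) \<xi>" .
  qed
  finally show ?thesis by (simp add: herm_def fourier_def)
qed

text \<open>The semigroup is moved from f, which is merely bounded, to the Hermite function by two
  applications of Fubini and a translation in between.\<close>

lemma herm_heat_pairing:
  fixes e :: "'a::euclidean_space" and f :: "'a \<Rightarrow>\<^sub>C complex"
  assumes t: "0 < t" and s: "0 \<le> s" and e: "e \<in> Basis"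
  shows "(pairing e m t (heat_semigroup s f)) = (pairing e m (t + s) f)"
proof -
  define c where "c = sqrt s"
  have c: "0 \<le> c" "c\<^sup>2 = s" using s by (auto simp: c_def)
  note [measurable] = herm_measurable[OF t e]
  have "(pairing e m t (heat_semigroup s f)) = (LINT x|lborel. (LINT y|lborel. heat_kernel 1 y
      *\<^sub>R (f (x - c *\<^sub>R y) * herm e m t x)))"
    using s by (simp add: heat_semigroup_eq c_def max_def flip: integral_mult_left_zero)
  also have "\<dots> = (LINT y|lborel. (LINT x|lborel. heat_kernel 1 y
      *\<^sub>R (f (x - c *\<^sub>R y) * herm e m t x)))"
  proof (rule lborel_fubini)
    show "integrable lborel (\<lambda>x. norm f * norm (herm e m t x))"
      by (intro integrable_mult_right integrable_norm herm_integrable t e)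
    show "integrable lborel (heat_kernel 1 :: 'a \<Rightarrow> real)" by (rule integrable_heat_kernel) simp
    show "norm (heat_kernel 1 y *\<^sub>R (f (x - c *\<^sub>R y) * herm e m t x))
        \<le> norm f * norm (herm e m t x) * heat_kernel 1 y" for x y
      using mult_right_mono[OF norm_bounded[of f "x - c *\<^sub>R y"], of
          "heat_kernel 1 y * norm (herm e m t x)"]
      by (simp add: norm_mult heat_kernel_nonneg mult_ac)
  qed measurable
  also have "\<dots> = (LINT y|lborel. (LINT z|lborel. heat_kernel 1 y
      *\<^sub>R (f z * herm e m t (z + c *\<^sub>R y))))"
  proof (rule Bochner_Integration.integral_cong[OF refl])
    fix y :: 'a
    show "(LINT x|lborel. heat_kernel 1 y *\<^sub>R (f (x - c *\<^sub>R y) * herm e m t x))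
        = (LINT z|lborel. heat_kernel 1 y *\<^sub>R (f z * herm e m t (z + c *\<^sub>R y)))"
      by (subst integral_lborel_shift[symmetric, of _ "c *\<^sub>R y"]) (simp add: add.commute)
  qed
  also have "\<dots> = (LINT z|lborel. (LINT y|lborel. heat_kernel 1 y
      *\<^sub>R (f z * herm e m t (z + c *\<^sub>R y))))"
  proof -
    let ?k = "2 * DIM('a)"
    obtain C where C: "\<And>x. (1 + norm x) ^ ?k * norm (herm e m t x) \<le> C"
      using herm_rapid[OF t e, of m] unfolding rapid_def by metis
    have C0: "0 \<le> C" using C[of 0] by (meson norm_ge_zero order_trans zero_le_mult_iff zero_le_power
        add_nonneg_nonneg zero_le_one)
    obtain C' where C': "\<And>y::'a. (1 + norm y) ^ (?k + ?k) * heat_kernel 1 y \<le> C'"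
      using heat_kernel_decay by metis
    show ?thesis
    proof (rule lborel_fubini)
      show "integrable lborel (\<lambda>y::'a. (1 + c * norm y) ^ ?k * heat_kernel 1 y)"
      proof (rule integrable_of_decay[OF _ order_refl])
        fix y :: 'a
        have "(1 + c * norm y) ^ ?k \<le> ((1 + c) * (1 + norm y)) ^ ?k"
          using c by (intro power_mono) (auto simp: algebra_simps)
        then have "(1 + norm y) ^ ?k * ((1 + c * norm y) ^ ?k * heat_kernel 1 y)
            \<le> (1 + norm y) ^ ?k * (((1 + c) * (1 + norm y)) ^ ?k * heat_kernel 1 y)"
          by (intro mult_left_mono mult_right_mono heat_kernel_nonneg) auto
        also have "\<dots> = (1 + c) ^ ?k * ((1 + norm y) ^ (?k + ?k) * heat_kernel 1 y)"
          by (simp only: power_mult_distrib power_add mult_ac)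
        also have "\<dots> \<le> (1 + c) ^ ?k * C'"
          using c by (intro mult_left_mono C') auto
        finally show "(1 + norm y) ^ ?k * norm ((1 + c * norm y) ^ ?k * heat_kernel 1 y)
            \<le> (1 + c) ^ ?k * C'"
          using c by (simp add: heat_kernel_nonneg abs_mult)
      qed measurable
      show "integrable lborel (\<lambda>z::'a. (norm f * C) * inverse ((1 + norm z) ^ ?k))"
        by (intro integrable_mult_right integrable_decay) simp
      fix y z :: 'a
      have *: "norm z \<le> norm (z + c *\<^sub>R y) + norm (c *\<^sub>R y)"
        using norm_triangle_ineq4[of "z + c *\<^sub>R y" "c *\<^sub>R y"] by simp
      \<comment> \<open>This inequality separates the variables: decay in z + c y becomes decay in z
        times polynomial growth in y, and the latter is absorbed by the heat kernel. It gives the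
        product majorant for the second exchange.\<close>
      then have "1 + norm z \<le> (1 + norm (z + c *\<^sub>R y)) * (1 + c * norm y)"
      proof -
        have "0 \<le> c * (norm y * norm (z + c *\<^sub>R y))" using c by simp
        moreover have "(1 + norm (z + c *\<^sub>R y)) * (1 + c * norm y)
            = 1 + norm (z + c *\<^sub>R y) + c * norm y + c * (norm y * norm (z + c *\<^sub>R y))"
          by (simp add: algebra_simps)
        moreover have "norm (c *\<^sub>R y) = c * norm y" using c by simp
        ultimately show ?thesis using *(1) by argo
      qed
      then have "(1 + norm z) ^ ?k \<le> ((1 + norm (z + c *\<^sub>R y)) * (1 + c * norm y)) ^ ?k"
        by (intro power_mono) auto
      then have "(1 + norm z) ^ ?k * norm (herm e m t (z + c *\<^sub>R y))
          \<le> ((1 + norm (z + c *\<^sub>R y)) * (1 + c * norm y)) ^ ?k * norm (herm e m t (z + c *\<^sub>R y))"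
        by (intro mult_right_mono) auto
      also have "\<dots> = (1 + c * norm y) ^ ?k * ((1 + norm (z + c *\<^sub>R y)) ^ ?k
          * norm (herm e m t (z + c *\<^sub>R y)))"
        by (simp only: power_mult_distrib mult_ac)
      also have "\<dots> \<le> (1 + c * norm y) ^ ?k * C"
        using c by (intro mult_left_mono C) auto
      finally have "norm (herm e m t (z + c *\<^sub>R y))
          \<le> (1 + c * norm y) ^ ?k * C * inverse ((1 + norm z) ^ ?k)"
        by (simp add: field_simps add_pos_nonneg)
      then have "heat_kernel 1 y * (norm (f z) * norm (herm e m t (z + c *\<^sub>R y)))
          \<le> heat_kernel 1 y * (norm f * ((1 + c * norm y) ^ ?k * C * inverse ((1 + norm z) ^ ?k)))"
        by (intro mult_left_mono mult_mono norm_bounded heat_kernel_nonneg) auto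
      then show "norm (heat_kernel 1 y *\<^sub>R (f z * herm e m t (z + c *\<^sub>R y)))
          \<le> (1 + c * norm y) ^ ?k * heat_kernel 1 y * (norm f * C * inverse ((1 + norm z) ^ ?k))"
        by (simp add: norm_mult heat_kernel_nonneg mult_ac)
    qed measurable
  qed
  also have "\<dots> = (LINT z|lborel. f z * herm e m (t + s) z)"
  proof (intro Bochner_Integration.integral_cong refl)
    fix z
    have "(LINT y|lborel. heat_kernel 1 y *\<^sub>R (f z * herm e m t (z + c *\<^sub>R y)))
        = (LINT y|lborel. f z * (heat_kernel 1 y *\<^sub>R herm e m t (z + c *\<^sub>R y)))"
      by simp
    also have "\<dots> = f z * herm e m (t + s) z"
      by (subst integral_mult_right_zero) (simp add: herm_heat[OF t e] c)
    finally show "(LINT y|lborel. heat_kernel 1 y *\<^sub>R (f z * herm e m t (z + c *\<^sub>R y)))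
        = f z * herm e m (t + s) z" .
  qed
  finally show ?thesis .
qed

section \<open>Decay of Bessel potentials of Hermite functions\<close>

definition gamma_weight :: "real \<Rightarrow> real \<Rightarrow> real" where
  "gamma_weight a r = (if 0 < r then r powr (a - 1) * exp (- r) else 0)"

lemma gamma_weight_nonneg: "0 \<le> gamma_weight a r"
  by (simp add: gamma_weight_def)

lemma gamma_weight_measurable [measurable]: "gamma_weight a \<in> borel_measurable borel"
  unfolding gamma_weight_def[abs_def] by measurable

lemma gamma_weight_integral:
  assumes a: "0 < a"
  shows "integrable lborel (gamma_weight a)" and "(LINT r|lborel. gamma_weight a r) = Gamma a"
proof -
  have "((\<lambda>t. if t \<in> {0..} then t powr (a - 1) / exp t else 0) has_integral Gamma a) UNIV"
    using Gamma_integral_real[OF a] by (simp only: has_integral_restrict_UNIV)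
  then have "(gamma_weight a has_integral Gamma a) UNIV"
    by (rule has_integral_spike[OF negligible_sing[of 0], rotated])
       (auto simp: gamma_weight_def exp_minus field_simps)
  then have nn: "(\<integral>\<^sup>+ r. gamma_weight a r \<partial>lborel) = Gamma a"
    by (intro nn_integral_has_integral_lborel) (auto simp: gamma_weight_nonneg)
  show int: "integrable lborel (gamma_weight a)"
    by (rule integrableI_nonneg) (auto simp: nn gamma_weight_nonneg)
  have "ennreal (LINT r|lborel. gamma_weight a r) = Gamma a"
    using nn_integral_eq_integral[OF int] nn by (simp add: gamma_weight_nonneg)
  then show "(LINT r|lborel. gamma_weight a r) = Gamma a"
    using Gamma_real_pos[OF a] by (subst (asm) ennreal_inj)
        (auto intro!: integral_nonneg_AE simp: gamma_weight_nonneg)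
qed

text \<open>Substitution of (1 + q) r for r in the Gamma integral. It is applied with a = s/2 and q
  = |\<xi>|^2.\<close>

lemma gamma_weight_laplace:
  assumes a: "0 < a" and q: "0 \<le> q"
  shows "(LINT r|lborel. gamma_weight a r * exp (- r * q)) = Gamma a * (1 + q) powr (- a)"
proof -
  have "Gamma a = (1 + q) * (LINT r|lborel. gamma_weight a ((1 + q) * r))"
    using q gamma_weight_integral(2)[OF a] lborel_integral_real_affine[of "1 + q" "gamma_weight a"
        0] by simp
  also have "(LINT r|lborel. gamma_weight a ((1 + q) * r))
      = (LINT r|lborel. (1 + q) powr (a - 1) * (gamma_weight a r * exp (- r * q)))"
  proof (intro Bochner_Integration.integral_cong refl)
    fix r :: real
    have "0 < (1 + q) * r \<longleftrightarrow> 0 < r" using q by (simp add: zero_less_mult_iff)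
    moreover have "exp (- ((1 + q) * r)) = exp (- r) * exp (- r * q)"
      by (simp add: exp_add[symmetric] algebra_simps)
    ultimately show "gamma_weight a ((1 + q) * r)
        = (1 + q) powr (a - 1) * (gamma_weight a r * exp (- r * q))"
      by (simp add: gamma_weight_def powr_mult mult_ac)
  qed
  also have "\<dots> = (1 + q) powr (a - 1) * (LINT r|lborel. gamma_weight a r * exp (- r * q))"
    by (rule integral_mult_right_zero)
  also have "(1 + q) * ((1 + q) powr (a - 1) * (LINT r|lborel. gamma_weight a r * exp (- r * q)))
      = (1 + q) powr a * (LINT r|lborel. gamma_weight a r * exp (- r * q))"
    using q by (simp add: powr_diff)
  finally show ?thesis
    using q by (simp add: powr_minus field_simps)
qed

text \<open>\<open>(1 + |\<xi>|^2)^(- s/2)\<close> is written as a Gamma integral of the Gaussians \<open>exp(- r (1 +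
  |\<xi>|^2))\<close>, so the Bessel potential of a Hermite function is a mixture of Hermite functions.\<close>

lemma fourier_bessel_symbol:
  fixes e :: "'a::euclidean_space"
  assumes s: "0 < s" and t: "0 < t" and e: "e \<in> Basis"
  shows "fourier (bessel_symbol s e m t) x = (LINT r|lborel. complex_of_real
      (gamma_weight (s / 2) r) * herm e m (t + r) x) / Gamma (s / 2)"
proof -
  let ?E = "\<lambda>\<xi>. fexp \<xi> x"
  let ?g = "\<lambda>\<xi> r. complex_of_real (gamma_weight (s / 2) r) * (?E \<xi> * herm_symbol e m (t + r) \<xi>)"
  have G: "0 < Gamma (s / 2)" using s by (intro Gamma_real_pos) simp
  note sym = herm_symbol_add[of e m t]
  have "Gamma (s / 2) * fourier (bessel_symbol s e m t) x
      = (LINT \<xi>|lborel. (LINT r|lborel. ?g \<xi> r))"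
  proof -
    have "Gamma (s / 2) * (?E \<xi> * bessel_symbol s e m t \<xi>) = (LINT r|lborel. ?g \<xi> r)" for \<xi>
    proof -
      have "(LINT r|lborel. ?g \<xi> r) = (LINT r|lborel. complex_of_real (gamma_weight (s / 2) r
          * exp (- r * (norm \<xi>)\<^sup>2)) * (?E \<xi> * herm_symbol e m t \<xi>))"
        by (intro Bochner_Integration.integral_cong refl) (simp add: sym)
      also have "\<dots> = complex_of_real (LINT r|lborel. gamma_weight (s / 2) r
          * exp (- r * (norm \<xi>)\<^sup>2)) * (?E \<xi> * herm_symbol e m t \<xi>)"
        by (simp only: integral_mult_left_zero integral_complex_of_real)
      also have "\<dots> = Gamma (s / 2) * (?E \<xi> * bessel_symbol s e m t \<xi>)"
        using s by (subst gamma_weight_laplace) (auto simp: bessel_symbol_def)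
      finally show ?thesis by simp
    qed
    then show ?thesis
      unfolding fourier_def integral_mult_right_zero[symmetric] by simp
  qed
  also have "\<dots> = (LINT r|lborel. (LINT \<xi>|lborel. ?g \<xi> r))"
  proof (rule lborel_fubini)
    show "integrable lborel (\<lambda>\<xi>. norm (herm_symbol e m t \<xi>))"
      by (intro integrable_norm gauss_span_integrable herm_symbol_gauss_span t e)
    show "integrable lborel (gamma_weight (s / 2))"
      using s by (intro gamma_weight_integral) simp
    show "norm (?g \<xi> r) \<le> norm (herm_symbol e m t \<xi>) * gamma_weight (s / 2) r" for \<xi> r
    proof (cases "0 < r")
      case True
      then have "norm (herm_symbol e m (t + r) \<xi>) \<le> norm (herm_symbol e m t \<xi>)"
        by (simp add: sym norm_mult mult_left_le)
      from mult_left_mono[OF this gamma_weight_nonneg[of "s / 2" r]] show ?thesis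
        by (simp add: norm_mult gamma_weight_nonneg mult.commute)
    qed (simp add: gamma_weight_def)
    show "(\<lambda>(\<xi>, r). ?g \<xi> r) \<in> borel_measurable (borel \<Otimes>\<^sub>M borel)"
      unfolding herm_symbol_def by measurable
  qed
  also have "\<dots> = (LINT r|lborel. complex_of_real (gamma_weight (s / 2) r) * herm e m (t + r) x)"
    by (simp add: herm_def fourier_def)
  finally show ?thesis using G by (simp add: field_simps)
qed

text \<open>The Hermite function at time h^2 + r has length scale k = sqrt(h^2 + r) \<ge> h. Scaling
  gives k^(-N-m) (1 + |x|/k)^(-2N), and passing to the profile of width h costs (k/h)^(2N). The
  remaining k^(N-m) is split into a power of h and r^(-s'/2); the latter is integrable against
  r^(s/2 - 1) exp(-r) because s' < s.\<close>

lemma fourier_bessel_bound: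
  fixes e :: "'a::euclidean_space"
  assumes s': "0 < s'" "s' < s" and e: "e \<in> Basis" and m: "real DIM('a) + s' \<le> real m"
  shows "\<exists>C. \<forall>h>0. \<forall>x. norm (fourier (bessel_symbol s e m (h\<^sup>2)) x)
    \<le> C * h powr (s' - DIM('a) - m) * inverse ((1 + norm x / h) ^ (2 * DIM('a)))"
proof -
  let ?N = "DIM('a)"
  obtain C where C: "\<And>x. (1 + norm x) ^ (2 * ?N) * norm (herm e m 1 x) \<le> C"
    using herm_rapid[OF zero_less_one e, of m] unfolding rapid_def by metis
  have C0: "0 \<le> C" using C[of 0] by (meson norm_ge_zero order_trans zero_le_mult_iff zero_le_power
      add_nonneg_nonneg zero_le_one)
  let ?D = "C * Gamma ((s - s') / 2) / Gamma (s / 2)"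
  have G: "0 < Gamma (s / 2)" using s' by (intro Gamma_real_pos) simp
  show ?thesis
  proof (intro exI[of _ ?D] allI impI)
    fix h :: real and x :: 'a assume h: "0 < h"
    define W where "W = inverse ((1 + norm x / h) ^ (2 * ?N))"
    have hx: "0 < 1 + norm x / h" using h by (intro add_pos_nonneg) auto
    have W: "0 \<le> W" using hx by (simp add: W_def)
    have key: "norm (herm e m (h\<^sup>2 + r) x) \<le> C * W * h powr (s' - ?N - m) * r powr (- s' / 2)"
        if r: "0 < r" for r
    proof -
      define t where "t = h\<^sup>2 + r"
      have t: "0 < t" "r \<le> t" "h\<^sup>2 \<le> t" using r h by (auto simp: t_def add_pos_pos)
      define k where "k = sqrt t"
      have k: "0 < k" "h \<le> k" "k\<^sup>2 = t" using t h by (auto simp: k_def real_le_rsqrt)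
      have "norm (herm e m t x) = norm (herm e m 1 (x /\<^sub>R k)) / k ^ (?N + m)"
        using k(1) by (simp add: herm_scale[OF t(1)] k_def divide_inverse mult.commute)
      also have "\<dots> \<le> C / (1 + norm x / k) ^ (2 * ?N) / k ^ (?N + m)"
        using C[of "x /\<^sub>R k"] k(1) by (intro divide_right_mono)
            (auto simp: field_simps add_pos_nonneg)
      also have "C / (1 + norm x / k) ^ (2 * ?N) / k ^ (?N + m)
          \<le> C * ((k / h) ^ (2 * ?N) * W) / k ^ (?N + m)"
      proof -
        have *: "1 / b \<le> p * inverse a" if "a \<le> p * b" "0 < a" "0 < b" for a b p :: real
          using that by (simp add: field_simps)
        have "(1 + norm x / h) \<le> (k / h) * (1 + norm x / k)"
          using k h by (simp add: field_simps)
        then have "(1 + norm x / h) ^ (2 * ?N) \<le> (k / h) ^ (2 * ?N) * (1 + norm x / k) ^ (2 * ?N)"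
          unfolding power_mult_distrib[symmetric] using hx by (intro power_mono) auto
        then have "1 / (1 + norm x / k) ^ (2 * ?N) \<le> (k / h) ^ (2 * ?N) * W"
          unfolding W_def using hx k(1) by (intro *) (auto simp: add_pos_nonneg)
        from mult_left_mono[OF this C0] k(1) show ?thesis
          by (intro divide_right_mono) auto
      qed
      also have "\<dots> = C * W * (h powr (- 2 * ?N) * k powr (?N - real m))"
      proof -
        have "(k / h) ^ (2 * ?N) / k ^ (?N + m) = h powr (- 2 * ?N) * k powr (?N - real m)"
        proof -
          have "k powr (?N - real m) = k powr real (2 * ?N) / k powr real (?N + m)"
            by (simp add: powr_diff[symmetric])
          moreover have "h powr (- 2 * ?N) = 1 / h powr real (2 * ?N)"
            by (simp add: powr_minus_divide[symmetric])
          ultimately show ?thesis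
            using k(1) h by (simp only: powr_realpow) (simp add: power_divide)
        qed
        moreover have "C * ((k / h) ^ (2 * ?N) * W) / k ^ (?N + m)
            = C * W * ((k / h) ^ (2 * ?N) / k ^ (?N + m))"
          by simp
        ultimately show ?thesis by (simp only:)
      qed
      also have "\<dots> \<le> C * W * (h powr (- 2 * ?N) * (h powr (s' + ?N - m) * r powr (- s' / 2)))"
      proof -
        \<comment> \<open>Both exponents are nonpositive, the first one by N + s' \<le> m, so k may
          be replaced by the smaller h in the first factor and by the smaller sqrt r in the
          second.\<close>
        have "k powr (?N - real m) = k powr (s' + ?N - m) * k powr (- s')"
          by (simp add: powr_add[symmetric])
        also have "\<dots> \<le> h powr (s' + ?N - m) * r powr (- s' / 2)"
        proof (rule mult_mono)
          show "k powr (s' + ?N - m) \<le> h powr (s' + ?N - m)"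
            using k h m by (intro powr_mono2') auto
          have "k powr (- s') = t powr (- s' / 2)"
            using t(1) by (simp add: k_def powr_half_sqrt[symmetric] powr_powr)
          also have "\<dots> \<le> r powr (- s' / 2)"
            using t r s' by (intro powr_mono2') auto
          finally show "k powr (- s') \<le> r powr (- s' / 2)" .
        qed auto
        finally show ?thesis using C0 W by (intro mult_left_mono) auto
      qed
      also have "\<dots> = C * W * h powr (s' - ?N - m) * r powr (- s' / 2)"
      proof -
        have "h powr (- 2 * ?N) * h powr (s' + ?N - m) = h powr (s' - ?N - m)"
          by (simp add: powr_add[symmetric] algebra_simps)
        then show ?thesis by (simp only: mult.assoc flip: mult.assoc[of "h powr (- 2 * ?N)"])
      qed
      finally show ?thesis by (simp add: t_def)
    qed
    define A where "A = C * W * h powr (s' - ?N - m)"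
    have "norm (LINT r|lborel. complex_of_real (gamma_weight (s / 2) r) * herm e m (h\<^sup>2 + r) x)
       \<le> (LINT r|lborel. A * gamma_weight ((s - s') / 2) r)"
    proof (rule norm_integral_le)
      show "integrable lborel (\<lambda>r. A * gamma_weight ((s - s') / 2) r)"
        using s' by (intro integrable_mult_right gamma_weight_integral) simp
      show "norm (complex_of_real (gamma_weight (s / 2) r) * herm e m (h\<^sup>2 + r) x)
          \<le> A * gamma_weight ((s - s') / 2) r" for r
      proof (cases "0 < r")
        case True
        have "norm (complex_of_real (gamma_weight (s / 2) r) * herm e m (h\<^sup>2 + r) x)
            \<le> gamma_weight (s / 2) r * (A * r powr (- s' / 2))"
          using key[OF True] by (simp add: norm_mult gamma_weight_nonneg mult_left_mono A_def)
        also have "\<dots> = A * ((r powr (s / 2 - 1) * r powr (- s' / 2)) * exp (- r))"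
          using True by (simp add: gamma_weight_def)
        also have "r powr (s / 2 - 1) * r powr (- s' / 2) = r powr ((s - s') / 2 - 1)"
          by (simp add: powr_add[symmetric] diff_divide_distrib algebra_simps)
        also have "A * (r powr ((s - s') / 2 - 1) * exp (- r)) = A * gamma_weight ((s - s') / 2) r"
          using True by (simp add: gamma_weight_def)
        finally show ?thesis .
      qed (simp add: gamma_weight_def)
    qed
    also have "\<dots> = A * Gamma ((s - s') / 2)"
      using s' by (simp add: gamma_weight_integral)
    finally have "norm (fourier (bessel_symbol s e m (h\<^sup>2)) x)
        \<le> A * Gamma ((s - s') / 2) / Gamma (s / 2)"
      using s' h e G by (simp add: fourier_bessel_symbol norm_divide divide_right_mono)
    then show "norm (fourier (bessel_symbol s e m (h\<^sup>2)) x)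
        \<le> ?D * h powr (s' - ?N - m) * inverse ((1 + norm x / h) ^ (2 * ?N))"
      by (simp add: A_def W_def mult_ac)
  qed
qed

text \<open>The exponent of Hoelder's inequality, obtained by splitting \<open>|g|\<close> at the level \<open>h^(-
  N/p)\<close>.\<close>

lemma Lp_decay_integral:
  fixes g :: "'a::euclidean_space \<Rightarrow> complex"
  assumes p: "1 < p" and g: "g \<in> Lp_space p"
  shows "\<exists>C. \<forall>h>0. integrable lborel (\<lambda>x. norm (g x) * inverse ((1 + norm x / h) ^ (2 * DIM('a)))) \<and>
    (LINT x|lborel. norm (g x) * inverse ((1 + norm x / h) ^ (2 * DIM('a))))
        \<le> C * h powr (DIM('a) - DIM('a) / p)"
proof -
  let ?N = "DIM('a)"
  have [measurable]: "g \<in> borel_measurable borel"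
      and int: "integrable lborel (\<lambda>x. norm (g x) powr p)"
    using g by (auto simp: Lp_space_def)
  define A where "A = (LINT x|lborel. norm (g x) powr p)"
  define B where "B = (LINT x|lborel. inverse ((1 + norm (x::'a)) ^ (2 * ?N)))"
  show ?thesis
  proof (intro exI[of _ "A + B"] allI impI)
    fix h :: real assume h: "0 < h"
    define w where "w x = inverse ((1 + norm (x::'a) / h) ^ (2 * ?N))" for x
    have w: "0 \<le> w x" "w x \<le> 1" for x
    proof -
      have "1 \<le> (1 + norm x / h) ^ (2 * ?N)" using h by (intro one_le_power) auto
      then show "0 \<le> w x" "w x \<le> 1" by (auto simp: w_def field_simps)
    qed
    have [measurable]: "w \<in> borel_measurable borel" unfolding w_def[abs_def] by measurable
    define l where "l = h powr (- (?N / p))"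
    have l: "0 < l" using h by (simp add: l_def)
    have wi: "integrable lborel w" "(LINT x|lborel. w x) = h powr ?N * B"
    proof -
      let ?v = "\<lambda>x::'a. inverse ((1 + norm x) ^ (2 * ?N))"
      have v: "integrable lborel ?v" by (rule integrable_decay) simp
      have wv: "w = (\<lambda>x. ?v (0 + (1 / h) *\<^sub>R x))" using h by (simp add: w_def fun_eq_iff)
      show "integrable lborel w" unfolding wv using h by (intro integrable_lborel_affine v) simp
      show "(LINT x|lborel. w x) = h powr ?N * B"
        unfolding wv B_def using h
        by (subst integral_lborel_affine) (auto simp: powr_realpow power_one_over field_simps)
    qed
    have le: "norm (g x) * w x \<le> l * w x + l powr (1 - p) * norm (g x) powr p" for x
    proof (cases "norm (g x) \<le> l")
      case True
      then have "norm (g x) * w x \<le> l * w x" using w by (intro mult_right_mono) auto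
      moreover have "0 \<le> l powr (1 - p) * norm (g x) powr p" by simp
      ultimately show ?thesis by linarith
    next
      case False
      then have gx: "l < norm (g x)" by simp
      have "norm (g x) * w x \<le> norm (g x)" using w by (simp add: mult_left_le)
      also have "\<dots> = norm (g x) powr (1 - p) * norm (g x) powr p"
        using gx l by (simp add: powr_add[symmetric])
      also have "\<dots> \<le> l powr (1 - p) * norm (g x) powr p"
        using gx l p by (intro mult_right_mono powr_mono2') auto
      also have "\<dots> \<le> l * w x + l powr (1 - p) * norm (g x) powr p"
        using l w by simp
      finally show ?thesis .
    qed
    have ri: "integrable lborel (\<lambda>x. l * w x + l powr (1 - p) * norm (g x) powr p)"
      by (intro Bochner_Integration.integrable_add integrable_mult_right wi int)
    have gi: "integrable lborel (\<lambda>x. norm (g x) * w x)"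
    proof (rule Bochner_Integration.integrable_bound[OF ri])
      show "AE x in lborel. norm (norm (g x) * w x)
          \<le> norm (l * w x + l powr (1 - p) * norm (g x) powr p)"
        using le w by (intro AE_I2) (simp add: abs_mult, meson abs_ge_self order_trans)
    qed measurable
    have "(LINT x|lborel. norm (g x) * w x) \<le> (LINT x|lborel. l * w x + l powr (1 - p)
        * norm (g x) powr p)"
      by (intro Bochner_Integration.integral_mono gi ri le)
    also have "\<dots> = l * (h powr ?N * B) + l powr (1 - p) * A"
      unfolding A_def wi(2)[symmetric] by (subst Bochner_Integration.integral_add)
          (auto intro!: integrable_mult_right wi int)
    also have "l powr (1 - p) = h powr (?N - ?N / p)"
    proof -
      have "- (?N / p) * (1 - p) = ?N - ?N / p" using p by (simp add: field_simps)
      then show ?thesis by (simp only: l_def powr_powr)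
    qed
    also have "l * (h powr ?N * B) = h powr (?N - ?N / p) * B"
      by (simp add: l_def powr_add[symmetric] mult.assoc[symmetric])
    also have "h powr (?N - ?N / p) * B + h powr (?N - ?N / p) * A = (A + B) * h powr (?N - ?N / p)"
      by (simp add: algebra_simps)
    finally show "integrable lborel (\<lambda>x. norm (g x) * inverse ((1 + norm x / h) ^ (2 * ?N))) \<and>
      (LINT x|lborel. norm (g x) * inverse ((1 + norm x / h) ^ (2 * ?N)))
          \<le> (A + B) * h powr (?N - ?N / p)"
      using gi by (simp add: w_def)
  qed
qed

text \<open>The exponent is the sum of s' - N - m, from the Bessel potential of the Hermite
  function, and N - N/p, from integrating an L^p function against a profile of width h. The constant
  may depend on f, which stays fixed while h tends to 0.\<close>

lemma Hsp_herm_bound: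
  fixes e :: "'a::euclidean_space" and f :: "'a \<Rightarrow> complex"
  assumes f: "regular_distribution f \<in> Hsp s p" and p: "1 < p"
    and s': "0 < s'" "s' < s" and e: "e \<in> Basis" and m: "real DIM('a) + s' \<le> real m"
  shows "\<exists>C. \<forall>h>0. norm (pairing e m (h\<^sup>2) f) \<le> C * h powr (s' - m - DIM('a) / p)"
proof -
  let ?N = "DIM('a)"
  obtain g where g: "g \<in> Lp_space p"
    and rep: "\<And>\<psi>. \<psi> \<in> schwartz \<Longrightarrow> bessel_potential s (regular_distribution f) \<psi>
        = regular_distribution g \<psi>"
    using f unfolding Hsp_def is_Lp_function_def by blast
  obtain C where C: "\<And>h x. 0 < h \<Longrightarrow> norm (fourier (bessel_symbol s e m (h\<^sup>2)) x)
    \<le> C * h powr (s' - ?N - m) * inverse ((1 + norm x / h) ^ (2 * ?N))"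
    using fourier_bessel_bound[OF s' e m] by blast
  obtain D where D: "\<And>h. 0 < h \<Longrightarrow> integrable lborel (\<lambda>x. norm (g x)
      * inverse ((1 + norm x / h) ^ (2 * ?N)))"
      "\<And>h. 0 < h \<Longrightarrow> (LINT x|lborel. norm (g x) * inverse ((1 + norm x / h) ^ (2 * ?N)))
          \<le> D * h powr (?N - ?N / p)"
    using Lp_decay_integral[OF p g] by blast
  have C0: "0 \<le> C" using C[of 1 0] by (simp, meson norm_ge_zero order_trans)
  have "norm (pairing e m (h\<^sup>2) f) \<le> (C * D) * h powr (s' - m - ?N / p)" if h: "0 < h" for h
  proof -
    let ?\<theta> = "bessel_symbol s e m (h\<^sup>2)"
    have \<theta>: "?\<theta> \<in> gauss_span" using h e by (intro bessel_symbol_gauss_span) auto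
    have "(\<lambda>\<xi>. complex_of_real ((1 + (norm \<xi>)\<^sup>2) powr (s / 2)) * ?\<theta> \<xi>) = herm_symbol e m (h\<^sup>2)"
    proof
      fix \<xi> :: 'a
      have "(1 + (norm \<xi>)\<^sup>2) powr (s / 2) * (1 + (norm \<xi>)\<^sup>2) powr (- s / 2) = 1"
        using one_plus_norm_sq_pos[of \<xi>] by (simp add: powr_add[symmetric])
      then show "complex_of_real ((1 + (norm \<xi>)\<^sup>2) powr (s / 2)) * ?\<theta> \<xi> = herm_symbol e m (h\<^sup>2) \<xi>"
        unfolding bessel_symbol_def mult.assoc[symmetric] of_real_mult[symmetric] by simp
    qed
    \<comment> \<open>By duality the Bessel potential acts on the test function: Fourier inversion
      recovers the symbol, the multiplier reduces it to the Hermite symbol, and the last transform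
      gives \<open>herm\<close>.\<close>
    then have "bessel_potential s (regular_distribution f) (fourier ?\<theta>)
        = regular_distribution f (herm e m (h\<^sup>2))"
      by (simp add: bessel_potential_def inv_fourier_dist_def mult_dist_def fourier_dist_def
          inv_fourier_fourier[OF \<theta>] herm_def)
    then have "(pairing e m (h\<^sup>2) f) = (LINT x|lborel. g x * fourier ?\<theta> x)"
      using rep[OF fourier_schwartz[OF \<theta>]] by (simp add: regular_distribution_def)
    also have "norm \<dots> \<le> (LINT x|lborel. (C * h powr (s' - ?N - m))
        * (norm (g x) * inverse ((1 + norm x / h) ^ (2 * ?N))))"
    proof (rule norm_integral_le)
      show "norm (g x * fourier ?\<theta> x) \<le> (C * h powr (s' - ?N - m))
          * (norm (g x) * inverse ((1 + norm x / h) ^ (2 * ?N)))" for x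
        using mult_left_mono[OF C[OF h, of x] norm_ge_zero[of "g x"]]
            by (simp add: norm_mult mult_ac)
    qed (intro integrable_mult_right D h)
    also have "\<dots> = (C * h powr (s' - ?N - m)) * (LINT x|lborel. norm (g x)
        * inverse ((1 + norm x / h) ^ (2 * ?N)))"
      by (rule integral_mult_right_zero)
    also have "\<dots> \<le> (C * h powr (s' - ?N - m)) * (D * h powr (?N - ?N / p))"
      using C0 by (intro mult_left_mono D h) auto
    also have "\<dots> = (C * D) * (h powr (s' - ?N - m) * h powr (?N - ?N / p))"
      by (simp only: mult_ac)
    also have "h powr (s' - ?N - m) * h powr (?N - ?N / p) = h powr (s' - m - ?N / p)"
      by (simp add: powr_add[symmetric] algebra_simps)
    finally show ?thesis .
  qed
  then show ?thesis by blast
qed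

section \<open>Moments of the model singularity\<close>

lemma herm_symbol_deriv:
  fixes e :: "'a::euclidean_space"
  assumes e: "e \<in> Basis"
  shows "frechet_derivative (herm_symbol e m 1) (at y) e
      = of_nat m * herm_symbol e (m - 1) 1 y - 2 * herm_symbol e (m + 1) 1 y"
proof -
  have 1: "((\<lambda>y::'a. (y \<bullet> e) ^ m) has_derivative (\<lambda>d. of_nat m * (d \<bullet> e) * (y \<bullet> e) ^ (m - 1)))
      (at y)"
    by (rule has_derivative_power[OF has_derivative_inner_left[OF has_derivative_ident]])
  have "((\<lambda>y::'a. - 1 * (norm y)\<^sup>2) has_derivative (\<lambda>d. - 1 * (2 * (y \<bullet> d)))) (at y)"
    by (intro has_derivative_mult_right has_derivative_norm_sq)
  from has_derivative_compose[OF this DERIV_exp[unfolded has_field_derivative_def]]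
  have 2: "((\<lambda>y::'a. exp (- 1 * (norm y)\<^sup>2)) has_derivative (\<lambda>d. exp (- 1 * (norm y)\<^sup>2)
      * (- 1 * (2 * (y \<bullet> d))))) (at y)" .
  from has_derivative_of_real[OF has_derivative_mult[OF 1 2]]
  have "(herm_symbol e m 1 has_derivative (\<lambda>d. complex_of_real ((y \<bullet> e) ^ m
      * (exp (- 1 * (norm y)\<^sup>2) * (- 1 * (2 * (y \<bullet> d)))) +
      of_nat m * (d \<bullet> e) * (y \<bullet> e) ^ (m - 1) * exp (- 1 * (norm y)\<^sup>2)))) (at y)"
    unfolding herm_symbol_def[abs_def] .
  from frechet_derivative_at[OF this, symmetric] e show ?thesis
    by (simp add: herm_symbol_def)
qed

text \<open>The Fourier transform of the derivative of the symbol in direction \<open>e\<close>. For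
  m = 0 the truncated index m - 1 is harmless, since its coefficient is 0.\<close>

lemma herm_recurrence:
  fixes e :: "'a::euclidean_space"
  assumes e: "e \<in> Basis"
  shows "\<i> * complex_of_real (x \<bullet> e) * herm e m 1 x
      = of_nat m * herm e (m - 1) 1 x - 2 * herm e (m + 1) 1 x"
proof -
  have g: "herm_symbol e k 1 \<in> gauss_span" for k by (intro herm_symbol_gauss_span e) simp
  have "\<i> * complex_of_real (x \<bullet> e) * herm e m 1 x
      = fourier (\<lambda>y. of_nat m * herm_symbol e (m - 1) 1 y + (- 2) * herm_symbol e (m + 1) 1 y) x"
    unfolding herm_def fourier_deriv[OF g e, symmetric] herm_symbol_deriv[OF e] by simp
  also have "\<dots> = of_nat m * herm e (m - 1) 1 x + (- 2) * herm e (m + 1) 1 x"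
    unfolding herm_def fourier_cmult[symmetric]
    by (intro fourier_add gauss_span_integrable gauss_span_cmult g)
  finally show ?thesis by simp
qed

lemma herm_has_derivative:
  fixes e :: "'a::euclidean_space"
  assumes e: "e \<in> Basis"
  shows "\<exists>D. (\<forall>x. (herm e m 1 has_derivative D x) (at x)) \<and> (\<forall>x. D x e = - \<i> * herm e (m + 1) 1 x)"
proof -
  have g: "herm_symbol e m 1 \<in> gauss_span" by (intro herm_symbol_gauss_span e) simp
  have "(\<lambda>y. complex_of_real (y \<bullet> e) * herm_symbol e m 1 y) = herm_symbol e (m + 1) 1"
    by (simp add: herm_symbol_def fun_eq_iff)
  then have "fourier (\<lambda>y. - \<i> * (complex_of_real (y \<bullet> e) * herm_symbol e m 1 y)) x
      = - \<i> * herm e (m + 1) 1 x" for x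
    by (subst fourier_cmult) (simp add: herm_def)
  then show ?thesis
    using fourier_has_derivative[OF gauss_span_rapid gauss_span_measurable, OF g g] unfolding
        herm_def
    by (intro exI[of _ "\<lambda>x d. fourier (\<lambda>y. - \<i>
        * (complex_of_real (y \<bullet> d) * herm_symbol e m 1 y)) x"]) blast
qed

text \<open>The weight |y|^(a + 2) is a primitive of a multiple of the model |y|^a y, hence the
  right partner for integration by parts. At 0 its difference quotient is |h|^a h.\<close>

lemma abs_powr_has_derivative:
  fixes a :: real
  assumes "0 < a"
  shows "((\<lambda>y. \<bar>y\<bar> powr (a + 2)) has_real_derivative ((a + 2) * (\<bar>y\<bar> powr a * y))) (at y)"
proof (cases y "0::real" rule: linorder_cases)
  case less
  have "((\<lambda>y. (- y) powr (a + 2)) has_real_derivative ((a + 2) * (\<bar>y\<bar> powr a * y))) (at y)"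
    using less by (auto intro!: derivative_eq_intros simp: powr_add powr_diff field_simps
        power2_eq_square)
  then show ?thesis
    by (rule has_field_derivative_transform_within_open[of _ _ _ "{..<0}"]) (use less in auto)
next
  case equal
  have "((\<lambda>h. \<bar>h\<bar> powr a * h) \<longlongrightarrow> \<bar>0\<bar> powr a * 0) (at (0::real))"
    using assms by (intro tendsto_intros) auto
  then have "((\<lambda>h. \<bar>h\<bar> powr a * h) \<longlongrightarrow> 0) (at (0::real))" by simp
  then have "((\<lambda>h. (\<bar>0 + h\<bar> powr (a + 2) - \<bar>0\<bar> powr (a + 2)) / h) \<longlongrightarrow> 0) (at 0)"
    by (rule Lim_transform_eventually)
       (auto simp: eventually_at_filter powr_add power2_eq_square)
  then show ?thesis using equal by (simp add: DERIV_def)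
next
  case greater
  have "((\<lambda>y. y powr (a + 2)) has_real_derivative ((a + 2) * (\<bar>y\<bar> powr a * y))) (at y)"
    using greater by (auto intro!: derivative_eq_intros simp: powr_add powr_diff field_simps
        power2_eq_square)
  then show ?thesis
    by (rule has_field_derivative_transform_within_open[of _ _ _ "{0<..}"]) (use greater in auto)
qed

lemma rapid_add: "rapid f \<Longrightarrow> rapid g \<Longrightarrow> rapid (\<lambda>x. f x + g x)"
  by (rule poly_span_rapid[of "{f, g}"]) (auto intro: poly_span.intros)

lemma rapid_cmult: "rapid f \<Longrightarrow> rapid (\<lambda>x. c * f x)"
  by (rule poly_span_rapid[of "{f}"]) (auto intro: poly_span.intros)

lemma rapid_weighted:
  assumes w: "\<And>x. \<bar>w x\<bar> \<le> (1 + norm x) ^ j" and f: "rapid f"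
  shows "rapid (\<lambda>x. complex_of_real (w x) * f x)"
  unfolding rapid_def
proof
  fix k
  obtain C where C: "\<And>x. (1 + norm x) ^ (k + j) * norm (f x) \<le> C"
    using f unfolding rapid_def by metis
  have "(1 + norm x) ^ k * norm (complex_of_real (w x) * f x) \<le> C" for x
  proof -
    have "(1 + norm x) ^ k * (\<bar>w x\<bar> * norm (f x))
        \<le> (1 + norm x) ^ k * ((1 + norm x) ^ j * norm (f x))"
      by (intro mult_left_mono mult_right_mono w) auto
    then show ?thesis using C[of x] by (simp add: norm_mult power_add mult_ac)
  qed
  then show "\<exists>C. \<forall>x. (1 + norm x) ^ k * norm (complex_of_real (w x) * f x) \<le> C" by blast
qed

lemma coord_powr_le:
  fixes x :: "'a::euclidean_space"
  assumes "e \<in> Basis" "0 \<le> a" "a \<le> real j"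
  shows "\<bar>x \<bullet> e\<bar> powr a \<le> (1 + norm x) ^ j"
proof -
  have "\<bar>x \<bullet> e\<bar> powr a \<le> (1 + norm x) powr a"
    using Basis_le_norm[OF assms(1), of x] assms by (intro powr_mono2) auto
  also have "\<dots> \<le> (1 + norm x) powr real j"
    using assms by (intro powr_mono) auto
  also have "\<dots> = (1 + norm x) ^ j" by (simp add: powr_realpow add_pos_nonneg)
  finally show ?thesis .
qed

text \<open>Since the model is homogeneous of degree 1 + \<alpha>, this number is the coefficient of
  the leading term at every scale; the lower bound for the solution depends on its being
  nonzero.\<close>

definition herm_moment :: "real \<Rightarrow> 'a::euclidean_space \<Rightarrow> nat \<Rightarrow> complex" where
  "herm_moment \<alpha> e m = (LINT x|lborel. complex_of_real (\<bar>x \<bullet> e\<bar> powr \<alpha> * (x \<bullet> e)) * herm e m 1 x)"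

lemma coord_weight_le:
  fixes x :: "'a::euclidean_space"
  assumes "e \<in> Basis" "0 < \<alpha>" "\<alpha> < 1"
  shows "\<bar>\<bar>x \<bullet> e\<bar> powr \<alpha> * (x \<bullet> e)\<bar> \<le> (1 + norm x) ^ 2"
proof -
  have "\<bar>\<bar>x \<bullet> e\<bar> powr \<alpha> * (x \<bullet> e)\<bar> = \<bar>x \<bullet> e\<bar> powr (\<alpha> + 1)"
    by (simp add: abs_mult powr_add)
  then show ?thesis using coord_powr_le[OF assms(1), of "\<alpha> + 1" 2 x] assms by simp
qed

lemma
  fixes e :: "'a::euclidean_space"
  assumes e: "e \<in> Basis" and \<alpha>: "0 < \<alpha>" "\<alpha> < 1"
  shows herm_weight1_rapid: "rapid (\<lambda>x. complex_of_real (\<bar>x \<bullet> e\<bar> powr \<alpha> * (x \<bullet> e)) * herm e m 1 x)"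
    and herm_weight2_rapid: "rapid (\<lambda>x. complex_of_real (\<bar>x \<bullet> e\<bar> powr (\<alpha> + 2)) * herm e m 1 x)"
    and herm_weight1_integrable: "integrable lborel (\<lambda>x. complex_of_real (\<bar>x \<bullet> e\<bar> powr \<alpha> * (x \<bullet> e))
        * herm e m 1 x)"
    and herm_weight2_integrable: "integrable lborel (\<lambda>x. complex_of_real (\<bar>x \<bullet> e\<bar> powr (\<alpha> + 2))
        * herm e m 1 x)"
proof -
  note [measurable] = herm_measurable[OF zero_less_one e]
  show 1: "rapid (\<lambda>x. complex_of_real (\<bar>x \<bullet> e\<bar> powr \<alpha> * (x \<bullet> e)) * herm e m 1 x)"
    by (rule rapid_weighted[OF coord_weight_le[OF e \<alpha>] herm_rapid[OF _ e]]) simp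
  show 2: "rapid (\<lambda>x. complex_of_real (\<bar>x \<bullet> e\<bar> powr (\<alpha> + 2)) * herm e m 1 x)"
    by (rule rapid_weighted[OF _ herm_rapid[OF _ e], of _ 3])
        (use coord_powr_le[OF e, of "\<alpha> + 2" 3] \<alpha> in auto)
  show "integrable lborel (\<lambda>x. complex_of_real (\<bar>x \<bullet> e\<bar> powr \<alpha> * (x \<bullet> e)) * herm e m 1 x)"
    by (rule rapid_integrable[OF 1]) measurable
  show "integrable lborel (\<lambda>x. complex_of_real (\<bar>x \<bullet> e\<bar> powr (\<alpha> + 2)) * herm e m 1 x)"
    by (rule rapid_integrable[OF 2]) measurable
qed

text \<open>The derivative in direction \<open>e\<close> of |x \<bullet> e|^(\<alpha> + 2) times the
  Hermite function has integral 0. Differentiating the weight produces the model, differentiating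
  the Hermite function raises m by one.\<close>

lemma herm_moment_parts:
  fixes e :: "'a::euclidean_space"
  assumes e: "e \<in> Basis" and \<alpha>: "0 < \<alpha>" "\<alpha> < 1"
  shows "(\<alpha> + 2) * herm_moment \<alpha> e m = \<i> * (LINT x|lborel. complex_of_real (\<bar>x \<bullet> e\<bar> powr (\<alpha> + 2))
      * herm e (m + 1) 1 x)"
proof -
  obtain D where D: "\<And>x. (herm e m 1 has_derivative D x) (at x)" "\<And>x. D x e
      = - \<i> * herm e (m + 1) 1 x"
    using herm_has_derivative[OF e] by metis
  let ?w = "\<lambda>x::'a. \<bar>x \<bullet> e\<bar> powr (\<alpha> + 2)" and ?v = "\<lambda>x::'a. \<bar>x \<bullet> e\<bar> powr \<alpha> * (x \<bullet> e)"
  define E where "E x d = complex_of_real (?w x) * D x d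
      + complex_of_real ((d \<bullet> e) * ((\<alpha> + 2) * ?v x)) * herm e m 1 x" for x d
  have E: "((\<lambda>x. complex_of_real (?w x) * herm e m 1 x) has_derivative E x) (at x)" for x
  proof -
    have "((\<lambda>x::'a. x \<bullet> e) has_derivative (\<lambda>d. d \<bullet> e)) (at x)"
      by (rule has_derivative_inner_left[OF has_derivative_ident])
    from has_derivative_compose[OF this abs_powr_has_derivative[OF \<alpha>(1), unfolded
        has_field_derivative_def]]
    have "((\<lambda>x. ?w x) has_derivative (\<lambda>d. (d \<bullet> e) * ((\<alpha> + 2) * ?v x))) (at x)"
      by (simp add: mult_ac)
    from has_derivative_mult[OF has_derivative_of_real[OF this] D(1)] show ?thesis
      unfolding E_def[abs_def] .
  qed
  have Ee: "E x e = - \<i> * (complex_of_real (?w x) * herm e (m + 1) 1 x) + (\<alpha> + 2)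
      * (complex_of_real (?v x) * herm e m 1 x)" for x
    using e by (simp add: E_def D(2))
  note [measurable] = herm_measurable[OF zero_less_one e]
  have r: "rapid (\<lambda>x. E x e)"
    unfolding Ee
    by (intro rapid_add rapid_cmult herm_weight1_rapid herm_weight2_rapid e \<alpha>)
  obtain C where C: "\<And>x. (1 + norm x) ^ (2 * DIM('a)) * norm (E x e) \<le> C"
    using r unfolding rapid_def by metis
  have "(LINT x|lborel. E x e) = 0"
  proof (rule integral_partial_deriv_zero[OF E herm_weight2_integrable[OF e \<alpha>] e order_refl _ C])
    show "(\<lambda>x. E x e) \<in> borel_measurable borel"
      unfolding Ee by measurable
  qed
  also have "(LINT x|lborel. E x e) = - \<i> * (LINT x|lborel. complex_of_real (?w x)
      * herm e (m + 1) 1 x) + (\<alpha> + 2) * herm_moment \<alpha> e m"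
    unfolding Ee herm_moment_def
    by (subst Bochner_Integration.integral_add, intro integrable_mult_right herm_weight2_integrable
        e \<alpha>,
        intro integrable_mult_right herm_weight1_integrable e \<alpha>) (simp only:
            integral_mult_right_zero)
  finally show ?thesis by (simp add: algebra_simps)
qed

lemma coord_weight_mult: "(\<bar>y\<bar> powr a * y) * y = \<bar>y\<bar> powr (a + 2)" for y a :: real
  by (simp add: powr_add power2_eq_square[symmetric] mult.assoc)

text \<open>As |y|^(\<alpha> + 2) = (|y|^\<alpha> y) y, the additional factor x \<bullet> e can be
  spent on the recurrence of the Hermite functions. Combined with \<open>herm_moment_parts\<close>
  this eliminates the even weight.\<close>

lemma herm_moment_rec:
  fixes e :: "'a::euclidean_space"
  assumes e: "e \<in> Basis" and \<alpha>: "0 < \<alpha>" "\<alpha> < 1"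
  shows "\<i> * (LINT x|lborel. complex_of_real (\<bar>x \<bullet> e\<bar> powr (\<alpha> + 2)) * herm e m 1 x)
    = of_nat m * herm_moment \<alpha> e (m - 1) - 2 * herm_moment \<alpha> e (m + 1)"
proof -
  let ?w = "\<lambda>x::'a. complex_of_real (\<bar>x \<bullet> e\<bar> powr (\<alpha> + 2))"
      and ?v = "\<lambda>x::'a. complex_of_real (\<bar>x \<bullet> e\<bar> powr \<alpha> * (x \<bullet> e))"
  have "\<i> * (?w x * herm e m 1 x) = of_nat m * (?v x * herm e (m - 1) 1 x) + (- 2)
      * (?v x * herm e (m + 1) 1 x)" for x
  proof -
    have "?w x = ?v x * complex_of_real (x \<bullet> e)"
      by (simp only: coord_weight_mult[symmetric] of_real_mult)
    then have "\<i> * (?w x * herm e m 1 x) = ?v x * (\<i> * complex_of_real (x \<bullet> e) * herm e m 1 x)"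
      by (simp add: mult_ac)
    then show ?thesis unfolding herm_recurrence[OF e] by (simp add: algebra_simps)
  qed
  then have "\<i> * (pairing e m 1 ?w) = (LINT x|lborel. of_nat m * (?v x * herm e (m - 1) 1 x) + (- 2)
      * (?v x * herm e (m + 1) 1 x))"
    by (subst integral_mult_right_zero[symmetric]) simp
  also have "\<dots> = of_nat m * herm_moment \<alpha> e (m - 1) + (- 2) * herm_moment \<alpha> e (m + 1)"
    unfolding herm_moment_def
    by (subst Bochner_Integration.integral_add;
        (intro integrable_mult_right herm_weight1_integrable e \<alpha>)?)
       (simp only: integral_mult_right_zero)
  finally show ?thesis by simp
qed

lemma herm_0: "herm e 0 1 x = complex_of_real ((2 * pi) ^ DIM('a)
    * heat_kernel 1 (x::'a::euclidean_space))"
proof -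
  have "herm e 0 1 x = (LINT \<xi>|lborel. exp (- 1 * (norm \<xi>)\<^sup>2) *\<^sub>R iexp (\<xi> \<bullet> (- x)))"
    by (simp add: herm_def fourier_def herm_symbol_def scaleR_conv_of_real mult.commute)
  also have "\<dots> = ((2 * pi) ^ DIM('a) * heat_kernel 1 (- x)) *\<^sub>R 1"
    by (rule gauss_fourier_inverse) simp
  finally show ?thesis by (simp add: heat_kernel_minus of_real_def)
qed

text \<open>At m = 0 the recursion expresses this moment by the integral of |x \<bullet>
  e|^(\<alpha> + 2) against a Gaussian. The integrand is nonnegative and vanishes only on a
  hyperplane.\<close>

lemma herm_moment_1:
  fixes e :: "'a::euclidean_space"
  assumes e: "e \<in> Basis" and \<alpha>: "0 < \<alpha>" "\<alpha> < 1"
  shows "herm_moment \<alpha> e 1 \<noteq> 0"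
proof
  assume "herm_moment \<alpha> e 1 = 0"
  then have "(LINT x|lborel. complex_of_real (\<bar>x \<bullet> e\<bar> powr (\<alpha> + 2)) * herm e 0 1 x) = 0"
    using herm_moment_rec[OF e \<alpha>, of 0] by simp
  then have "complex_of_real (LINT x|lborel. \<bar>x \<bullet> e\<bar> powr (\<alpha> + 2)
      * ((2 * pi) ^ DIM('a) * heat_kernel 1 x)) = 0"
    unfolding herm_0 of_real_mult[symmetric] integral_complex_of_real .
  then have 0: "(LINT x|lborel. \<bar>x \<bullet> e\<bar> powr (\<alpha> + 2) * ((2 * pi) ^ DIM('a) * heat_kernel 1 x)) = 0"
    by simp
  have "integrable lborel (\<lambda>x. complex_of_real (\<bar>x \<bullet> e\<bar> powr (\<alpha> + 2)
      * ((2 * pi) ^ DIM('a) * heat_kernel 1 x)))"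
    using herm_weight2_integrable[OF e \<alpha>, of 0] unfolding herm_0 of_real_mult[symmetric] .
  then have int: "integrable lborel (\<lambda>x. \<bar>x \<bullet> e\<bar> powr (\<alpha> + 2)
      * ((2 * pi) ^ DIM('a) * heat_kernel 1 x))"
    by (simp only: complex_of_real_integrable_eq)
  have "AE x in lborel. \<bar>x \<bullet> e\<bar> powr (\<alpha> + 2) * ((2 * pi) ^ DIM('a) * heat_kernel 1 x) = 0"
    using 0 integral_nonneg_eq_0_iff_AE[OF int] by (simp add: heat_kernel_nonneg)
  moreover have "negligible {x. e \<bullet> x = 0}"
    using e by (intro negligible_hyperplane) (auto simp: nonzero_Basis)
  then have "{x. e \<bullet> x = 0} \<in> null_sets lborel"
    unfolding negligible_iff_null_sets by (subst (asm) null_sets_completion_iff) auto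
  from AE_not_in[OF this] have "AE x in lborel. e \<bullet> x \<noteq> 0" by simp
  ultimately have "AE x in (lborel :: 'a measure). False"
    by eventually_elim (auto simp: heat_kernel_def inner_commute)
  then show False
    by (simp add: AE_iff_measurable[of UNIV] emeasure_lborel_UNIV)
qed

text \<open>The two preceding relations give \<open>2 J(m + 2) = (m - 1 - \<alpha>) J(m)\<close> for the moments, and \<open>\<alpha>\<close>
  is not an integer.\<close>

lemma herm_moment_nonzero:
  fixes e :: "'a::euclidean_space"
  assumes e: "e \<in> Basis" and \<alpha>: "0 < \<alpha>" "\<alpha> < 1"
  shows "herm_moment \<alpha> e (2 * k + 1) \<noteq> 0"
proof (induction k)
  case 0
  then show ?case using herm_moment_1[OF e \<alpha>] by simp
next
  case (Suc k)
  let ?m = "2 * k + 1"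
  have "(\<alpha> + 2) * herm_moment \<alpha> e ?m = of_nat (?m + 1) * herm_moment \<alpha> e ?m - 2
      * herm_moment \<alpha> e (?m + 2)"
    using herm_moment_parts[OF e \<alpha>, of ?m] herm_moment_rec[OF e \<alpha>, of "?m + 1"] by simp
  then have "2 * herm_moment \<alpha> e (?m + 2) = complex_of_real (2 * real k - \<alpha>) * herm_moment \<alpha> e ?m"
    by (simp add: algebra_simps)
  moreover have "2 * real k - \<alpha> \<noteq> 0"
    using \<alpha> by (cases k) auto
  ultimately show ?case using Suc
    by (metis Suc_eq_plus1 add_2_eq_Suc' add_Suc mult_Suc_right mult_eq_0_iff mult_zero_right
        of_real_eq_0_iff plus_1_eq_Suc)
qed

subsection \<open>The initial datum and the singularity\<close>

lemma linear_norm_le_partials: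
  fixes D :: "'a::euclidean_space \<Rightarrow> complex"
  assumes "linear D"
  shows "norm (D d) \<le> (\<Sum>b\<in>Basis. norm (D b)) * norm d"
proof -
  have "D d = D (\<Sum>b\<in>Basis. (d \<bullet> b) *\<^sub>R b)" by (simp add: euclidean_representation)
  also have "\<dots> = (\<Sum>b\<in>Basis. (d \<bullet> b) *\<^sub>R D b)"
    by (simp add: linear_sum[OF assms] linear_scale[OF assms])
  also have "norm \<dots> \<le> (\<Sum>b\<in>Basis. norm (D b) * norm d)"
  proof (rule order_trans[OF norm_sum], rule sum_mono)
    fix b :: 'a assume "b \<in> Basis"
    then show "norm ((d \<bullet> b) *\<^sub>R D b) \<le> norm (D b) * norm d"
      using mult_left_mono[OF Basis_le_norm, of b "norm (D b)" d] by (simp add: mult.commute)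
  qed
  finally show ?thesis by (simp add: sum_distrib_right)
qed

text \<open>For members of \<open>bump_span\<close> it is the partial derivatives that are known to
  be bounded and continuous; their sum serves as a bound on the operator norm.\<close>

lemma diff_bound_partials:
  fixes f :: "'a::euclidean_space \<Rightarrow> complex"
  assumes "convex S" and D: "\<And>x. x \<in> S \<Longrightarrow> (f has_derivative D x) (at x)"
    and B: "\<And>x. x \<in> S \<Longrightarrow> (\<Sum>b\<in>Basis. norm (D x b)) \<le> B" and xy: "x \<in> S" "y \<in> S"
  shows "norm (f x - f y) \<le> B * norm (x - y)"
proof (rule differentiable_bound[OF assms(1) _ _ xy])
  fix z assume z: "z \<in> S"
  show "(f has_derivative D z) (at z within S)" using D[OF z] by (rule has_derivative_at_withinI)
  have B0: "0 \<le> B" using B[OF z] by (meson norm_ge_zero order_trans sum_nonneg)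
  show "onorm (D z) \<le> B"
  proof (rule onorm_bound[OF B0])
    fix d
    show "norm (D z d) \<le> B * norm d"
      using linear_norm_le_partials[OF has_derivative_linear[OF D[OF z]], of d]
          mult_right_mono[OF B[OF z] norm_ge_zero[of d]]
      by linarith
  qed
qed

text \<open>The bump has the value exp(-1) at the origin, and this is the slope b of the datum
  there.\<close>

definition datum :: "'a::euclidean_space \<Rightarrow> 'a \<Rightarrow> complex" where
  "datum e x = complex_of_real (x \<bullet> e) * complex_of_real (bump1 0 (1 - (norm x)\<^sup>2))"

lemma bump_in_bump_span: "(\<lambda>x. complex_of_real (bump1 0 (1 - (norm x)\<^sup>2))) \<in> bump_span"
  unfolding bump_span_def by (intro poly_span.base) (auto simp: bump_gen_def)

lemma datum_bump_span: "e \<in> Basis \<Longrightarrow> datum e \<in> bump_span"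
  using bump_in_bump_span unfolding bump_span_def datum_def[abs_def] by (intro poly_span.coord)

lemma datum_odd: "odd_fun (datum e)"
  by (simp add: odd_fun_def datum_def)

lemma bump_span_deriv:
  assumes "f \<in> bump_span"
  shows "(f has_derivative frechet_derivative f (at x)) (at x)"
    and "b \<in> Basis \<Longrightarrow> (\<lambda>x. frechet_derivative f (at x) b) \<in> bump_span"
  using assms bump_span_deriv_closed unfolding deriv_closed_def frechet_derivative_works by auto

lemma bump_span_lip:
  assumes "f \<in> bump_span"
  shows "\<exists>L\<ge>0. lip_fun L (f :: 'a::euclidean_space \<Rightarrow> complex)"
proof -
  have "\<forall>b\<in>Basis. \<exists>B. \<forall>x. norm (frechet_derivative f (at x) b) \<le> B"
    using bump_span_bounded bump_span_deriv(2)[OF assms] by blast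
  then obtain B where B: "\<And>b x. b \<in> Basis \<Longrightarrow> norm (frechet_derivative f (at x) b) \<le> B b"
    by metis
  have "lip_fun (\<Sum>b\<in>Basis. B b) f"
    unfolding lip_fun_def
    using diff_bound_partials[OF convex_UNIV bump_span_deriv(1)[OF assms] sum_mono[OF B]] by blast
  moreover have "0 \<le> (\<Sum>b\<in>(Basis::'a set). B b)"
    by (intro sum_nonneg) (meson B norm_ge_zero order_trans)
  ultimately show ?thesis by blast
qed

text \<open>Subtracting the linear part leaves a function whose derivative is continuous and
  vanishes at 0. The estimate concerns two arbitrary points near 0 because the heat semigroup will
  compare the datum at translates of x and -x.\<close>

lemma datum_near_linear:
  fixes e :: "'a::euclidean_space"
  assumes e: "e \<in> Basis" and \<epsilon>: "0 < \<epsilon>"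
  shows "\<exists>\<delta>>0. \<forall>x\<in>ball 0 \<delta>. \<forall>y\<in>ball 0 \<delta>.
    norm (datum e x - datum e y - complex_of_real (exp (- 1) * ((x - y) \<bullet> e))) \<le> \<epsilon> * norm (x - y)"
proof -
  let ?\<beta> = "\<lambda>x::'a. complex_of_real (bump1 0 (1 - (norm x)\<^sup>2))"
  define D where "D x d = frechet_derivative (datum e) (at x) d
      - complex_of_real (exp (- 1) * (d \<bullet> e))" for x d
  define g where "g x = datum e x - complex_of_real (exp (- 1) * (x \<bullet> e))" for x
  have g: "(g has_derivative D x) (at x)" for x
    unfolding g_def D_def[abs_def]
    by (intro has_derivative_diff bump_span_deriv datum_bump_span e has_derivative_of_real
        has_derivative_mult_right has_derivative_inner_left has_derivative_ident)
  have D0: "D 0 d = 0" for d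
  proof -
    obtain \<beta>' where \<beta>': "(?\<beta> has_derivative \<beta>') (at 0)"
      using bump_span_deriv(1)[OF bump_in_bump_span] by blast
    have "(datum e has_derivative (\<lambda>d. complex_of_real (0 \<bullet> e) * \<beta>' d + complex_of_real (d \<bullet> e)
        * ?\<beta> 0)) (at 0)"
      unfolding datum_def[abs_def]
      by (intro has_derivative_mult has_derivative_of_real has_derivative_inner_left
          has_derivative_ident \<beta>')
    from frechet_derivative_at[OF this, symmetric] show ?thesis
      by (simp add: D_def bump1_def)
  qed
  have "isCont (\<lambda>x. \<Sum>b\<in>Basis. norm (D x b)) 0"
  proof -
    have "isCont (\<lambda>x. frechet_derivative (datum e) (at x) b) 0" if "b \<in> Basis" for b
      using bump_span_continuous[OF bump_span_deriv(2)[OF datum_bump_span[OF e] that], of UNIV]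
      by (simp add: continuous_on_eq_continuous_at)
    then show ?thesis unfolding D_def by (intro continuous_intros) auto
  qed
  from this[unfolded continuous_at_eps_delta, rule_format, OF \<epsilon>]
  obtain \<delta> where \<delta>: "\<delta> > 0" "\<And>x. norm x < \<delta> \<Longrightarrow> \<bar>\<Sum>b\<in>Basis. norm (D x b)\<bar> < \<epsilon>"
    by (auto simp: D0 dist_norm)
  have "norm (g x - g y) \<le> \<epsilon> * norm (x - y)" if "x \<in> ball 0 \<delta>" "y \<in> ball 0 \<delta>" for x y
    by (rule diff_bound_partials[OF convex_ball g _ that]) (use \<delta>(2) in \<open>force simp: dist_norm\<close>)
  then show ?thesis
    using \<delta>(1) by (intro exI[of _ \<delta>]) (auto simp: g_def inner_diff_left right_diff_distrib
        algebra_simps)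
qed

definition datum_bc :: "'a::euclidean_space \<Rightarrow> 'a \<Rightarrow>\<^sub>C complex" where
  "datum_bc e = Bcontfun (datum e)"

lemma apply_datum_bc:
  assumes "e \<in> Basis"
  shows "apply_bcontfun (datum_bc e) = datum e"
proof -
  obtain B where "\<And>x. norm (datum e x) \<le> B"
    using bump_span_bounded[OF datum_bump_span[OF assms]] by blast
  then have "datum e \<in> bcontfun"
    by (intro bcontfun_normI bump_span_continuous datum_bump_span assms)
  then show ?thesis by (simp add: datum_bc_def Bcontfun_inverse)
qed

lemma datum_bc_C0:
  assumes "e \<in> Basis"
  shows "datum_bc e \<in> C0"
proof -
  have "\<forall>\<^sub>F x in at_infinity. datum_bc e x = 0"
    unfolding eventually_at_infinity apply_datum_bc[OF assms]
    using bump_span_support[OF datum_bump_span[OF assms]] by blast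
  then show ?thesis
    unfolding C0_def by (auto intro: tendsto_eventually)
qed

text \<open>By oddness, twice the value at x is the heat average of the difference of the datum at x
  - c y and at -x - c y, where c = sqrt t. This difference is O(|x|) for every y, so the error is
  relative to |x|. For c |y| < \<delta>/2 both points lie where the datum is almost linear; the
  other y are controlled by the first moment of the kernel and gain a factor c.\<close>

lemma heat_datum_near_linear:
  fixes e :: "'a::euclidean_space"
  assumes e: "e \<in> Basis" and \<epsilon>: "0 < \<epsilon>"
  shows "\<exists>\<tau>>0. \<exists>\<delta>>0. \<forall>t\<in>{0..\<tau>}. \<forall>x. norm x \<le> \<delta> \<longrightarrow>
    norm (heat_semigroup t (datum_bc e) x - complex_of_real (exp (- 1) * (x \<bullet> e))) \<le> \<epsilon> * norm x"
proof -
  let ?M = "heat_moment TYPE('a)"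
  define b where "b = exp (- 1 :: real)"
  have b: "0 < b" by (simp add: b_def)
  have \<epsilon>2: "0 < \<epsilon> / 2" using \<epsilon> by simp
  obtain \<delta> where \<delta>: "0 < \<delta>" and near: "\<And>x y. x \<in> ball 0 \<delta> \<Longrightarrow> y \<in> ball 0 \<delta> \<Longrightarrow>
    norm (datum e x - datum e y - complex_of_real (b * ((x - y) \<bullet> e))) \<le> \<epsilon> / 2 * norm (x - y)"
    using datum_near_linear[OF e \<epsilon>2] unfolding b_def by blast
  obtain L where L: "0 \<le> L" "lip_fun L (datum e)"
    using bump_span_lip[OF datum_bump_span[OF e]] by blast
  define A where "A = 4 * (L + b) * ?M + 1"
  have A: "0 < A" "4 * (L + b) * ?M \<le> A"
    unfolding A_def using L b heat_moment_nonneg[where 'a='a]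
        by (auto intro!: add_nonneg_pos mult_nonneg_nonneg)
  \<comment> \<open>This gives c \<le> \<epsilon> \<delta> / A, so the contribution of large y, at
    most A (c / \<delta>) |x|, stays below \<epsilon> |x|.\<close>
  define \<tau> where "\<tau> = (\<epsilon> * \<delta> / A)\<^sup>2"
  have \<tau>: "0 < \<tau>" using \<epsilon> \<delta> A by (simp add: \<tau>_def)
  have main: "norm (heat_semigroup t (datum_bc e) x - complex_of_real (b * (x \<bullet> e))) \<le> \<epsilon> * norm x"
    if t: "t \<in> {0..\<tau>}" and x: "norm x \<le> \<delta> / 2" for t x
  proof -
    define c where "c = sqrt t"
    have c: "0 \<le> c" "c \<le> \<epsilon> * \<delta> / A"
    proof -
      show "0 \<le> c" using t by (simp add: c_def)
      have "sqrt t \<le> sqrt \<tau>" using t by simp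
      also have "sqrt \<tau> = \<epsilon> * \<delta> / A" using \<epsilon> \<delta> A by (simp add: \<tau>_def)
      finally show "c \<le> \<epsilon> * \<delta> / A" by (simp add: c_def)
    qed
    let ?g = "\<lambda>y. datum e (x - c *\<^sub>R y) - datum e (- x - c *\<^sub>R y)
        - complex_of_real (b * ((2 *\<^sub>R x) \<bullet> e))"
    have gb: "norm (?g y) \<le> \<epsilon> * norm x + (4 * (L + b) * norm x * (c / \<delta>)) * norm y" for y
    proof (cases "c * norm y < \<delta> / 2")
      case True
      have "x - c *\<^sub>R y \<in> ball 0 \<delta>" "- x - c *\<^sub>R y \<in> ball 0 \<delta>"
        unfolding mem_ball_0 using norm_triangle_ineq4[of x "c *\<^sub>R y"]
            norm_triangle_ineq4[of "- x" "c *\<^sub>R y"] True x c by auto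
      from near[OF this]
      have "norm (?g y) \<le> \<epsilon> / 2 * norm (2 *\<^sub>R x)" by (simp add: scaleR_2 dist_norm)
      moreover have "0 \<le> (4 * (L + b) * norm x * (c / \<delta>)) * norm y"
        using L b c \<delta> by (intro mult_nonneg_nonneg) auto
      ultimately show ?thesis by simp
    next
      case False
      have "norm (?g y) \<le> norm (datum e (x - c *\<^sub>R y) - datum e (- x - c *\<^sub>R y))
          + norm (complex_of_real (b * ((2 *\<^sub>R x) \<bullet> e)))"
        by (rule norm_triangle_ineq4)
      also have "\<dots> \<le> L * norm (2 *\<^sub>R x) + b * norm (2 *\<^sub>R x)"
      proof (rule add_mono)
        show "norm (datum e (x - c *\<^sub>R y) - datum e (- x - c *\<^sub>R y)) \<le> L * norm (2 *\<^sub>R x)"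
          using L(2)[unfolded lip_fun_def, rule_format, of "x - c *\<^sub>R y" "- x - c *\<^sub>R y"]
              by (simp add: scaleR_2)
        show "norm (complex_of_real (b * ((2 *\<^sub>R x) \<bullet> e))) \<le> b * norm (2 *\<^sub>R x)"
          using b Basis_le_norm[OF e, of "2 *\<^sub>R x"] unfolding norm_of_real abs_mult
              by (intro mult_mono) auto
      qed
      also have "\<dots> = 2 * (L + b) * norm x * 1" by (simp add: algebra_simps)
      \<comment> \<open>In this case the inserted factor 2 (c / \<delta>) |y| is at least 1.\<close>
      also have "\<dots> \<le> 2 * (L + b) * norm x * (2 * (c / \<delta>) * norm y)"
        using False \<delta> L b by (intro mult_left_mono) (auto simp: field_simps)
      also have "\<dots> = 0 + (4 * (L + b) * norm x * (c / \<delta>)) * norm y"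
        by (simp add: algebra_simps)
      also have "\<dots> \<le> \<epsilon> * norm x + (4 * (L + b) * norm x * (c / \<delta>)) * norm y"
        using \<epsilon> by (intro add_right_mono) simp
      finally show ?thesis .
    qed
    have odd: "heat_semigroup t (datum_bc e) (- x) = - heat_semigroup t (datum_bc e) x"
      using heat_semigroup_odd[of "datum_bc e" t] datum_odd[of e] unfolding odd_fun_def
          apply_datum_bc[OF e] by blast
    have int1: "integrable lborel (\<lambda>y. heat_kernel 1 y *\<^sub>R datum e (z - c *\<^sub>R y))" for z
      using heat_integrable[of "datum_bc e" z c] by (simp add: apply_datum_bc[OF e])
    have int0: "integrable lborel (\<lambda>y::'a. heat_kernel 1 y *\<^sub>R z)" for z :: complex
      by (intro integrable_scaleR_left integrable_heat_kernel) simp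
    have "2 * (heat_semigroup t (datum_bc e) x - complex_of_real (b * (x \<bullet> e)))
        = heat_semigroup t (datum_bc e) x - heat_semigroup t (datum_bc e) (- x) - complex_of_real
            (b * ((2 *\<^sub>R x) \<bullet> e))"
      unfolding odd by (simp add: algebra_simps)
    also have "\<dots> = (LINT y|lborel. heat_kernel 1 y *\<^sub>R ?g y)"
    proof -
      have "(LINT y|lborel. heat_kernel 1 y *\<^sub>R ?g y)
        = (LINT y|lborel. heat_kernel 1 y *\<^sub>R datum e (x - c *\<^sub>R y)) -
            (LINT y|lborel. heat_kernel 1 y *\<^sub>R datum e (- x - c *\<^sub>R y))
          - (LINT y|lborel. heat_kernel 1 (y::'a) *\<^sub>R complex_of_real (b * ((2 *\<^sub>R x) \<bullet> e)))"
        unfolding scaleR_diff_right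
        by (simp only: Bochner_Integration.integral_diff[OF
            Bochner_Integration.integrable_diff[OF int1 int1] int0]
            Bochner_Integration.integral_diff[OF int1 int1])
      also have "(LINT y|lborel. heat_kernel 1 (y::'a) *\<^sub>R complex_of_real (b * ((2 *\<^sub>R x) \<bullet> e)))
          = complex_of_real (b * ((2 *\<^sub>R x) \<bullet> e))"
        using integral_heat_kernel[of 1, where 'a='a] integrable_heat_kernel[of 1, where 'a='a]
        by (subst integral_scaleR_left) auto
      finally show ?thesis
        using t by (simp add: heat_semigroup_eq apply_datum_bc[OF e] c_def max_def)
    qed
    also have "norm \<dots> \<le> (LINT y|lborel. heat_kernel 1 (y::'a)
        * (\<epsilon> * norm x + (4 * (L + b) * norm x * (c / \<delta>)) * norm y))"
    proof (rule heat_kernel_mean_le[OF _ gb])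
      show "integrable lborel (\<lambda>y. heat_kernel 1 y *\<^sub>R ?g y)"
        unfolding scaleR_diff_right by (intro Bochner_Integration.integrable_diff int1 int0)
      have "integrable lborel (\<lambda>y::'a. (\<epsilon> * norm x) * heat_kernel 1 y
          + (4 * (L + b) * norm x * (c / \<delta>)) * (heat_kernel 1 y * norm y))"
        by (intro Bochner_Integration.integrable_add integrable_mult_right heat_moment_integrable
            integrable_heat_kernel) simp
      then show "integrable lborel (\<lambda>y::'a. heat_kernel 1 y
          * (\<epsilon> * norm x + (4 * (L + b) * norm x * (c / \<delta>)) * norm y))"
        by (simp add: algebra_simps)
    qed
    also have "\<dots> = (LINT y|lborel. (\<epsilon> * norm x) * heat_kernel 1 (y::'a)
        + (4 * (L + b) * norm x * (c / \<delta>)) * (heat_kernel 1 y * norm y))"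
      by (simp add: algebra_simps)
    also have "\<dots> = \<epsilon> * norm x + (4 * (L + b) * norm x * (c / \<delta>)) * ?M"
      using integral_heat_kernel[of 1, where 'a='a]
      by (subst Bochner_Integration.integral_add, intro integrable_mult_right integrable_heat_kernel
          zero_less_one,
          intro integrable_mult_right heat_moment_integrable) (simp only: integral_mult_right_zero
              heat_moment_def)
    also have "\<dots> \<le> \<epsilon> * norm x + \<epsilon> * norm x"
    proof -
      have "(4 * (L + b) * norm x * (c / \<delta>)) * ?M = (4 * (L + b) * ?M) * (c / \<delta>) * norm x" by simp
      also have "\<dots> \<le> A * (c / \<delta>) * norm x"
        using A c \<delta> by (intro mult_right_mono) auto
      also have "\<dots> \<le> \<epsilon> * norm x"
        using A c \<delta> by (intro mult_right_mono) (auto simp: field_simps)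
      finally show ?thesis by simp
    qed
    finally have "norm (2 * (heat_semigroup t (datum_bc e) x - complex_of_real (b * (x \<bullet> e))))
        \<le> 2 * (\<epsilon> * norm x)"
      by simp
    then show ?thesis unfolding norm_mult by simp
  qed
  show ?thesis
    using \<tau> \<delta> main unfolding b_def by (intro exI[of _ \<tau>] conjI exI[of _ "\<delta> / 2"]) auto
qed

section \<open>Asymptotics of the pairings and the contradiction\<close>

lemma herm_pairing_scale:
  fixes e :: "'a::euclidean_space" and g :: "'a \<Rightarrow> complex"
  assumes r: "0 < r"
  shows "(pairing e m r g) = (LINT y|lborel. g (sqrt r *\<^sub>R y) * herm e m 1 y) /\<^sub>R sqrt r ^ m"
proof -
  define c where "c = sqrt r"
  have c: "0 < c" using r by (simp add: c_def)
  have h: "herm e m r (c *\<^sub>R y) = herm e m 1 y /\<^sub>R c ^ (DIM('a) + m)" for y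
    using c by (simp add: herm_scale[OF r] c_def[symmetric])
  have "(pairing e m r g) = c ^ DIM('a) *\<^sub>R (LINT y|lborel. g (c *\<^sub>R y) * herm e m r (c *\<^sub>R y))"
    using integral_lborel_affine[of c "\<lambda>x. g x * herm e m r x" 0] c by simp
  also have "(LINT y|lborel. g (c *\<^sub>R y) * herm e m r (c *\<^sub>R y))
      = (LINT y|lborel. (g (c *\<^sub>R y) * herm e m 1 y) /\<^sub>R c ^ (DIM('a) + m))"
    by (simp add: h)
  also have "\<dots> = (LINT y|lborel. g (c *\<^sub>R y) * herm e m 1 y) /\<^sub>R c ^ (DIM('a) + m)"
    by (rule integral_scaleR_right)
  finally show ?thesis
    using c by (simp add: c_def[symmetric] power_add)
qed

lemma herm_norm_moment_integrable:
  fixes e :: "'a::euclidean_space"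
  assumes e: "e \<in> Basis" and a: "0 \<le> a"
  shows "integrable lborel (\<lambda>x. norm x powr a * norm (herm e m 1 x))"
proof -
  obtain j where j: "a \<le> real j" using real_arch_simple by blast
  have [measurable]: "herm e m 1 \<in> borel_measurable borel" by (intro herm_measurable e) simp
  have "\<bar>norm x powr a\<bar> \<le> (1 + norm x) ^ j" for x :: 'a
  proof -
    have "norm x powr a \<le> (1 + norm x) powr a" using a by (intro powr_mono2) auto
    also have "\<dots> \<le> (1 + norm x) powr real j" using j by (intro powr_mono) auto
    also have "\<dots> = (1 + norm x) ^ j" by (simp add: powr_realpow add_pos_nonneg)
    finally show ?thesis by simp
  qed
  then have "rapid (\<lambda>x. complex_of_real (norm x powr a) * herm e m 1 x)"
    by (rule rapid_weighted) (intro herm_rapid e, simp)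
  from integrable_norm[OF rapid_integrable(1)[OF this]] show ?thesis
    by (simp add: norm_mult)
qed

text \<open>After rescaling to length sqrt r the nonlinearity is compared with its value on b (x
  \<bullet> e). The error has a part of the same order with a small factor \<epsilon>, and a part of
  one order higher in |x|, which gains sqrt r. Each is made at most a quarter of the main term,
  uniformly in t and r.\<close>

lemma nonlin_pairing_asymptotics:
  fixes e :: "'a::euclidean_space" and w :: "real \<Rightarrow> 'a \<Rightarrow>\<^sub>C complex"
  assumes \<alpha>: "0 < \<alpha>" "\<alpha> < 1" and e: "e \<in> Basis" and b: "0 < b" and L: "0 \<le> L"
    and lin: "\<And>\<epsilon>. 0 < \<epsilon> \<Longrightarrow> \<exists>\<tau>>0. \<exists>\<delta>>0. \<forall>t\<in>{0..\<tau>}. \<forall>x. norm x \<le> \<delta> \<longrightarrow>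
        norm (w t x - complex_of_real (b * (x \<bullet> e))) \<le> \<epsilon> * norm x"
    and gl: "\<And>t x. t \<in> {0..\<tau>0} \<Longrightarrow> norm (w t x) \<le> L * norm x" and \<tau>0: "0 < \<tau>0"
        and J: "herm_moment \<alpha> e m \<noteq> 0"
  shows "\<exists>\<tau>>0. \<tau> \<le> \<tau>0 \<and> (\<forall>t\<in>{0..\<tau>}. \<forall>r\<in>{0<..\<tau>}.
     norm ((pairing e m r (power_nonlin \<alpha> (w t))) - (b powr (1 + \<alpha>) * r powr ((1 + \<alpha> - m) / 2)) *\<^sub>R
         herm_moment \<alpha> e m)
       \<le> b powr (1 + \<alpha>) * norm (herm_moment \<alpha> e m) / 2 * r powr ((1 + \<alpha> - m) / 2))"
proof -
  define A where "A = max L b"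
  have A: "0 < A" "L \<le> A" "b \<le> A" using b by (auto simp: A_def)
  define P1 where "P1 = (LINT y|lborel. norm y powr (1 + \<alpha>) * norm (herm e m 1 y))"
  define P2 where "P2 = (LINT y|lborel. norm y powr (2 + \<alpha>) * norm (herm e m 1 y))"
  have P: "0 \<le> P1" "0 \<le> P2" unfolding P1_def P2_def by (intro integral_nonneg_AE; simp)+
  \<comment> \<open>Half the modulus of the leading coefficient; each of the two parts of the error
    is allowed K/2.\<close>
  define K where "K = b powr (1 + \<alpha>) * norm (herm_moment \<alpha> e m) / 2"
  have K: "0 < K" using b J by (simp add: K_def)
  define B where "B = 2 * A powr \<alpha>"
  have B: "0 < B" using A by (simp add: B_def)
  define X where "X = B * P1 + 1"
  define \<epsilon> where "\<epsilon> = K / (2 * X)"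
  have BP: "0 < X" using B P by (simp add: X_def add_nonneg_pos)
  have \<epsilon>: "0 < \<epsilon>" "B * (\<epsilon> * P1) \<le> K / 2"
  proof -
    show "0 < \<epsilon>" using K BP by (simp add: \<epsilon>_def)
    have "B * (\<epsilon> * P1) \<le> \<epsilon> * X" using \<open>0 < \<epsilon>\<close> by (simp add: X_def algebra_simps)
    also have "\<dots> = K / 2" using BP by (simp add: \<epsilon>_def)
    finally show "B * (\<epsilon> * P1) \<le> K / 2" .
  qed
  obtain \<tau>1 \<delta> where \<tau>1: "0 < \<tau>1" and \<delta>: "0 < \<delta>" and
    lin': "\<And>t x. t \<in> {0..\<tau>1} \<Longrightarrow> norm x \<le> \<delta> \<Longrightarrow> norm (w t x - complex_of_real (b * (x \<bullet> e)))
        \<le> \<epsilon> * norm x"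
    using lin[OF \<epsilon>(1)] by blast
  define Q where "Q = B * (2 * A / \<delta> * P2) + 1"
  have Q: "0 < Q" "B * (2 * A / \<delta> * P2) \<le> Q"
    unfolding Q_def using B A \<delta> P by (auto intro!: add_nonneg_pos)
  \<comment> \<open>Ensures sqrt r \<le> K / (2 Q), which controls the part of the error of order 2
    + \<alpha>.\<close>
  define \<tau>2 where "\<tau>2 = (K / (2 * Q))\<^sup>2"
  have \<tau>2: "0 < \<tau>2" using K Q by (simp add: \<tau>2_def)
  define \<tau> where "\<tau> = min \<tau>0 (min \<tau>1 \<tau>2)"
  have \<tau>: "0 < \<tau>" "\<tau> \<le> \<tau>0" "\<tau> \<le> \<tau>1" "\<tau> \<le> \<tau>2" using \<tau>0 \<tau>1 \<tau>2 by (auto simp: \<tau>_def)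
  \<comment> \<open>The nonlinearity evaluated at the linear function b (x \<bullet> e), using b >
    0.\<close>
  define F0 where "F0 x = complex_of_real (b powr (1 + \<alpha>) * (\<bar>x \<bullet> e\<bar> powr \<alpha> * (x \<bullet> e)))" for x :: 'a
  have diffF: "norm (power_nonlin \<alpha> (w t) x - F0 x)
      \<le> B * (\<epsilon> * norm x powr (1 + \<alpha>) + 2 * A / \<delta> * norm x powr (2 + \<alpha>))"
    if t: "t \<in> {0..\<tau>}" for t x
  proof -
    let ?z = "w t x" and ?v = "complex_of_real (b * (x \<bullet> e))"
    have xe: "\<bar>x \<bullet> e\<bar> \<le> norm x" by (rule Basis_le_norm[OF e])
    have z: "norm ?z \<le> A * norm x"
      using gl[of t x] t \<tau> mult_right_mono[OF A(2) norm_ge_zero[of x]] by auto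
    have z0: "norm ?v \<le> A * norm x"
      using mult_mono[OF A(3) xe] A b by (simp add: norm_mult abs_mult)
    have "F0 x = of_real (norm ?v powr \<alpha>) * ?v"
      using b by (simp add: F0_def norm_mult powr_mult powr_add mult_ac)
    then have "norm (power_nonlin \<alpha> (w t) x - F0 x) \<le> 2 * (A * norm x) powr \<alpha> * norm (?z - ?v)"
      using nonlin_lip[OF \<alpha>(1) _ z z0] \<alpha> by (simp add: apply_power_nonlin)
    \<comment> \<open>A single bound for all x: outside the ball of radius \<delta> the crude bound
      2 A |x| is multiplied by |x| / \<delta> \<ge> 1, which costs one more power of |x| and avoids
      splitting the integral.\<close>
    also have "\<dots> \<le> 2 * (A * norm x) powr \<alpha> * (\<epsilon> * norm x + 2 * A / \<delta> * (norm x * norm x))"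
    proof (rule mult_left_mono)
      show "norm (?z - ?v) \<le> \<epsilon> * norm x + 2 * A / \<delta> * (norm x * norm x)"
      proof (cases "norm x \<le> \<delta>")
        case True
        then have "norm (?z - ?v) \<le> \<epsilon> * norm x" using lin'[of t x] t \<tau> by auto
        moreover have "0 \<le> 2 * A / \<delta> * (norm x * norm x)" using A \<delta> by simp
        ultimately show ?thesis by linarith
      next
        case False
        have "norm (?z - ?v) \<le> 2 * A * norm x * 1"
          using norm_triangle_ineq4[of ?z ?v] z z0 by linarith
        also have "\<dots> \<le> 2 * A * norm x * (norm x / \<delta>)"
          using False \<delta> A by (intro mult_left_mono) auto
        also have "\<dots> = 0 + 2 * A / \<delta> * (norm x * norm x)" by simp
        also have "\<dots> \<le> \<epsilon> * norm x + 2 * A / \<delta> * (norm x * norm x)"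
          using \<epsilon> by (intro add_right_mono) simp
        finally show ?thesis .
      qed
    qed simp
    also have "\<dots> = B * (\<epsilon> * norm x powr (1 + \<alpha>) + 2 * A / \<delta> * norm x powr (2 + \<alpha>))"
      by (simp add: B_def powr_mult powr_add power2_eq_square algebra_simps)
    finally show ?thesis .
  qed
  have "norm ((pairing e m r (power_nonlin \<alpha> (w t))) - (b powr (1 + \<alpha>) * r powr ((1 + \<alpha> - m) / 2))
      *\<^sub>R herm_moment \<alpha> e m)
       \<le> K * r powr ((1 + \<alpha> - m) / 2)" if t: "t \<in> {0..\<tau>}" and r: "r \<in> {0<..\<tau>}" for t r
  proof -
    define c where "c = sqrt r"
    have c: "0 < c" "c \<le> K / (2 * Q)"
    proof -
      show "0 < c" using r by (simp add: c_def)
      have "sqrt r \<le> sqrt \<tau>2" using r \<tau> by simp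
      also have "sqrt \<tau>2 = K / (2 * Q)" using K Q by (simp add: \<tau>2_def)
      finally show "c \<le> K / (2 * Q)" by (simp add: c_def)
    qed
    have nd: "norm (z /\<^sub>R c ^ m) = norm z / c ^ m" for z :: complex
      using c(1) by (simp add: divide_inverse mult.commute)
    have cr: "c powr (1 + \<alpha> - m) = r powr ((1 + \<alpha> - m) / 2)"
      using r by (simp add: c_def powr_half_sqrt[symmetric] powr_powr)
    have F0c: "F0 (c *\<^sub>R y) = (b powr (1 + \<alpha>) * c powr (1 + \<alpha>))
        *\<^sub>R complex_of_real (\<bar>y \<bullet> e\<bar> powr \<alpha> * (y \<bullet> e))" for y
      using c(1) by (simp add: F0_def scaleR_conv_of_real abs_mult powr_mult powr_add mult_ac)
    have "herm e m 1 \<in> borel_measurable borel" by (intro herm_measurable e) simp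
    note [measurable] = this
    have hi: "integrable lborel (\<lambda>y. norm (herm e m 1 y))"
      by (intro integrable_norm herm_integrable e) simp
    have i1: "integrable lborel (\<lambda>y. power_nonlin \<alpha> (w t) (c *\<^sub>R y) * herm e m 1 y)"
    proof (rule Bochner_Integration.integrable_bound)
      show "integrable lborel (\<lambda>y. norm (power_nonlin \<alpha> (w t)) * norm (herm e m 1 y))"
        by (intro integrable_mult_right hi)
      show "AE y in lborel. norm (power_nonlin \<alpha> (w t) (c *\<^sub>R y) * herm e m 1 y)
          \<le> norm (norm (power_nonlin \<alpha> (w t)) * norm (herm e m 1 y))"
        by (auto simp: norm_mult norm_bounded intro!: mult_right_mono)
    qed measurable
    have i0: "integrable lborel (\<lambda>y. F0 (c *\<^sub>R y) * herm e m 1 y)"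
      using integrable_scaleR_right[OF herm_weight1_integrable[OF e \<alpha>, of m], of
          "b powr (1 + \<alpha>) * c powr (1 + \<alpha>)"]
      unfolding F0c by (simp only: mult_scaleR_left)
    have "(LINT y|lborel. F0 (c *\<^sub>R y) * herm e m 1 y)
        = (b powr (1 + \<alpha>) * c powr (1 + \<alpha>)) *\<^sub>R herm_moment \<alpha> e m"
      unfolding F0c herm_moment_def mult_scaleR_left by (rule integral_scaleR_right)
    moreover have "r powr ((1 + \<alpha> - m) / 2) = c powr (1 + \<alpha>) / c ^ m"
      unfolding cr[symmetric] using c(1) by (simp add: powr_diff powr_realpow)
    moreover have "(pairing e m r (power_nonlin \<alpha> (w t)))
        = (LINT y|lborel. power_nonlin \<alpha> (w t) (c *\<^sub>R y) * herm e m 1 y) /\<^sub>R c ^ m"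
      using r unfolding c_def by (intro herm_pairing_scale) simp
    ultimately have "(pairing e m r (power_nonlin \<alpha> (w t)))
        - (b powr (1 + \<alpha>) * r powr ((1 + \<alpha> - m) / 2)) *\<^sub>R herm_moment \<alpha> e m
      = ((LINT y|lborel. power_nonlin \<alpha> (w t) (c *\<^sub>R y) * herm e m 1 y) -
          (LINT y|lborel. F0 (c *\<^sub>R y) * herm e m 1 y)) /\<^sub>R c ^ m"
      by (simp only: scaleR_diff_right scaleR_scaleR divide_inverse mult_ac)
    also have "\<dots> = (LINT y|lborel. (power_nonlin \<alpha> (w t) (c *\<^sub>R y) - F0 (c *\<^sub>R y))
        * herm e m 1 y) /\<^sub>R c ^ m"
      by (simp only: left_diff_distrib Bochner_Integration.integral_diff[OF i1 i0])
    also have "norm \<dots> = norm (LINT y|lborel. (power_nonlin \<alpha> (w t) (c *\<^sub>R y) - F0 (c *\<^sub>R y))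
        * herm e m 1 y) / c ^ m"
      by (rule nd)
    also have "\<dots> \<le> (LINT y|lborel. (B * \<epsilon> * c powr (1 + \<alpha>))
        * (norm y powr (1 + \<alpha>) * norm (herm e m 1 y)) +
        (B * (2 * A / \<delta>) * c powr (2 + \<alpha>)) * (norm y powr (2 + \<alpha>) * norm (herm e m 1 y))) / c ^ m"
    proof (intro divide_right_mono norm_integral_le)
      show "integrable lborel (\<lambda>y. (B * \<epsilon> * c powr (1 + \<alpha>))
          * (norm y powr (1 + \<alpha>) * norm (herm e m 1 y)) +
        (B * (2 * A / \<delta>) * c powr (2 + \<alpha>)) * (norm y powr (2 + \<alpha>) * norm (herm e m 1 y)))"
        using \<alpha> by (intro Bochner_Integration.integrable_add integrable_mult_right
            herm_norm_moment_integrable e) auto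
      fix y :: 'a
      have "norm (c *\<^sub>R y) powr a = c powr a * norm y powr a" for a using c(1)
          by (simp add: powr_mult)
      then show "norm ((power_nonlin \<alpha> (w t) (c *\<^sub>R y) - F0 (c *\<^sub>R y)) * herm e m 1 y) \<le>
        (B * \<epsilon> * c powr (1 + \<alpha>)) * (norm y powr (1 + \<alpha>) * norm (herm e m 1 y)) +
        (B * (2 * A / \<delta>) * c powr (2 + \<alpha>)) * (norm y powr (2 + \<alpha>) * norm (herm e m 1 y))"
        using mult_right_mono[OF diffF[OF t, of "c *\<^sub>R y"] norm_ge_zero[of "herm e m 1 y"]]
        by (simp only: norm_mult) (simp add: algebra_simps)
    qed (use c(1) in simp)
    also have "\<dots> = ((B * \<epsilon> * c powr (1 + \<alpha>)) * P1 + (B * (2 * A / \<delta>) * c powr (2 + \<alpha>))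
        * P2) / c ^ m"
      unfolding P1_def P2_def using \<alpha> e
      by (subst Bochner_Integration.integral_add)
          (auto intro!: integrable_mult_right herm_norm_moment_integrable)
    also have "\<dots> = (B * (\<epsilon> * P1) + (B * (2 * A / \<delta> * P2)) * c) * c powr (1 + \<alpha> - m)"
      using c(1) by (simp add: powr_diff powr_realpow powr_add power2_eq_square algebra_simps
          add_divide_distrib)
    also have "\<dots> \<le> (K / 2 + Q * c) * c powr (1 + \<alpha> - m)"
      using \<epsilon> Q c by (intro mult_right_mono add_mono) auto
    also have "\<dots> \<le> (K / 2 + K / 2) * c powr (1 + \<alpha> - m)"
      using Q c by (intro mult_right_mono add_mono) (auto simp: field_simps)
    finally show ?thesis by (simp add: cr)
  qed
  then show ?thesis using \<tau> unfolding K_def by blast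
qed


text \<open>Bounded linearity lets the pairing pass through the Duhamel integral, whose values are
  bounded continuous functions.\<close>

lemma herm_pairing_bounded_linear:
  fixes e :: "'a::euclidean_space"
  assumes r: "0 < r" and e: "e \<in> Basis"
  shows "bounded_linear (\<lambda>f :: 'a \<Rightarrow>\<^sub>C complex. LINT x|lborel. f x * herm e m r x)"
    and "norm (pairing e m r (apply_bcontfun f)) \<le> norm f * (LINT x|lborel. norm (herm e m r x))"
proof -
  note [measurable] = herm_measurable[OF r e]
  have hi: "integrable lborel (\<lambda>x. norm (herm e m r x))"
    by (intro integrable_norm herm_integrable r e)
  have le: "norm (f x * herm e m r x) \<le> norm f * norm (herm e m r x)" for f :: "'a \<Rightarrow>\<^sub>C complex"
      and x
    unfolding norm_mult by (intro mult_right_mono norm_bounded) auto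
  have int: "integrable lborel (\<lambda>x. f x * herm e m r x)" for f :: "'a \<Rightarrow>\<^sub>C complex"
  proof (rule Bochner_Integration.integrable_bound)
    show "integrable lborel (\<lambda>x. norm f * norm (herm e m r x))" by (intro integrable_mult_right hi)
    show "AE x in lborel. norm (f x * herm e m r x) \<le> norm (norm f * norm (herm e m r x))"
      using le by (auto simp: abs_mult)
  qed measurable
  show bd: "norm (pairing e m r f) \<le> norm f * (LINT x|lborel. norm (herm e m r x))"
      for f :: "'a \<Rightarrow>\<^sub>C complex"
    unfolding integral_mult_right_zero[symmetric]
        by (intro norm_integral_le integrable_mult_right hi le)
  show "bounded_linear (\<lambda>f :: 'a \<Rightarrow>\<^sub>C complex. LINT x|lborel. f x * herm e m r x)"
  proof (rule bounded_linear_intro[OF _ _ bd])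
    fix f g :: "'a \<Rightarrow>\<^sub>C complex" and c :: real
    show "(pairing e m r (f + g)) = (pairing e m r f) + (pairing e m r g)"
      by (simp add: distrib_right Bochner_Integration.integral_add[OF int int])
    show "(LINT x|lborel. (c *\<^sub>R f) x * herm e m r x) = c *\<^sub>R (pairing e m r f)"
      by simp
  qed
qed

lemma mild_solution_pairing:
  fixes e :: "'a::euclidean_space" and u :: "real \<Rightarrow> 'a \<Rightarrow>\<^sub>C complex"
  assumes u: "mild_solution \<alpha> \<kappa> u0 T u" and t: "0 \<le> t" "ereal t < T" and r: "0 < r"
      and e: "e \<in> Basis"
  shows "(\<lambda>\<sigma>. LINT x|lborel. power_nonlin \<alpha> (u \<sigma>) x
      * herm e m (r + (t - \<sigma>)) x) integrable_on {0..t}"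
    and "(pairing e m r (u t)) = (pairing e m (r + t) u0) +
      \<kappa> * integral {0..t} (\<lambda>\<sigma>. LINT x|lborel. power_nonlin \<alpha> (u \<sigma>) x * herm e m (r + (t - \<sigma>)) x)"
proof -
  let ?h = "\<lambda>\<sigma>. heat_semigroup (t - \<sigma>) (power_nonlin \<alpha> (u \<sigma>))"
  let ?L = "\<lambda>f :: 'a \<Rightarrow>\<^sub>C complex. LINT x|lborel. f x * herm e m r x"
  note L = herm_pairing_bounded_linear(1)[OF r e, of m]
  have h: "?h integrable_on {0..t}" and ut: "\<And>x. u t x
      = heat_semigroup t u0 x + \<kappa> * integral {0..t} ?h x"
    using u t unfolding mild_solution_def by auto
  have Lh: "?L (?h \<sigma>) = (pairing e m (r + (t - \<sigma>)) (power_nonlin \<alpha> (u \<sigma>)))" if "\<sigma> \<in> {0..t}" for \<sigma>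
    using that by (intro herm_heat_pairing r e) auto
  show "(\<lambda>\<sigma>. LINT x|lborel. power_nonlin \<alpha> (u \<sigma>) x * herm e m (r + (t - \<sigma>)) x) integrable_on {0..t}"
    by (rule integrable_eq[OF integrable_linear[OF h L]]) (simp add: Lh)
  have "u t = heat_semigroup t u0 + cmul_bcontfun \<kappa> (integral {0..t} ?h)"
    by (rule bcontfun_eqI) (simp add: ut)
  then have "?L (u t) = ?L (heat_semigroup t u0) + ?L (cmul_bcontfun \<kappa> (integral {0..t} ?h))"
    by (simp only: linear_add[OF bounded_linear.linear[OF L]])
  also have "?L (cmul_bcontfun \<kappa> (integral {0..t} ?h)) = \<kappa> * ?L (integral {0..t} ?h)"
    by (simp add: mult.assoc)
  also have "?L (integral {0..t} ?h) = integral {0..t} (\<lambda>\<sigma>. ?L (?h \<sigma>))"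
    using integral_linear[OF h L] by (simp add: comp_def)
  also have "\<dots> = integral {0..t} (\<lambda>\<sigma>. LINT x|lborel. power_nonlin \<alpha> (u \<sigma>) x
      * herm e m (r + (t - \<sigma>)) x)"
    by (rule integral_cong[OF Lh])
  also have "?L (heat_semigroup t u0) = (pairing e m (r + t) u0)"
    by (rule herm_heat_pairing[OF r t(1) e])
  finally show "?L (u t) = (pairing e m (r + t) u0) +
      \<kappa> * integral {0..t} (\<lambda>\<sigma>. LINT x|lborel. power_nonlin \<alpha> (u \<sigma>) x * herm e m (r + (t - \<sigma>)) x)" .
qed

text \<open>Applied to the datum at time r + t: away from time 0 the pairing stays bounded, whereas
  the Duhamel part blows up as h -> 0.\<close>

lemma herm_pairing_decay:
  fixes e :: "'a::euclidean_space" and f :: "'a \<Rightarrow>\<^sub>C complex"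
  assumes e: "e \<in> Basis" and t: "0 < t"
  shows "\<exists>C. \<forall>r\<ge>t. norm (pairing e m r f) \<le> C"
proof -
  let ?P = "LINT y|lborel. norm (herm e m 1 y)"
  have "norm (pairing e m r f) \<le> norm f * ?P / sqrt t ^ m" if r: "t \<le> r" for r
  proof -
    have r0: "0 < r" using r t by simp
    have "norm (pairing e m r f) = norm (LINT y|lborel. f (sqrt r *\<^sub>R y)
        * herm e m 1 y) / sqrt r ^ m"
      using r0 by (subst herm_pairing_scale) (auto simp: divide_inverse mult.commute)
    also have "\<dots> \<le> (LINT y|lborel. norm f * norm (herm e m 1 y)) / sqrt r ^ m"
      using r0 e by (intro divide_right_mono norm_integral_le integrable_mult_right integrable_norm
          herm_integrable)
        (auto simp: norm_mult norm_bounded intro!: mult_right_mono)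
    also have "\<dots> = norm f * ?P / sqrt r ^ m" by simp
    also have "\<dots> \<le> norm f * ?P / sqrt t ^ m"
      using r t by (intro divide_left_mono power_mono mult_nonneg_nonneg integral_nonneg_AE) auto
    finally show ?thesis .
  qed
  then show ?thesis by blast
qed

text \<open>Divided by h^(3 + \<alpha> - m), the upper bound consists of h^(s' - N/p - 3 - \<alpha>)
  and h^(m - 3 - \<alpha>), both with positive exponents, while the lower bound is a positive
  constant. The room between t and \<tau> keeps every scale h^2 + (t - \<sigma>) in the range of the
  asymptotics.\<close>

lemma not_Hsp:
  fixes e :: "'a::euclidean_space" and u :: "real \<Rightarrow> 'a \<Rightarrow>\<^sub>C complex"
  assumes \<alpha>: "0 < \<alpha>" "\<alpha> < 1" and \<kappa>: "\<kappa> \<noteq> 0" and e: "e \<in> Basis" and b: "0 < b"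
    and u: "mild_solution \<alpha> \<kappa> u0 T u" and t: "0 < t" "ereal t < T" and t\<tau>: "t < \<tau>"
    and J: "herm_moment \<alpha> e m \<noteq> 0"
    and asym: "\<And>\<sigma> r. \<sigma> \<in> {0..t} \<Longrightarrow> r \<in> {0<..\<tau>} \<Longrightarrow>
       norm ((pairing e m r (power_nonlin \<alpha> (u \<sigma>))) -
           (b powr (1 + \<alpha>) * r powr ((1 + \<alpha> - m) / 2)) *\<^sub>R herm_moment \<alpha> e m)
       \<le> b powr (1 + \<alpha>) * norm (herm_moment \<alpha> e m) / 2 * r powr ((1 + \<alpha> - m) / 2)"
    and p: "1 < p" and s': "3 + real DIM('a) / p + \<alpha> < s'" "s' < s"
        and m: "real DIM('a) + s' \<le> real m"
  shows "regular_distribution (apply_bcontfun (u t)) \<notin> Hsp s p"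
proof
  let ?N = "real DIM('a)"
  assume H: "regular_distribution (apply_bcontfun (u t)) \<in> Hsp s p"
  have Np: "0 \<le> ?N / p" using p by simp
  have s0: "0 < s'" using s'(1) Np \<alpha> by linarith
  have m3: "3 + \<alpha> < real m" using s'(1) Np m by linarith
  obtain C where C: "\<And>h. 0 < h \<Longrightarrow> norm (pairing e m (h\<^sup>2) (u t)) \<le> C * h powr (s' - m - ?N / p)"
    using Hsp_herm_bound[OF H p s0 s'(2) e m] by blast
  obtain D where D: "\<And>r. t \<le> r \<Longrightarrow> norm (pairing e m r u0) \<le> D"
    using herm_pairing_decay[OF e t(1)] by blast
  define \<gamma> where "\<gamma> = (1 + \<alpha> - m) / 2"
  have \<gamma>: "\<gamma> < 0" using m3 by (simp add: \<gamma>_def)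
  define K where "K = b powr (1 + \<alpha>) * norm (herm_moment \<alpha> e m)"
  have K: "0 < K" using b J by (simp add: K_def)
  \<comment> \<open>The factor 1/2 is the loss to the error term, and 2^\<gamma> comes from
    evaluating the integrand at the scale 2 h^2.\<close>
  define q where "q = norm \<kappa> * (K / 2 * 2 powr \<gamma>)"
  have q: "0 < q" using \<kappa> K by (simp add: q_def)
  have key: "q \<le> C * h powr (s' - ?N / p - 3 - \<alpha>) + D * h powr (real m - 3 - \<alpha>)"
    if h: "0 < h" "h\<^sup>2 \<le> t" "h\<^sup>2 + t \<le> \<tau>" for h
  proof -
    let ?r = "h\<^sup>2"
    have r: "0 < ?r" using h by simp
    let ?Z = "\<lambda>\<sigma>. LINT x|lborel. power_nonlin \<alpha> (u \<sigma>) x * herm e m (?r + (t - \<sigma>)) x"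
    let ?R = "\<lambda>\<sigma>. (?r + (t - \<sigma>)) powr \<gamma>"
    let ?J = "b powr (1 + \<alpha>) *\<^sub>R herm_moment \<alpha> e m"
    note Z = mild_solution_pairing[OF u less_imp_le[OF t(1)] t(2) r e, of m]
    have Rc: "continuous_on {0..t} ?R"
      using r by (intro continuous_intros) (auto simp: add_pos_nonneg less_imp_neq[symmetric])
    have Ri: "?R integrable_on S" if "S = {0..t} \<or> S = {t - ?r..t}" for S
      using that h by (auto intro!: integrable_continuous_real continuous_on_subset[OF Rc])
    have JR: "(\<lambda>\<sigma>. ?R \<sigma> *\<^sub>R ?J) integrable_on {0..t}"
      using integrable_linear[OF Ri[of "{0..t}"] bounded_linear_scaleR_left[of ?J]]
          by (simp add: comp_def)
    have intJR: "integral {0..t} (\<lambda>\<sigma>. ?R \<sigma> *\<^sub>R ?J) = integral {0..t} ?R *\<^sub>R ?J"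
      using integral_linear[OF Ri[of "{0..t}"] bounded_linear_scaleR_left[of ?J]]
          by (simp add: comp_def)
    have "norm (integral {0..t} ?Z - integral {0..t} ?R *\<^sub>R ?J)
        = norm (integral {0..t} (\<lambda>\<sigma>. ?Z \<sigma> - ?R \<sigma> *\<^sub>R ?J))"
      by (simp only: Henstock_Kurzweil_Integration.integral_diff[OF Z(1) JR] intJR)
    also have "\<dots> \<le> integral {0..t} (\<lambda>\<sigma>. K / 2 * ?R \<sigma>)"
    proof (rule integral_norm_bound_integral)
      show "(\<lambda>\<sigma>. ?Z \<sigma> - ?R \<sigma> *\<^sub>R ?J) integrable_on {0..t}" by (intro integrable_diff Z JR)
      show "(\<lambda>\<sigma>. K / 2 * ?R \<sigma>) integrable_on {0..t}" by (intro integrable_on_mult_right Ri) simp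
      fix \<sigma> assume \<sigma>: "\<sigma> \<in> {0..t}"
      then have "?r + (t - \<sigma>) \<in> {0<..\<tau>}" using r h by (auto intro: add_pos_nonneg)
      from asym[OF \<sigma> this] show "norm (?Z \<sigma> - ?R \<sigma> *\<^sub>R ?J) \<le> K / 2 * ?R \<sigma>"
        by (simp add: K_def \<gamma>_def mult.commute)
    qed
    also have "\<dots> = K / 2 * integral {0..t} ?R" by simp
    finally have 1: "norm (integral {0..t} ?Z - integral {0..t} ?R *\<^sub>R ?J)
        \<le> K / 2 * integral {0..t} ?R" .
    have IR0: "0 \<le> integral {0..t} ?R" by (intro integral_nonneg Ri) auto
    \<comment> \<open>The coefficient \<open>?J\<close> does not depend on \<sigma> and
      \<open>?R\<close> is nonnegative, so the model integral has no cancellation; half of it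
      survives the error.\<close>
    have "norm (integral {0..t} ?R *\<^sub>R ?J) = K * integral {0..t} ?R"
      using IR0 by (simp add: K_def mult.commute)
    then have 2: "K / 2 * integral {0..t} ?R \<le> norm (integral {0..t} ?Z)"
      using 1 norm_triangle_ineq2[of "integral {0..t} ?R *\<^sub>R ?J" "integral {0..t} ?Z"]
      by (simp add: norm_minus_commute)
    \<comment> \<open>Only the last window of length h^2 is kept. There the scale is at most 2 h^2,
      and the exponent \<gamma> is negative.\<close>
    have "(2 * ?r) powr \<gamma> * ?r = integral {t - ?r..t} (\<lambda>_. (2 * ?r) powr \<gamma>)"
      using r by simp
    also have "\<dots> \<le> integral {t - ?r..t} ?R"
      using r h \<gamma> by (intro integral_le Ri integrable_const_ivl powr_mono2')
          (auto intro!: add_pos_nonneg)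
    also have "\<dots> \<le> integral {0..t} ?R"
      using h by (intro integral_subset_le Ri) auto
    finally have 3: "(2 * ?r) powr \<gamma> * ?r \<le> integral {0..t} ?R" .
    have pw: "(2 * ?r) powr \<gamma> * ?r = 2 powr \<gamma> * h powr (3 + \<alpha> - m)"
    proof -
      have "?r = h powr 2" using h by (simp add: powr_numeral)
      then have "?r powr \<gamma> * ?r = h powr (2 * \<gamma> + 2)"
        by (simp add: powr_powr powr_add)
      also have "2 * \<gamma> + 2 = 3 + \<alpha> - m" by (simp add: \<gamma>_def)
      finally show ?thesis by (simp add: powr_mult mult.assoc)
    qed
    have "q * h powr (3 + \<alpha> - m) = norm \<kappa> * (K / 2 * ((2 * ?r) powr \<gamma> * ?r))"
      by (simp add: q_def pw)
    also have "\<dots> \<le> norm \<kappa> * norm (integral {0..t} ?Z)"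
    proof (intro mult_left_mono norm_ge_zero)
      have "K / 2 * ((2 * ?r) powr \<gamma> * ?r) \<le> K / 2 * integral {0..t} ?R"
        using K by (intro mult_left_mono 3) simp
      then show "K / 2 * ((2 * ?r) powr \<gamma> * ?r) \<le> norm (integral {0..t} ?Z)"
        using 2 by (rule order_trans)
    qed
    also have "\<dots> = norm ((pairing e m ?r (u t)) - (pairing e m (?r + t) u0))"
      by (simp add: Z(2) norm_mult)
    also have "\<dots> \<le> C * h powr (s' - m - ?N / p) + D"
      using h C[OF h(1)] D[of "?r + t"] by (intro order_trans[OF norm_triangle_ineq4] add_mono) auto
    finally have "q * h powr (3 + \<alpha> - m) * h powr (real m - 3 - \<alpha>)
        \<le> (C * h powr (s' - m - ?N / p) + D) * h powr (real m - 3 - \<alpha>)"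
      by (rule mult_right_mono) simp
    then show ?thesis
      using h by (simp add: distrib_right mult.assoc powr_add[symmetric] algebra_simps)
  qed
  have "((\<lambda>h. C * h powr (s' - ?N / p - 3 - \<alpha>) + D * h powr (real m - 3 - \<alpha>))
      \<longlongrightarrow> C * 0 + D * 0) (at_right 0)"
  proof (intro tendsto_intros)
    have *: "((\<lambda>h. h powr a) \<longlongrightarrow> 0) (at_right (0::real))" if "0 < a" for a :: real
      using that by real_asymp
    show "((\<lambda>h. h powr (s' - ?N / p - 3 - \<alpha>)) \<longlongrightarrow> 0) (at_right 0)" using s' by (intro *) simp
    show "((\<lambda>h. h powr (real m - 3 - \<alpha>)) \<longlongrightarrow> 0) (at_right 0)" using m3 by (intro *) simp
  qed
  then have "\<forall>\<^sub>F h in at_right 0. C * h powr (s' - ?N / p - 3 - \<alpha>) + D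
      * h powr (real m - 3 - \<alpha>) < q"
    using order_tendstoD(2)[of _ 0] q by simp
  moreover have "\<forall>\<^sub>F h in at_right 0. h\<^sup>2 < min t (\<tau> - t)"
  proof -
    have "((\<lambda>h::real. h\<^sup>2) \<longlongrightarrow> 0\<^sup>2) (at_right 0)" by (intro tendsto_intros)
    then show ?thesis using t(1) t\<tau> by (intro order_tendstoD(2)[of _ 0]) auto
  qed
  moreover have "\<forall>\<^sub>F h in at_right 0. (0::real) < h" by (rule eventually_at_right_less)
  ultimately have "\<forall>\<^sub>F h in at_right (0::real). False"
  proof eventually_elim
    case (elim h)
    then show ?case using key[of h] by simp
  qed
  then show False by simp
qed

text \<open>The interval (0, a) has positive measure, so a property valid almost everywhere holds at
  some arbitrarily small time.\<close>

lemma AE_interval_witness: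
  assumes "AE t in lebesgue_on {0<..<T}. P t" "0 < (a::real)" "a \<le> T"
  shows "\<exists>t. 0 < t \<and> t < a \<and> P t"
proof (rule ccontr)
  assume *: "\<not> ?thesis"
  have "AE t in lebesgue. t \<in> {0<..<T} \<longrightarrow> P t"
    using assms(1) by (simp add: AE_restrict_space_iff)
  then have "AE t in lebesgue. t \<notin> {0<..<a}"
    by eventually_elim (use * assms(3) in auto)
  then have "{0<..<a} \<in> null_sets lebesgue"
    by (subst AE_iff_null_sets) auto
  then have "emeasure lebesgue {0<..<a} = 0" by (rule null_setsD1)
  then show False using assms(2) by simp
qed

theorem corollary1p2:
  fixes \<alpha> :: real and \<kappa> :: complex
  assumes "0 < \<alpha>" and "\<alpha> < 1" and "\<kappa> \<noteq> 0"
  shows "\<exists>u0 :: (real ^ 'n) \<Rightarrow>\<^sub>C complex.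
    apply_bcontfun u0 \<in> Cc_smooth \<and>
    (\<exists>Tmax u. maximal_solution \<alpha> \<kappa> u0 Tmax u) \<and>
    (\<forall>Tmax u. maximal_solution \<alpha> \<kappa> u0 Tmax u \<longrightarrow>
      (\<forall>(p::real) (s::real) (T::real).
        1 < p \<and> s > 3 + real CARD('n) / p + \<alpha> \<and> 0 < T \<and> ereal T < Tmax \<longrightarrow>
        \<not> L1_Hsp s p T (\<lambda>t. regular_distribution (apply_bcontfun (u t)))))"
proof -
  note \<alpha> = assms(1,2) less_imp_le[OF assms(2)]
  obtain e :: "real ^ 'n" where e: "e \<in> Basis" using nonempty_Basis by blast
  define u0 where "u0 = datum_bc e"
  note u0 = apply_datum_bc[OF e, folded u0_def]
  obtain L where L: "0 \<le> L" "lip_fun L (datum e)"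
    using bump_span_lip[OF datum_bump_span[OF e]] by blast
  have "u0 \<in> C0" "odd_fun u0" "lip_fun L u0"
    using datum_bc_C0[OF e] datum_odd L(2) by (auto simp: u0_def apply_datum_bc[OF e])
  from local_existence[OF \<alpha>(1,3) this L(1), of \<kappa>]
  obtain \<tau>0 M w where \<tau>0: "0 < \<tau>0" and w: "mild_solution \<alpha> \<kappa> u0 (ereal \<tau>0) w"
      "continuous_on {0..\<tau>0} w"
    and wQ: "\<forall>t\<in>{0..\<tau>0}. w t \<in> lip_ball M (2 * L)"
    by blast
  \<comment> \<open>The integral equation is available only for times strictly below \<tau>0;
    halving gives a closed interval inside.\<close>
  define \<tau>1 where "\<tau>1 = \<tau>0 / 2"
  have \<tau>1: "0 < \<tau>1" "\<tau>1 < \<tau>0" using \<tau>0 by (auto simp: \<tau>1_def)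
  have odd0: "f 0 = 0" if "odd_fun f" for f :: "real ^ 'n \<Rightarrow> complex"
    using that[unfolded odd_fun_def, rule_format, of 0] by simp
  \<comment> \<open>Oddness forces w(t) to vanish at the origin, so the Lipschitz constant bounds
    |w(t,x)| / |x|.\<close>
  have gl: "norm (w t x) \<le> 2 * L * norm x" if "t \<in> {0..\<tau>1}" for t x
  proof -
    have "odd_fun (w t)" "lip_fun (2 * L) (w t)" using wQ that \<tau>1 by (auto simp: lip_ball_def)
    then show ?thesis using odd0[of "w t"] unfolding lip_fun_def by (metis diff_zero)
  qed
  \<comment> \<open>The Duhamel term has a Lipschitz constant proportional to t and vanishes at the
    origin by oddness. For small t it is absorbed by one half of \<epsilon> |x|; the other half is
    for the heat evolution of the datum.\<close>
  have lin: "\<exists>\<tau>>0. \<exists>\<delta>>0. \<forall>t\<in>{0..\<tau>}. \<forall>x. norm x \<le> \<delta> \<longrightarrow>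
        norm (w t x - complex_of_real (exp (- 1) * (x \<bullet> e))) \<le> \<epsilon> * norm x" if \<epsilon>: "0 < \<epsilon>" for \<epsilon>
  proof -
    have "0 < \<epsilon> / 2" using \<epsilon> by simp
    from heat_datum_near_linear[OF e this]
    obtain \<tau>2 \<delta> where \<tau>2: "0 < \<tau>2" and \<delta>: "0 < \<delta>" and near: "\<And>t x. t \<in> {0..\<tau>2} \<Longrightarrow> norm x \<le> \<delta> \<Longrightarrow>
      norm (heat_semigroup t u0 x - complex_of_real (exp (- 1) * (x \<bullet> e))) \<le> \<epsilon> / 2 * norm x"
      unfolding u0_def by blast
    define A where "A = norm \<kappa> * (2 * M powr \<alpha> * (2 * L)) + 1"
    have A: "0 < A" "norm \<kappa> * (2 * M powr \<alpha> * (2 * L)) \<le> A" using L(1)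
        by (auto simp: A_def intro!: add_nonneg_pos)
    define \<tau> where "\<tau> = min \<tau>1 (min \<tau>2 (\<epsilon> / (2 * A)))"
    have \<tau>: "0 < \<tau>" "\<tau> \<le> \<tau>1" "\<tau> \<le> \<tau>2" "\<tau> \<le> \<epsilon> / (2 * A)" using \<tau>1 \<tau>2 \<epsilon> A by (auto simp: \<tau>_def)
    have "norm (w t x - complex_of_real (exp (- 1) * (x \<bullet> e))) \<le> \<epsilon> * norm x"
      if t: "t \<in> {0..\<tau>}" and x: "norm x \<le> \<delta>" for t x
    proof -
      have t': "0 \<le> t" "t \<le> \<tau>0" "ereal t < ereal \<tau>0" using t \<tau> \<tau>1 by auto
      note Dh = duhamel_props[OF \<alpha>(1,3) w(2) wQ t'(1,2)]
      have "norm (duhamel \<alpha> w t x) \<le> 2 * M powr \<alpha> * (2 * L) * t * norm x"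
        using Dh(5)[unfolded lip_fun_def, rule_format, of x 0] odd0[OF Dh(4)] by simp
      then have "norm (\<kappa> * duhamel \<alpha> w t x) \<le> norm \<kappa> * (2 * M powr \<alpha> * (2 * L) * t * norm x)"
        unfolding norm_mult by (rule mult_left_mono) simp
      also have "\<dots> = (norm \<kappa> * (2 * M powr \<alpha> * (2 * L))) * t * norm x" by simp
      also have "\<dots> \<le> A * (\<epsilon> / (2 * A)) * norm x"
        using A t t' \<tau> by (intro mult_right_mono mult_mono) auto
      also have "\<dots> = \<epsilon> / 2 * norm x" using A by simp
      finally have 1: "norm (\<kappa> * duhamel \<alpha> w t x) \<le> \<epsilon> / 2 * norm x" .
      have "w t x = heat_semigroup t u0 x + \<kappa> * duhamel \<alpha> w t x"
        using w(1) t' unfolding mild_solution_def duhamel_def by blast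
      then have "w t x - complex_of_real (exp (- 1) * (x \<bullet> e))
          = (heat_semigroup t u0 x - complex_of_real (exp (- 1) * (x \<bullet> e))) + \<kappa> * duhamel \<alpha> w t x"
        by simp
      also have "norm \<dots> \<le> \<epsilon> / 2 * norm x + \<epsilon> / 2 * norm x"
        using near[of t x] t \<tau> x 1 by (intro order_trans[OF norm_triangle_ineq] add_mono) auto
      finally show ?thesis by (simp add: algebra_simps)
    qed
    then show ?thesis using \<tau>(1) \<delta> by blast
  qed
  show ?thesis
  proof (intro exI[of _ u0] conjI allI impI)
    show "apply_bcontfun u0 \<in> Cc_smooth"
      unfolding u0 by (intro bump_span_Cc_smooth datum_bump_span e)
    show "\<exists>Tmax u. maximal_solution \<alpha> \<kappa> u0 Tmax u"
      by (rule maximal_solution_exists[OF \<alpha>(1,3) w(1)])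
    fix Tmax u and p s T :: real
    assume mx: "maximal_solution \<alpha> \<kappa> u0 Tmax u"
      and "1 < p \<and> s > 3 + real CARD('n) / p + \<alpha> \<and> 0 < T \<and> ereal T < Tmax"
    then have p: "1 < p" and s: "3 + real CARD('n) / p + \<alpha> < s" and T: "0 < T" "ereal T < Tmax"
        by auto
    have u: "mild_solution \<alpha> \<kappa> u0 Tmax u" using mx by (simp add: maximal_solution_def)
    obtain s' where s': "3 + real CARD('n) / p + \<alpha> < s'" "s' < s" using dense[OF s] by blast
    obtain k where k: "CARD('n) + s' \<le> real k" using real_arch_simple by blast
    \<comment> \<open>Odd for the sake of \<open>herm_moment_nonzero\<close>, and at least N + s' as
      the Bessel potential bound demands.\<close>
    define m where "m = 2 * k + 1"
    have m: "real DIM(real ^ 'n) + s' \<le> real m" using k by (simp add: m_def)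
    have J: "herm_moment \<alpha> e m \<noteq> 0" unfolding m_def by (rule herm_moment_nonzero[OF e \<alpha>(1,2)])
    have L2: "0 \<le> 2 * L" using L by simp
    obtain \<tau> where \<tau>: "0 < \<tau>" "\<tau> \<le> \<tau>1" and asym: "\<And>t r. t \<in> {0..\<tau>} \<Longrightarrow> r \<in> {0<..\<tau>} \<Longrightarrow>
     norm ((pairing e m r (power_nonlin \<alpha> (w t))) -
         (exp (- 1) powr (1 + \<alpha>) * r powr ((1 + \<alpha> - m) / 2)) *\<^sub>R herm_moment \<alpha> e m)
       \<le> exp (- 1) powr (1 + \<alpha>) * norm (herm_moment \<alpha> e m) / 2 * r powr ((1 + \<alpha> - m) / 2)"
      using nonlin_pairing_asymptotics[OF \<alpha>(1,2) e exp_gt_zero L2 lin gl \<tau>1(1) J] by blast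
    show "\<not> L1_Hsp s p T (\<lambda>t. regular_distribution (apply_bcontfun (u t)))"
    proof
      assume "L1_Hsp s p T (\<lambda>t. regular_distribution (apply_bcontfun (u t)))"
      then have "AE t in lebesgue_on {0<..<T}. regular_distribution (apply_bcontfun (u t)) \<in> Hsp s
          p"
        by (simp add: L1_Hsp_def)
      from AE_interval_witness[OF this, of "min T \<tau>"] T \<tau>
      obtain t where t: "0 < t" "t < T" "t < \<tau>"
          and H: "regular_distribution (apply_bcontfun (u t)) \<in> Hsp s p"
        by auto
      \<comment> \<open>Uniqueness transfers the asymptotics of the local solution to the given
        maximal solution on [0, t].\<close>
      have uw: "u \<sigma> = w \<sigma>" if "\<sigma> \<in> {0..t}" for \<sigma>
      proof (rule mild_solution_unique[OF \<alpha>(1,3) u w(1)])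
        show "ereal \<sigma> < Tmax" using ereal_le_less[OF _ T(2), of \<sigma>] that t by simp
        show "ereal \<sigma> < ereal \<tau>0" using that t \<tau> \<tau>1 by simp
      qed (use that in simp)
      have "regular_distribution (apply_bcontfun (u t)) \<notin> Hsp s p"
      proof (rule not_Hsp[OF \<alpha>(1,2) assms(3) e exp_gt_zero[of "- 1"] u t(1) _ t(3) J _ p _ s'(2) m])
        show "ereal t < Tmax" using ereal_le_less[OF _ T(2), of t] t by simp
        show "3 + real DIM(real ^ 'n) / p + \<alpha> < s'" using s' by simp
      qed (use asym uw t in auto)
      with H show False by blast
    qed
  qed
qed

end
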